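(* Let $X$ be a compact metric space and $f:X\to X$ a Borel measurable map with finite variational entropy $h(f)<\infty$. Let $\{\mathcal S,\tau\}$ be an inducing scheme (of hyperbolic type) for $f$ with inducing domain $W$. Assume that: (L1) $f$ has a finite generating partition $\mathcal P$ which is compatible to the inducing scheme $\{\mathcal S,\tau\}$; (L2) $\{\mathcal S,\tau\}$ has finite $\overline\varphi$-complexity for some potential function $\varphi:X\to\mathbb R$, where $\overline\varphi$ is the induced potential of $\varphi$. Then any ergodic measure $\mu\in\mathcal M(f,X)$ with $\mu(W)>0$ and $\mathcal K(\overline\varphi)<P_\mu(\varphi)<\infty$ is liftable, i.e. $\mu\in\mathcal M_L(f,Y)$.
   Context: **Entropy and measures.** $\mathcal M(f,X)$ is the set of $f$-invariant ergodic Borel probability measures on $X$; $h_\mu(f)$ is Kolmogorov–Sinai entropy; the variational entropy is $h(f)=\sup_{\mu\in\mathcal M(f,X)}h_\mu(f)$. The map $f$ may have discontinuities. For $\varphi:X\to\mathbb R$, $P_\mu(\varphi)=h_\mu(f)+\int\varphi\,d\mu$. **Inducing scheme (of hyperbolic type).** $\mathcal S=\{J_a\}_{a\in S}$ is a countable collection of disjoint Borel subsets of $X$ and $\tau:S\to\mathbb N$ takes positive integer values. Put $W=\bigcup_{a\in S}J_a$ (inducing domain) and $\tau(x)=\tau(a)$ for $x\in J_a$, $\tau(x)=0$ for $x\notin W$ (inducing time). One requires: - (I1) $f^{\tau(a)}(J_a)\subset W$ for all $a\in S$ and $\bigcup_{a\in S}f^{\tau(a)}(J_a)=W$. The induced map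 $F:W\to W$ is $F|_{J_a}=f^{\tau(a)}|_{J_a}$, and each $F|_{J_a}$ can be extended to a homeomorphism of a neighborhood of the closure $\overline{J_a}$. - (I2) For every $\underline a=(a_n)_{n\in\mathbb Z}\in S^{\mathbb Z}$ there is a unique sequence $(x_n)_{n\in\mathbb Z}$, $x_n=x_n(\underline a)$, such that (a) $x_n\in\overline{J_{a_n}}$ and $f^{\tau(a_n)}(x_n)=x_{n+1}$ (on closures, $f^{\tau(a_n)}$ is read via the extension of $F|_{J_{a_n}}$); (b) if $x_n(\underline a)=x_n(\underline b)$ for all $n\le0$ then $\underline a=\underline b$. - (I3) With $\sigma$ the left shift on $S^{\mathbb Z}$ and $\check S=\{\underline a\in S^{\mathbb Z}: x_n(\underline a)\in J_{a_n}\ \forall n\in\mathbb Z\}$, the set $S^{\mathbb Z}\setminus\check S$ supports no ergodic $\sigma$-invariant measure which gives positive mass to any open subset. - (I4) $F$ has at least one periodic orbit in $W$. **Liftable measures.** $Y=\bigcup_{k\ge0}f^k(W)=\{f^n(x):x\in W,\,0\le n<\tau(x)\}$. $\mathcal M(f,Y)$ and $\mathcal M(F,W)$ are the ergodic invariant Borel probability measures of $f$ on $Y$ and of $F$ on $W$. For $\nu\in\mathcal M(F,W)$ let $Q_\nu=\int_W\tau\,d\nu$; if $Q_\nu<\infty$, then $\mathcal L(\nu)\in\mathcal M(f,Y)$ is defined by $\mathcal L(\nu)(E)=\frac1{Q_\nu}\sum_{a\in S}\sum_{k=0}^{\tau(a)-1}\nu(f^{-k}E\cap J_a)$. $\mathcal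 M_L(f,Y)$ is the set of $\mu\in\mathcal M(f,Y)$ with $\mu=\mathcal L(\nu)$ for some $\nu\in\mathcal M(F,W)$ (with $Q_\nu<\infty$). **Induced potential and weighted complexity.** The induced potential of $\varphi$ is $\overline\varphi:W\to\mathbb R$, $\overline\varphi(x)=\sum_{k=0}^{\tau(x)-1}\varphi(f^k(x))$. Let $S_n=\{a\in S:\tau(a)=n\}$. For $\omega:W\to\mathbb R$, $\{\mathcal S,\tau\}$ has finite $\omega$-complexity if $U_n(\omega):=\sum_{a\in S_n}\sup_{x\in J_a}\exp(\omega(x))<\infty$ for all $n\ge1$ and $\mathcal K(\omega):=\limsup_{n\to\infty}\frac1n\log U_n(\omega)<\infty$ (with $\log0=-\infty$). **Partitions.** A measurable partition $\mathcal P$ of $X$ is compatible to $\{\mathcal S,\tau\}$ if for any $a\in S$ and any $0\le i<\tau(a)$ the set $f^i(J_a)$ is contained in an element of $\mathcal P$. It is generating if the smallest $\sigma$-algebra containing $\bigcup_{n\ge0}\mathcal P_n$ (or $\bigcup_{n\ge0}\widetilde{\mathcal P}_n$ if $f$ is invertible) is the Borel $\sigma$-algebra of $X$, where $\mathcal P_n=\bigvee_{k=0}^nf^{-k}\mathcal P$ and $\widetilde{\mathcal P}_n=\bigvee_{k=-n}^nf^{-k}\mathcal P$. *)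

theory Defs
  imports "HOL-Probability.Probability"
begin

text \<open>Only the underlying measurable space of \<open>N\<close> is used.\<close>

definition ergodic_measures :: "'a measure \<Rightarrow> ('a \<Rightarrow> 'a) \<Rightarrow> 'a measure set" where
  "ergodic_measures N T = {\<mu>. sets \<mu> = sets N \<and> prob_space \<mu> \<and>
     T \<in> N \<rightarrow>\<^sub>M N \<and> distr \<mu> N T = \<mu> \<and>
     (\<forall>A\<in>sets N. T -` A \<inter> space N = A \<longrightarrow> emeasure \<mu> A = 0 \<or> emeasure \<mu> A = 1)}"

definition measurable_partition :: "'a::topological_space set set \<Rightarrow> bool" where
  "measurable_partition P \<longleftrightarrow> partition_on UNIV P \<and> P \<subseteq> sets borel"

definition partition_join :: "('a \<Rightarrow> 'a) \<Rightarrow> 'a set set \<Rightarrow> nat \<Rightarrow> 'a set set" where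
  "partition_join f P n = {\<Inter>k\<le>n. (f ^^ k) -` A k |A. \<forall>k\<le>n. A k \<in> P} - {{}}"

text \<open>For bijective \<open>f\<close>, the negative index \<open>-k\<close> of the two-sided join contributes
  \<open>f\<^sup>k(A) = (f\<^sup>-\<^sup>1)\<^sup>-\<^sup>k(A)\<close>.\<close>

definition partition_join_two_sided :: "('a \<Rightarrow> 'a) \<Rightarrow> 'a set set \<Rightarrow> nat \<Rightarrow> 'a set set" where
  "partition_join_two_sided f P n =
     {(\<Inter>k\<le>n. (f ^^ k) -` A (int k)) \<inter> (\<Inter>k\<le>n. (f ^^ k) ` A (- int k)) |A.
        \<forall>k. \<bar>k\<bar> \<le> int n \<longrightarrow> A k \<in> P} - {{}}"

definition generating :: "('a::topological_space \<Rightarrow> 'a) \<Rightarrow> 'a set set \<Rightarrow> bool" where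
  "generating f P \<longleftrightarrow>
     sigma_sets UNIV (\<Union>n. if bij f then partition_join_two_sided f P n else partition_join f P n)
       = sets borel"

definition partition_entropy :: "'a measure \<Rightarrow> 'a set set \<Rightarrow> real" where
  "partition_entropy \<mu> P = - (\<Sum>A\<in>P. measure \<mu> A * ln (measure \<mu> A))"

definition entropy_wrt_partition :: "('a \<Rightarrow> 'a) \<Rightarrow> 'a measure \<Rightarrow> 'a set set \<Rightarrow> real" where
  "entropy_wrt_partition f \<mu> P =
     lim (\<lambda>n. partition_entropy \<mu> (partition_join f P n) / real (Suc n))"

definition ks_entropy :: "('a::topological_space \<Rightarrow> 'a) \<Rightarrow> 'a measure \<Rightarrow> ereal" where
  "ks_entropy f \<mu> =
     (SUP P\<in>{P. finite P \<and> measurable_partition P}. ereal (entropy_wrt_partition f \<mu> P))"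

definition variational_entropy :: "('a::topological_space \<Rightarrow> 'a) \<Rightarrow> ereal" where
  "variational_entropy f = (SUP \<mu>\<in>ergodic_measures borel f. ks_entropy f \<mu>)"

text \<open>Since \<open>\<infinity> - \<infinity> = \<infinity>\<close> in \<^typ>\<open>ereal\<close>, the value is \<open>\<infinity>\<close> when the integral is undefined;
  a finite value means that \<open>\<phi>\<close> is integrable, if it is measurable.\<close>

definition extended_integral :: "'a measure \<Rightarrow> ('a \<Rightarrow> real) \<Rightarrow> ereal" where
  "extended_integral M \<phi> =
     enn2ereal (\<integral>\<^sup>+x. ennreal (\<phi> x) \<partial>M) - enn2ereal (\<integral>\<^sup>+x. ennreal (- \<phi> x) \<partial>M)"

definition pressure :: "('a::topological_space \<Rightarrow> 'a) \<Rightarrow> ('a \<Rightarrow> real) \<Rightarrow> 'a measure \<Rightarrow> ereal" where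
  "pressure f \<phi> \<mu> = ks_entropy f \<mu> + extended_integral (completion \<mu>) \<phi>"

definition inducing_domain :: "'i set \<Rightarrow> ('i \<Rightarrow> 'a set) \<Rightarrow> 'a set" where
  "inducing_domain S J = (\<Union>a\<in>S. J a)"

definition inducing_time :: "'i set \<Rightarrow> ('i \<Rightarrow> 'a set) \<Rightarrow> ('i \<Rightarrow> nat) \<Rightarrow> 'a \<Rightarrow> nat" where
  "inducing_time S J \<tau> x =
     (if x \<in> inducing_domain S J then \<tau> (THE a. a \<in> S \<and> x \<in> J a) else 0)"

definition induced_map ::
    "('a \<Rightarrow> 'a) \<Rightarrow> 'i set \<Rightarrow> ('i \<Rightarrow> 'a set) \<Rightarrow> ('i \<Rightarrow> nat) \<Rightarrow> 'a \<Rightarrow> 'a" where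
  "induced_map f S J \<tau> x = (f ^^ inducing_time S J \<tau> x) x"

definition homeo_extension ::
    "('a::topological_space \<Rightarrow> 'a) \<Rightarrow> 'a set \<Rightarrow> nat \<Rightarrow> ('a \<Rightarrow> 'a) \<Rightarrow> bool" where
  "homeo_extension f A n g \<longleftrightarrow> (\<forall>x\<in>A. g x = (f ^^ n) x) \<and>
     (\<exists>U h. open U \<and> closure A \<subseteq> U \<and> homeomorphism U (g ` U) g h)"

text \<open>Two extensions agree on the closure of \<open>A\<close> by continuity (in a Hausdorff space), so the
  choice below is immaterial there.\<close>

definition closure_extension ::
    "('a::topological_space \<Rightarrow> 'a) \<Rightarrow> 'a set \<Rightarrow> nat \<Rightarrow> 'a \<Rightarrow> 'a" where
  "closure_extension f A n = (SOME g. homeo_extension f A n g)"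

definition follows_code :: "('a::topological_space \<Rightarrow> 'a) \<Rightarrow> ('i \<Rightarrow> 'a set) \<Rightarrow> ('i \<Rightarrow> nat) \<Rightarrow>
    (int \<Rightarrow> 'i) \<Rightarrow> (int \<Rightarrow> 'a) \<Rightarrow> bool" where
  "follows_code f J \<tau> a x \<longleftrightarrow>
     (\<forall>n. x n \<in> closure (J (a n)) \<and> closure_extension f (J (a n)) (\<tau> (a n)) (x n) = x (n + 1))"

definition coded_sequence :: "('a::topological_space \<Rightarrow> 'a) \<Rightarrow> ('i \<Rightarrow> 'a set) \<Rightarrow> ('i \<Rightarrow> nat) \<Rightarrow>
    (int \<Rightarrow> 'i) \<Rightarrow> int \<Rightarrow> 'a" where
  "coded_sequence f J \<tau> a = (THE x. follows_code f J \<tau> a x)"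

definition good_codes :: "('a::topological_space \<Rightarrow> 'a) \<Rightarrow> 'i set \<Rightarrow> ('i \<Rightarrow> 'a set) \<Rightarrow>
    ('i \<Rightarrow> nat) \<Rightarrow> (int \<Rightarrow> 'i) set" where
  "good_codes f S J \<tau> = {a. (\<forall>n. a n \<in> S) \<and> (\<forall>n. coded_sequence f J \<tau> a n \<in> J (a n))}"

definition left_shift :: "(int \<Rightarrow> 'i) \<Rightarrow> int \<Rightarrow> 'i" where
  "left_shift a n = a (n + 1)"

text \<open>The product \<open>\<sigma>\<close>-algebra is the Borel \<open>\<sigma>\<close>-algebra of the product topology,
  as \<open>S\<close> is countable and discrete.\<close>

definition code_space :: "'i set \<Rightarrow> (int \<Rightarrow> 'i) measure" where
  "code_space S = PiM UNIV (\<lambda>_. count_space S)"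

definition full_support :: "'i set \<Rightarrow> (int \<Rightarrow> 'i) measure \<Rightarrow> bool" where
  "full_support S m \<longleftrightarrow>
     (\<forall>U. openin (product_topology (\<lambda>_. discrete_topology S) UNIV) U \<and> U \<noteq> {} \<longrightarrow> emeasure m U > 0)"

locale inducing_scheme =
  fixes f :: "'a::metric_space \<Rightarrow> 'a"
    and S :: "'i set"
    and J :: "'i \<Rightarrow> 'a set"
    and \<tau> :: "'i \<Rightarrow> nat"
  assumes countable_index: "countable S"
    and borel_base: "\<And>a. a \<in> S \<Longrightarrow> J a \<in> sets borel"
    and disjoint_base: "disjoint_family_on J S"
    and time_pos: "\<And>a. a \<in> S \<Longrightarrow> \<tau> a > 0"
    and I1_maps_into: "\<And>a. a \<in> S \<Longrightarrow> (f ^^ \<tau> a) ` J a \<subseteq> inducing_domain S J"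
    and I1_onto: "(\<Union>a\<in>S. (f ^^ \<tau> a) ` J a) = inducing_domain S J"
    and I1_extension: "\<And>a. a \<in> S \<Longrightarrow> \<exists>g. homeo_extension f (J a) (\<tau> a) g"
    and I2_unique: "\<And>a. (\<forall>n. a n \<in> S) \<Longrightarrow> \<exists>!x. follows_code f J \<tau> a x"
    and I2_injective: "\<And>a b. (\<forall>n. a n \<in> S) \<Longrightarrow> (\<forall>n. b n \<in> S) \<Longrightarrow>
      (\<forall>n\<le>0. coded_sequence f J \<tau> a n = coded_sequence f J \<tau> b n) \<Longrightarrow> a = b"
    and I3: "\<not> (\<exists>m\<in>ergodic_measures (code_space S) left_shift.
      full_support S m \<and> (AE a in m. a \<notin> good_codes f S J \<tau>))"
    and I4: "\<exists>x\<in>inducing_domain S J. \<exists>p>0. (induced_map f S J \<tau> ^^ p) x = x"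

definition tower :: "('a \<Rightarrow> 'a) \<Rightarrow> 'i set \<Rightarrow> ('i \<Rightarrow> 'a set) \<Rightarrow> 'a set" where
  "tower f S J = (\<Union>k. (f ^^ k) ` inducing_domain S J)"

text \<open>A measure on the tower is viewed as a Borel measure on the whole space for which the
  complement of the tower is null.\<close>

definition tower_ergodic_measures ::
    "('a::topological_space \<Rightarrow> 'a) \<Rightarrow> 'i set \<Rightarrow> ('i \<Rightarrow> 'a set) \<Rightarrow> 'a measure set" where
  "tower_ergodic_measures f S J = {\<mu>\<in>ergodic_measures borel f. AE x in \<mu>. x \<in> tower f S J}"

definition induced_ergodic_measures :: "('a::topological_space \<Rightarrow> 'a) \<Rightarrow> 'i set \<Rightarrow>
    ('i \<Rightarrow> 'a set) \<Rightarrow> ('i \<Rightarrow> nat) \<Rightarrow> 'a measure set" where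
  "induced_ergodic_measures f S J \<tau> =
     ergodic_measures (restrict_space borel (inducing_domain S J)) (induced_map f S J \<tau>)"

definition mean_inducing_time ::
    "'i set \<Rightarrow> ('i \<Rightarrow> 'a set) \<Rightarrow> ('i \<Rightarrow> nat) \<Rightarrow> 'a measure \<Rightarrow> ennreal" where
  "mean_inducing_time S J \<tau> \<nu> = (\<integral>\<^sup>+x. of_nat (inducing_time S J \<tau> x) \<partial>\<nu>)"

definition lifted_measure :: "('a::topological_space \<Rightarrow> 'a) \<Rightarrow> 'i set \<Rightarrow> ('i \<Rightarrow> 'a set) \<Rightarrow>
    ('i \<Rightarrow> nat) \<Rightarrow> 'a measure \<Rightarrow> 'a measure" where
  "lifted_measure f S J \<tau> \<nu> = measure_of UNIV (sets borel)
     (\<lambda>E. (\<Sum>\<^sub>\<infinity>a\<in>S. \<Sum>k<\<tau> a. emeasure \<nu> ((f ^^ k) -` E \<inter> J a)) / mean_inducing_time S J \<tau> \<nu>)"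

definition liftable_measures :: "('a::topological_space \<Rightarrow> 'a) \<Rightarrow> 'i set \<Rightarrow> ('i \<Rightarrow> 'a set) \<Rightarrow>
    ('i \<Rightarrow> nat) \<Rightarrow> 'a measure set" where
  "liftable_measures f S J \<tau> = {\<mu>\<in>tower_ergodic_measures f S J.
     \<exists>\<nu>\<in>induced_ergodic_measures f S J \<tau>.
       mean_inducing_time S J \<tau> \<nu> < \<infinity> \<and> \<mu> = lifted_measure f S J \<tau> \<nu>}"

definition induced_potential :: "('a \<Rightarrow> 'a) \<Rightarrow> 'i set \<Rightarrow> ('i \<Rightarrow> 'a set) \<Rightarrow> ('i \<Rightarrow> nat) \<Rightarrow>
    ('a \<Rightarrow> real) \<Rightarrow> 'a \<Rightarrow> real" where
  "induced_potential f S J \<tau> \<phi> x = (\<Sum>k<inducing_time S J \<tau> x. \<phi> ((f ^^ k) x))"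

definition log_ennreal :: "ennreal \<Rightarrow> ereal" where
  "log_ennreal u = (if u = 0 then -\<infinity> else if u = \<infinity> then \<infinity> else ereal (ln (enn2real u)))"

definition weighted_count ::
    "'i set \<Rightarrow> ('i \<Rightarrow> 'a set) \<Rightarrow> ('i \<Rightarrow> nat) \<Rightarrow> ('a \<Rightarrow> real) \<Rightarrow> nat \<Rightarrow> ennreal" where
  "weighted_count S J \<tau> \<omega> n = (\<Sum>\<^sub>\<infinity>a\<in>{a\<in>S. \<tau> a = n}. SUP x\<in>J a. ennreal (exp (\<omega> x)))"

definition complexity ::
    "'i set \<Rightarrow> ('i \<Rightarrow> 'a set) \<Rightarrow> ('i \<Rightarrow> nat) \<Rightarrow> ('a \<Rightarrow> real) \<Rightarrow> ereal" where
  "complexity S J \<tau> \<omega> = limsup (\<lambda>n. log_ennreal (weighted_count S J \<tau> \<omega> n) / ereal (real n))"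

definition finite_complexity ::
    "'i set \<Rightarrow> ('i \<Rightarrow> 'a set) \<Rightarrow> ('i \<Rightarrow> nat) \<Rightarrow> ('a \<Rightarrow> real) \<Rightarrow> bool" where
  "finite_complexity S J \<tau> \<omega> \<longleftrightarrow>
     (\<forall>n\<ge>1. weighted_count S J \<tau> \<omega> n < \<infinity>) \<and> complexity S J \<tau> \<omega> < \<infinity>"

definition compatible_partition ::
    "('a \<Rightarrow> 'a) \<Rightarrow> 'i set \<Rightarrow> ('i \<Rightarrow> 'a set) \<Rightarrow> ('i \<Rightarrow> nat) \<Rightarrow> 'a set set \<Rightarrow> bool" where
  "compatible_partition f S J \<tau> P \<longleftrightarrow> (\<forall>a\<in>S. \<forall>i<\<tau> a. \<exists>A\<in>P. (f ^^ i) ` J a \<subseteq> A)"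

end

theory Submission
  imports Defs
begin

text \<open>Let \<open>N\<^sub>n(x)\<close> be the number of steps of the induced map \<open>F\<close> that start from \<open>x \<in> W\<close> within the
  first \<open>n\<close> iterates of \<open>f\<close>. If the mean of \<open>N\<^sub>n / n\<close> over \<open>W\<close> does not tend to \<open>0\<close>, then a cluster
  point of the occupation measures of these steps is a nonzero \<open>F\<close>-invariant measure whose lift is
  dominated by \<open>\<mu>\<close>; by ergodicity the lift is a multiple of \<open>\<mu>\<close>, and this stays true for an ergodic
  component. If the mean tends to \<open>0\<close>, then most of a typical orbit segment is covered by few long
  blocks, so that summing the weights \<open>sup exp \<phi>\<close> of the blocks over all such parses bounds, by Gibbs'
  inequality, \<open>P\<^sub>\<mu>(\<phi>)\<close> by the complexity, contrary to the hypothesis.\<close>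

section \<open>Entropy of finite codings\<close>

text \<open>Since \<open>f\<close> may be discontinuous, weak limits of occupation measures need not
  be invariant. The limit is therefore taken set by set along a filter. At first it is only finitely
  additive; the tower inequality makes it dominated by \<open>\<mu>\<close>, and domination yields
  countable additivity. The ergodic component comes from a lower bound on the
  \<open>\<mu>\<close>-measure of charged invariant sets inside a suitable set, which forces an atom
  among the invariant sets. In the other case an orbit cannot be cut into blocks everywhere, and
  single letters fill the gaps. Every letter and every block costs a fixed factor, chosen so that
  the words of length \<open>n\<close> have total weight at most \<open>exp (\<rho> * n)\<close> for
  any \<rho> above the complexity. Letters and blocks are so rare that these factors lose less than
  any given \<delta> per step. As \<phi> may be unbounded while the weight of a letter ignores it,
  \<phi> is truncated from above at a small loss in mean. The homeomorphic extensions in (I1) make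
  the levels of the tower Borel sets.\<close>

definition code_entropy :: "'a measure \<Rightarrow> ('a \<Rightarrow> 'b) \<Rightarrow> real" where
  "code_entropy M \<xi> = - (\<integral>x. ln (measure M (\<xi> -` {\<xi> x} \<inter> space M)) \<partial>M)"

primrec itin :: "('a \<Rightarrow> 'a) \<Rightarrow> ('a \<Rightarrow> 'b) \<Rightarrow> nat \<Rightarrow> 'a \<Rightarrow> 'b list" where
  "itin f p 0 x = []"
| "itin f p (Suc n) x = p x # itin f p n (f x)"

lemma integral_simple_comp:
  fixes g :: "'b \<Rightarrow> real"
  assumes "finite_measure M" "simple_function M \<xi>"
  shows "(\<integral>x. g (\<xi> x) \<partial>M) = (\<Sum>b\<in>\<xi> ` space M. g b * measure M (\<xi> -` {b} \<inter> space M))"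
    and "integrable M (\<lambda>x. g (\<xi> x))"
proof -
  interpret finite_measure M by fact
  let ?A = "\<lambda>b. \<xi> -` {b} \<inter> space M"
  have fin: "finite (\<xi> ` space M)" using assms(2) by (rule simple_functionD)
  have ms: "\<xi> -` {b} \<inter> space M \<in> sets M" for b
    using assms(2) by (rule simple_functionD)
  have eq: "g (\<xi> x) = (\<Sum>b\<in>\<xi> ` space M. g b * indicator (?A b) x)"
    if "x \<in> space M" for x
  proof -
    have "(\<Sum>b\<in>\<xi> ` space M. g b * indicator (?A b) x)
        = (\<Sum>b\<in>\<xi> ` space M. if b = \<xi> x then g b else 0)"
      using that by (intro sum.cong) (auto simp: indicator_def)
    then show ?thesis using that fin by simp
  qed
  have int: "integrable M (\<lambda>x. \<Sum>b\<in>\<xi> ` space M. g b * indicator (?A b) x)"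
    using ms by (intro Bochner_Integration.integrable_sum integrable_mult_right
      integrable_real_indicator) (auto simp: emeasure_eq_measure)
  show "integrable M (\<lambda>x. g (\<xi> x))"
    using int eq by (simp cong: Bochner_Integration.integrable_cong)
  have "(\<integral>x. g (\<xi> x) \<partial>M) = (\<integral>x. (\<Sum>b\<in>\<xi> ` space M. g b * indicator (?A b) x) \<partial>M)"
    using eq by (intro Bochner_Integration.integral_cong) auto
  also have "\<dots> = (\<Sum>b\<in>\<xi> ` space M. g b * measure M (\<xi> -` {b} \<inter> space M))"
    using ms by (subst Bochner_Integration.integral_sum)
      (auto simp: emeasure_eq_measure intro!: integrable_mult_right integrable_real_indicator)
  finally show "(\<integral>x. g (\<xi> x) \<partial>M) = (\<Sum>b\<in>\<xi> ` space M. g b * measure M (\<xi> -` {b} \<inter> space M))" .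
qed

lemma code_entropy_eq_sum:
  assumes "finite_measure M" "simple_function M \<xi>"
  shows "code_entropy M \<xi> = - (\<Sum>b\<in>\<xi> ` space M.
    measure M (\<xi> -` {b} \<inter> space M) * ln (measure M (\<xi> -` {b} \<inter> space M)))"
  using integral_simple_comp(1)[OF assms, of "\<lambda>b. ln (measure M (\<xi> -` {b} \<inter> space M))"]
  by (simp add: code_entropy_def mult.commute)

lemma code_entropy_cong:
  assumes "\<And>x y. x \<in> space M \<Longrightarrow> y \<in> space M \<Longrightarrow> \<xi> x = \<xi> y \<longleftrightarrow> \<eta> x = \<eta> y"
  shows "code_entropy M \<xi> = code_entropy M \<eta>"
proof -
  have "\<xi> -` {\<xi> x} \<inter> space M = \<eta> -` {\<eta> x} \<inter> space M" if "x \<in> space M" for x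
    using assms that by auto
  then show ?thesis
    unfolding code_entropy_def by (intro arg_cong[where f=uminus] Bochner_Integration.integral_cong) auto
qed

lemma code_entropy_comp:
  assumes "finite_measure M" "T \<in> M \<rightarrow>\<^sub>M M" "distr M M T = M" "simple_function M \<xi>"
  shows "code_entropy M (\<lambda>x. \<xi> (T x)) = code_entropy M \<xi>"
proof -
  interpret finite_measure M by fact
  let ?A = "\<lambda>x. \<xi> -` {\<xi> (T x)} \<inter> space M"
  let ?g = "\<lambda>x. ln (measure M (\<xi> -` {\<xi> x} \<inter> space M))"
  have ms: "\<xi> -` {b} \<inter> space M \<in> sets M" for b
    using assms(4) by (rule simple_functionD)
  have "measure M ((\<lambda>x. \<xi> (T x)) -` {\<xi> (T x)} \<inter> space M) = measure M (?A x)" for x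
  proof -
    have "measure M (?A x) = measure (distr M M T) (?A x)"
      using assms(3) by simp
    also have "\<dots> = measure M (T -` (?A x) \<inter> space M)"
      using ms assms(2) by (intro measure_distr) auto
    also have "T -` (?A x) \<inter> space M = (\<lambda>x. \<xi> (T x)) -` {\<xi> (T x)} \<inter> space M"
      using measurable_space[OF assms(2)] by auto
    finally show ?thesis by simp
  qed
  then have "code_entropy M (\<lambda>x. \<xi> (T x)) = - (\<integral>x. ?g (T x) \<partial>M)"
    by (simp add: code_entropy_def)
  also have "(\<integral>x. ?g (T x) \<partial>M) = (\<integral>x. ?g x \<partial>distr M M T)"
  proof (rule integral_distr[symmetric])
    show "?g \<in> borel_measurable M"
      using integral_simple_comp(2)[OF assms(1,4), of "\<lambda>b. ln (measure M (\<xi> -` {b} \<inter> space M))"]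
      by (rule borel_measurable_integrable)
  qed fact
  finally show ?thesis using assms(3) by (simp add: code_entropy_def)
qed

text \<open>The laws of the logarithm need positive arguments; there are only finitely many fibres,
  so those of measure zero can be discarded together.\<close>

lemma AE_fibre_pos:
  assumes "finite_measure M" "simple_function M \<xi>"
  shows "AE x in M. measure M (\<xi> -` {\<xi> x} \<inter> space M) > 0"
proof -
  interpret finite_measure M by fact
  have fin: "finite (\<xi> ` space M)" using assms(2) by (rule simple_functionD)
  have ms: "\<xi> -` {b} \<inter> space M \<in> sets M" for b
    using assms(2) by (rule simple_functionD)
  let ?B = "{b \<in> \<xi> ` space M. measure M (\<xi> -` {b} \<inter> space M) = 0}"
  have "(\<Union>b\<in>?B. \<xi> -` {b} \<inter> space M) \<in> null_sets M"
    using fin ms by (intro null_sets_UN') (auto intro: countable_finite simp: null_sets_def emeasure_eq_measure)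
  then show ?thesis
    by (rule AE_I') (auto simp: not_less zero_less_measure_iff)
qed

text \<open>Gibbs' variational inequality; the entropy bounds below are instances for suitable \<open>V\<close>.\<close>

lemma code_entropy_gibbs:
  assumes "prob_space M" "simple_function M \<xi>"
    and nonneg: "\<And>b. b \<in> \<xi> ` space M \<Longrightarrow> V b \<ge> 0"
    and pos: "\<And>b. measure M (\<xi> -` {b} \<inter> space M) > 0 \<Longrightarrow> V b > 0"
    and Z: "(\<Sum>b\<in>\<xi> ` space M. V b) \<le> Z"
  shows "code_entropy M \<xi> \<le> ln Z - (\<integral>x. ln (V (\<xi> x)) \<partial>M)"
proof -
  interpret prob_space M by fact
  have fin: "finite (\<xi> ` space M)" using assms(2) by (rule simple_functionD)
  have ms: "\<xi> -` {b} \<inter> space M \<in> sets M" for b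
    using assms(2) by (rule simple_functionD)
  define q where "q b = measure M (\<xi> -` {b} \<inter> space M)" for b
  note sf = integral_simple_comp[OF finite_measure_axioms assms(2)]
  have sumq: "(\<Sum>b\<in>\<xi> ` space M. q b) = 1"
    using sf(1)[of "\<lambda>_. 1"] prob_space by (simp add: q_def)
  then obtain b0 where "b0 \<in> \<xi> ` space M" "q b0 \<noteq> 0"
    by (metis sum.neutral zero_neq_one)
  then have "(\<Sum>b\<in>\<xi> ` space M. V b) > 0"
    using pos[of b0] by (intro sum_pos2[OF fin]) (auto simp: q_def zero_less_measure_iff nonneg)
  then have Zpos: "Z > 0" using Z by simp
  \<comment> \<open>Termwise form of \<open>ln u \<le> u - 1\<close> at
    \<open>u = V b / (Z * q b)\<close>; a letter with \<open>q b = 0\<close> makes the left side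
    vanish, whatever its logarithm.\<close>
  have pt: "q b * (ln (V b) - ln Z - ln (q b)) \<le> V b / Z - q b" if b: "b \<in> \<xi> ` space M" for b
  proof (cases "q b = 0")
    case True then show ?thesis using nonneg[OF b] Zpos by simp
  next
    case False
    then have qp: "q b > 0" by (simp add: q_def zero_less_measure_iff)
    then have Vp: "V b > 0" using pos[of b] by (simp add: q_def)
    have "ln (V b) - ln Z - ln (q b) = ln (V b / (Z * q b))"
      using Vp Zpos qp by (simp add: ln_div ln_mult)
    also have "\<dots> \<le> V b / (Z * q b) - 1"
      using Vp Zpos qp by (intro ln_le_minus_one) simp
    finally have "q b * (ln (V b) - ln Z - ln (q b)) \<le> q b * (V b / (Z * q b) - 1)"
      using qp by (intro mult_left_mono) auto
    also have "\<dots> = V b / Z - q b" using qp Zpos by (simp add: right_diff_distrib)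
    finally show ?thesis .
  qed
  have "(\<integral>x. ln (V (\<xi> x)) \<partial>M) - ln Z + code_entropy M \<xi>
      = (\<Sum>b\<in>\<xi> ` space M. q b * (ln (V b) - ln Z - ln (q b)))"
    using sf(1)[of "\<lambda>b. ln (V b)"] sumq
    by (simp add: code_entropy_eq_sum[OF finite_measure_axioms assms(2)] q_def[symmetric]
      right_diff_distrib sum_subtractf sum_distrib_left[symmetric] mult.commute)
  also have "\<dots> \<le> (\<Sum>b\<in>\<xi> ` space M. V b / Z - q b)" by (intro sum_mono pt)
  also have "\<dots> = (\<Sum>b\<in>\<xi> ` space M. V b) / Z - 1"
    by (simp add: sum_subtractf sumq sum_divide_distrib)
  also have "\<dots> \<le> 0" using Z Zpos by simp
  finally show ?thesis by simp
qed

lemma code_entropy_nonneg: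
  assumes "prob_space M" shows "code_entropy M \<xi> \<ge> 0"
proof -
  interpret prob_space M by fact
  have "ln (measure M A) \<le> 0" for A
    using prob_le_1[of A] by (cases "measure M A = 0") (auto simp: zero_less_measure_iff ln_le_zero_iff)
  then have "(\<integral>x. ln (measure M (\<xi> -` {\<xi> x} \<inter> space M)) \<partial>M) \<le> 0"
    using Bochner_Integration.integral_nonneg[of M "\<lambda>x. - ln (measure M (\<xi> -` {\<xi> x} \<inter> space M))"] by simp
  then show ?thesis by (simp add: code_entropy_def)
qed

text \<open>Gibbs' inequality with the product of the marginal distributions as weight: its total
  over all pairs is 1, and a pair of positive measure has positive marginals.\<close>

lemma code_entropy_Pair_le:
  assumes "prob_space M" "simple_function M \<xi>" "simple_function M \<eta>"
  shows "code_entropy M (\<lambda>x. (\<xi> x, \<eta> x)) \<le> code_entropy M \<xi> + code_entropy M \<eta>"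
proof -
  interpret prob_space M by fact
  let ?pair = "\<lambda>x. (\<xi> x, \<eta> x)"
  have sf: "simple_function M ?pair"
    using assms(2,3) by (rule simple_function_Pair)
  note fm = finite_measure_axioms
  define u where "u b = measure M (\<xi> -` {b} \<inter> space M)" for b
  define v where "v b = measure M (\<eta> -` {b} \<inter> space M)" for b
  have fin: "finite (\<xi> ` space M)" "finite (\<eta> ` space M)"
    using assms(2,3) by (auto intro: simple_functionD)
  have su: "(\<Sum>b\<in>\<xi> ` space M. u b) = 1"
    using integral_simple_comp(1)[OF fm assms(2), of "\<lambda>_. 1"] prob_space by (simp add: u_def)
  have sv: "(\<Sum>b\<in>\<eta> ` space M. v b) = 1"
    using integral_simple_comp(1)[OF fm assms(3), of "\<lambda>_. 1"] prob_space by (simp add: v_def)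
  have nn: "u b \<ge> 0" "v c \<ge> 0" for b c by (auto simp: u_def v_def)
  let ?V = "\<lambda>z. u (fst z) * v (snd z)"
  have "(\<Sum>z\<in>?pair ` space M. ?V z) \<le> (\<Sum>z\<in>\<xi> ` space M \<times> \<eta> ` space M. ?V z)"
    using fin nn by (intro sum_mono2) (auto intro!: mult_nonneg_nonneg)
  also have "\<dots> = (\<Sum>b\<in>\<xi> ` space M. u b) * (\<Sum>c\<in>\<eta> ` space M. v c)"
    unfolding sum_product by (simp add: sum.cartesian_product case_prod_beta)
  also have "\<dots> = 1" by (simp add: su sv)
  finally have Z: "(\<Sum>z\<in>?pair ` space M. ?V z) \<le> 1" .
  have pos: "?V z > 0" if "measure M (?pair -` {z} \<inter> space M) > 0" for z
  proof -
    have "measure M (?pair -` {z} \<inter> space M) \<le> u (fst z)"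
      "measure M (?pair -` {z} \<inter> space M) \<le> v (snd z)"
      unfolding u_def v_def using assms(2,3)
      by (auto intro!: finite_measure_mono simple_functionD)
    with that show ?thesis by (intro mult_pos_pos) auto
  qed
  have "code_entropy M ?pair \<le> ln 1 - (\<integral>x. ln (?V (\<xi> x, \<eta> x)) \<partial>M)"
    using nn by (intro code_entropy_gibbs[OF assms(1) sf _ pos Z]) auto
  also have "(\<integral>x. ln (?V (\<xi> x, \<eta> x)) \<partial>M) = (\<integral>x. ln (u (\<xi> x)) + ln (v (\<eta> x)) \<partial>M)"
  proof (rule integral_cong_AE)
    show "(\<lambda>x. ln (?V (\<xi> x, \<eta> x))) \<in> borel_measurable M"
      by (rule borel_measurable_integrable[OF integral_simple_comp(2)[OF fm sf]])
    show "AE x in M. ln (?V (\<xi> x, \<eta> x)) = ln (u (\<xi> x)) + ln (v (\<eta> x))"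
      using AE_fibre_pos[OF fm assms(2)] AE_fibre_pos[OF fm assms(3)]
      by eventually_elim (simp add: u_def v_def ln_mult)
  qed (intro borel_measurable_add borel_measurable_integrable
      integral_simple_comp(2)[OF fm assms(2)] integral_simple_comp(2)[OF fm assms(3)])
  also have "\<dots> = - code_entropy M \<xi> - code_entropy M \<eta>"
    using integral_simple_comp(2)[OF fm assms(2), of "\<lambda>b. ln (u b)"]
      integral_simple_comp(2)[OF fm assms(3), of "\<lambda>b. ln (v b)"]
    by (subst Bochner_Integration.integral_add) (auto simp: code_entropy_def u_def v_def)
  finally show ?thesis by simp
qed

section \<open>Itineraries and the growth of their entropy\<close>

lemma length_itin [simp]: "length (itin f p n x) = n"
  by (induction n arbitrary: x) auto

lemma itin_eq_map: "itin f p n x = map (\<lambda>k. p ((f ^^ k) x)) [0..<n]"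
proof (induction n arbitrary: x)
  case (Suc n)
  have "map (\<lambda>k. p ((f ^^ k) x)) [0..<Suc n] = p x # map (\<lambda>k. p ((f ^^ Suc k) x)) [0..<n]"
    by (subst upt_conv_Cons) (auto simp: map_Suc_upt[symmetric] simp del: upt_Suc)
  then show ?case by (simp add: Suc.IH funpow_swap1)
qed simp

lemma nth_itin [simp]: "k < n \<Longrightarrow> itin f p n x ! k = p ((f ^^ k) x)"
  by (simp add: itin_eq_map)

lemma itin_add:
  "itin f p (m + n) x = itin f p m x @ itin f p n ((f ^^ m) x)"
  by (induction m arbitrary: x) (auto simp: funpow_swap1)

lemma take_itin: "m \<le> n \<Longrightarrow> take m (itin f p n x) = itin f p m x"
  using itin_add[of f p m "n - m" x] by simp

lemma drop_itin: "m \<le> n \<Longrightarrow> drop m (itin f p n x) = itin f p (n - m) ((f ^^ m) x)"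
  using itin_add[of f p m "n - m" x] by simp

lemma itin_eq_iff:
  "itin f p n x = itin f p n y \<longleftrightarrow> (\<forall>k<n. p ((f ^^ k) x) = p ((f ^^ k) y))"
  by (auto simp: list_eq_iff_nth_eq)

lemma set_itin_subset: "set (itin f p n x) \<subseteq> range p"
  by (auto simp: itin_eq_map)

lemma simple_function_itin:
  assumes "f \<in> M \<rightarrow>\<^sub>M M" "simple_function M p"
  shows "simple_function M (itin f p n)"
proof (induction n)
  case 0
  have "itin f p 0 = (\<lambda>x. [])" by auto
  then show ?case by simp
next
  case (Suc n)
  have "simple_function M (\<lambda>x. itin f p n (f x))"
    by (rule simple_function_comp[OF assms(1) Suc])
  with assms(2) have "simple_function M (\<lambda>x. p x # itin f p n (f x))"
    by (rule simple_function_compose2)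
  moreover have "itin f p (Suc n) = (\<lambda>x. p x # itin f p n (f x))" by auto
  ultimately show ?case by simp
qed

lemma measurable_funpow:
  assumes "f \<in> M \<rightarrow>\<^sub>M M" shows "(f ^^ n) \<in> M \<rightarrow>\<^sub>M M"
proof (induction n)
  case (Suc n)
  show ?case using measurable_comp[OF Suc assms] by (simp add: comp_def)
qed (simp add: id_def)

lemma distr_funpow:
  assumes "f \<in> M \<rightarrow>\<^sub>M M" "distr M M f = M"
  shows "distr M M (f ^^ n) = M"
proof (induction n)
  case 0 then show ?case by (simp add: id_def distr_id)
next
  case (Suc n)
  have "distr M M (f ^^ Suc n) = distr (distr M M (f ^^ n)) M f"
    using measurable_funpow[OF assms(1)] assms(1) by (subst distr_distr) auto
  then show ?case using Suc assms(2) by (simp add: comp_def)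
qed

lemma code_entropy_itin_subadditive:
  assumes "prob_space M" "f \<in> M \<rightarrow>\<^sub>M M" "distr M M f = M" "simple_function M p"
  shows "code_entropy M (itin f p (m + n))
    \<le> code_entropy M (itin f p m) + code_entropy M (itin f p n)"
proof -
  interpret prob_space M by fact
  note fm = measurable_funpow[OF assms(2)] and sf = simple_function_itin[OF assms(2,4)]
  have "code_entropy M (itin f p (m + n))
      = code_entropy M (\<lambda>x. (itin f p m x, itin f p n ((f ^^ m) x)))"
    by (rule code_entropy_cong) (simp add: itin_add)
  also have "\<dots> \<le> code_entropy M (itin f p m) + code_entropy M (\<lambda>x. itin f p n ((f ^^ m) x))"
    by (intro code_entropy_Pair_le assms(1) sf simple_function_comp[OF fm sf])
  also have "code_entropy M (\<lambda>x. itin f p n ((f ^^ m) x)) = code_entropy M (itin f p n)"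
    by (intro code_entropy_comp finite_measure_axioms fm distr_funpow assms sf)
  finally show ?thesis .
qed

text \<open>Fekete's lemma; the limit is the infimum \<open>L\<close>. The shift by one avoids
  division by zero and fits the join over \<open>k \<le> n\<close>, which has \<open>n + 1\<close>
  letters.\<close>

lemma subadditive_convergent:
  fixes a :: "nat \<Rightarrow> real"
  assumes sub: "\<And>m n. a (m + n) \<le> a m + a n" and nonneg: "\<And>n. 0 \<le> a n"
  shows "convergent (\<lambda>n. a (Suc n) / real (Suc n))"
proof -
  define L where "L = (INF n. a (Suc n) / real (Suc n))"
  have bdd: "bdd_below (range (\<lambda>n. a (Suc n) / real (Suc n)))"
    by (rule bdd_belowI[of _ 0]) (auto simp: nonneg)
  have lower: "L \<le> a (Suc n) / real (Suc n)" for n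
    unfolding L_def by (rule cINF_lower[OF bdd]) simp
  have mult: "a (q * m + r) \<le> real q * a m + a r" for q m r
  proof (induction q)
    case (Suc q)
    have "a (Suc q * m + r) \<le> a m + a (q * m + r)" using sub[of m "q * m + r"] by (simp add: add.assoc)
    with Suc show ?case by (simp add: algebra_simps)
  qed simp
  have div: "u / real (Suc n) \<le> X + C / real (Suc n)" if "u \<le> real (Suc n) * X + C" for u X C n
  proof -
    have "u / real (Suc n) \<le> (real (Suc n) * X + C) / real (Suc n)"
      using that by (rule divide_right_mono) simp
    then show ?thesis by (simp only: add_divide_distrib) simp
  qed
  have "(\<lambda>n. a (Suc n) / real (Suc n)) \<longlonglongrightarrow> L"
  proof (rule LIMSEQ_I)
    fix e :: real assume e: "e > 0"
    then have "\<exists>m. a (Suc m) / real (Suc m) < L + e / 2"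
      unfolding L_def using cINF_less_iff[OF _ bdd, of "L + e / 2"] by (auto simp: L_def)
    then obtain m where m: "a (Suc m) / real (Suc m) < L + e / 2" by blast
    \<comment> \<open>Bounds the value at every remainder modulo \<open>Suc m\<close>; it disappears
      after division by a large \<open>n\<close>.\<close>
    define C where "C = (\<Sum>r<Suc m. a r)"
    have C: "a r \<le> C" if "r < Suc m" for r
      unfolding C_def using that by (intro member_le_sum) (auto simp: nonneg)
    have C0: "C \<ge> 0" by (simp add: C_def sum_nonneg nonneg)
    obtain n0 :: nat where n0: "2 * C / e < real n0" using reals_Archimedean2 by blast
    show "\<exists>n0. \<forall>n\<ge>n0. norm (a (Suc n) / real (Suc n) - L) < e"
    proof (intro exI allI impI)
      fix n assume n: "n \<ge> n0"
      define q where "q = Suc n div Suc m"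
      define r where "r = Suc n mod Suc m"
      have qr: "Suc n = q * Suc m + r" by (simp add: q_def r_def del: mult_Suc_right)
      have r: "r < Suc m" by (simp add: r_def)
      have "a (Suc n) \<le> real q * a (Suc m) + a r" unfolding qr by (rule mult)
      also have "\<dots> = (real q * real (Suc m)) * (a (Suc m) / real (Suc m)) + a r" by simp
      also have "\<dots> \<le> real (Suc n) * (a (Suc m) / real (Suc m)) + C"
        using C[OF r] nonneg by (intro add_mono mult_right_mono)
          (auto simp: qr of_nat_mult[symmetric] simp del: of_nat_mult of_nat_Suc mult_Suc_right)
      finally have "a (Suc n) / real (Suc n) \<le> a (Suc m) / real (Suc m) + C / real (Suc n)"
        by (rule div)
      also have "C / real (Suc n) < e / 2"
      proof -
        have "2 * C / e < real (Suc n)" using n0 n by linarith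
        then show ?thesis using e by (simp add: field_simps)
      qed
      finally have "a (Suc n) / real (Suc n) < L + e" using m by linarith
      then show "norm (a (Suc n) / real (Suc n) - L) < e" using lower[of n] by simp
    qed
  qed
  then show ?thesis by (auto simp: convergent_def)
qed

section \<open>Finite partitions read as codings\<close>

definition cell :: "'a set set \<Rightarrow> 'a \<Rightarrow> 'a set" where
  "cell P x = (THE A. A \<in> P \<and> x \<in> A)"

lemma cell_eq:
  assumes "partition_on UNIV P" "A \<in> P" "x \<in> A"
  shows "cell P x = A"
  unfolding cell_def
  by (rule the_equality) (use assms partition_onD2[OF assms(1)] in \<open>auto simp: disjoint_def\<close>)

lemma cell:
  assumes "partition_on UNIV P"
  shows "cell P x \<in> P" "x \<in> cell P x"
proof -
  obtain A where "A \<in> P" "x \<in> A" using partition_onD1[OF assms] by blast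
  then show "cell P x \<in> P" "x \<in> cell P x"
    using cell_eq[OF assms] by auto
qed

lemma vimage_cell:
  assumes "partition_on UNIV P" "A \<in> P"
  shows "cell P -` {A} = A"
  using cell(2)[OF assms(1)] cell_eq[OF assms] by auto

lemma simple_function_cell:
  assumes "finite P" "measurable_partition P" "sets \<mu> = sets borel"
  shows "simple_function \<mu> (cell P)"
proof -
  have P: "partition_on UNIV P" "P \<subseteq> sets borel" using assms(2) by (auto simp: measurable_partition_def)
  have sp: "space \<mu> = UNIV" using sets_eq_imp_space_eq[OF assms(3)] by simp
  have "range (cell P) \<subseteq> P" using cell(1)[OF P(1)] by auto
  then have "finite (range (cell P))" using assms(1) finite_subset by blast
  moreover have "cell P -` {A} \<in> sets \<mu>" if "A \<in> P" for A
    using that P by (auto simp: vimage_cell assms(3))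
  ultimately show ?thesis
    using cell(1)[OF P(1)] by (auto simp: simple_function_def sp)
qed

text \<open>The nonempty atoms of the join are exactly the fibres of the itinerary of cells, one for
  each occurring word; the times \<open>0\<close> to \<open>n\<close> make \<open>Suc n\<close>
  letters.\<close>

lemma partition_entropy_join:
  assumes "finite P" "measurable_partition P" "sets \<mu> = sets borel" "prob_space \<mu>" "f \<in> borel_measurable borel"
  shows "partition_entropy \<mu> (partition_join f P n) = code_entropy \<mu> (itin f (cell P) (Suc n))"
proof -
  interpret prob_space \<mu> by fact
  have sp: "space \<mu> = UNIV" using sets_eq_imp_space_eq[OF assms(3)] by simp
  have P: "partition_on UNIV P" using assms(2) by (auto simp: measurable_partition_def)
  let ?w = "itin f (cell P) (Suc n)"
  have fm: "f \<in> \<mu> \<rightarrow>\<^sub>M \<mu>" using assms(5) by (simp cong: measurable_cong_sets add: assms(3))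
  note sf = simple_function_itin[OF fm simple_function_cell[OF assms(1-3)]]
  have weq: "?w x = ?w y \<longleftrightarrow> (\<forall>k\<le>n. cell P ((f ^^ k) x) = cell P ((f ^^ k) y))" for x y
    unfolding itin_eq_iff by (simp add: less_Suc_eq_le)
  have fib: "?w -` {?w x} = (\<Inter>k\<le>n. (f ^^ k) -` cell P ((f ^^ k) x))" for x
  proof -
    have "(f ^^ k) y \<in> cell P ((f ^^ k) x) \<longleftrightarrow>
        cell P ((f ^^ k) y) = cell P ((f ^^ k) x)" for k y
      using cell[OF P] cell_eq[OF P] by metis
    then show ?thesis using weq by (auto simp del: itin.simps)
  qed
  have join: "partition_join f P n = (\<lambda>b. ?w -` {b}) ` range ?w"
  proof (intro equalityI subsetI)
    fix C assume "C \<in> partition_join f P n"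
    then obtain A x where A: "C = (\<Inter>k\<le>n. (f ^^ k) -` A k)" "\<forall>k\<le>n. A k \<in> P" and x: "x \<in> C"
      unfolding partition_join_def by auto
    have "A k = cell P ((f ^^ k) x)" if "k \<le> n" for k
      using A x that cell_eq[OF P, of "A k" "(f ^^ k) x"] by auto
    then have "C = ?w -` {?w x}" unfolding fib A(1) by (intro INF_cong) auto
    then show "C \<in> (\<lambda>b. ?w -` {b}) ` range ?w" by blast
  next
    fix C assume "C \<in> (\<lambda>b. ?w -` {b}) ` range ?w"
    then obtain x where x: "C = ?w -` {?w x}" by auto
    then have "x \<in> C" by simp
    have "C = (\<Inter>k\<le>n. (f ^^ k) -` cell P ((f ^^ k) x))" using x fib by simp
    then have "\<exists>A. C = (\<Inter>k\<le>n. (f ^^ k) -` A k) \<and> (\<forall>k\<le>n. A k \<in> P)"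
      using cell(1)[OF P] by (intro exI[of _ "\<lambda>k. cell P ((f ^^ k) x)"]) simp
    with \<open>x \<in> C\<close> show "C \<in> partition_join f P n" unfolding partition_join_def by blast
  qed
  have inj: "inj_on (\<lambda>b. ?w -` {b}) (range ?w)" by (rule inj_onI) blast
  show ?thesis
    unfolding partition_entropy_def join code_entropy_eq_sum[OF finite_measure_axioms sf]
    by (subst sum.reindex[OF inj]) (simp add: sp comp_def)
qed

text \<open>The definition uses \<open>lim\<close>, which is meaningful only for a convergent
  sequence; subadditivity along itineraries supplies the convergence.\<close>

lemma entropy_wrt_partition_LIMSEQ:
  assumes "finite P" "measurable_partition P" "sets \<mu> = sets borel" "prob_space \<mu>"
    and f: "f \<in> borel_measurable borel" "distr \<mu> borel f = \<mu>"
  shows "(\<lambda>n. code_entropy \<mu> (itin f (cell P) (Suc n)) / real (Suc n))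
    \<longlonglongrightarrow> entropy_wrt_partition f \<mu> P"
proof -
  have fm: "f \<in> \<mu> \<rightarrow>\<^sub>M \<mu>" using f by (simp cong: measurable_cong_sets add: assms(3))
  have d: "distr \<mu> \<mu> f = \<mu>" using f(2) distr_cong[OF refl assms(3), where f=f and g=f] by simp
  have "convergent (\<lambda>n. code_entropy \<mu> (itin f (cell P) (Suc n)) / real (Suc n))"
    by (intro subadditive_convergent code_entropy_itin_subadditive fm d assms
      simple_function_cell code_entropy_nonneg)
  then show ?thesis
    unfolding entropy_wrt_partition_def partition_entropy_join[OF assms(1-4) f(1)]
    by (simp only: convergent_LIMSEQ_iff)
qed

section \<open>Entropy of a generating partition\<close>

text \<open>The letters are independent, the \<open>j\<close>-th one with subprobability
  \<open>K j\<close>. Removing the first letter shifts the family \<open>K\<close>, so the induction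
  generalises over it.\<close>

lemma sum_prod_lists_le_1:
  fixes K :: "nat \<Rightarrow> 'c \<Rightarrow> real"
  assumes "finite D" "\<And>j c. K j c \<ge> 0" "\<And>j. (\<Sum>c\<in>D. K j c) \<le> 1"
  shows "(\<Sum>b\<in>{xs. set xs \<subseteq> D \<and> length xs = n}. \<Prod>j<n. K j (b ! j)) \<le> 1"
  using assms(2,3)
proof (induction n arbitrary: K)
  case 0
  have "{xs. set xs \<subseteq> D \<and> length xs = 0} = {[]}" by auto
  then show ?case by simp
next
  case (Suc n)
  let ?L = "{xs. set xs \<subseteq> D \<and> length xs = n}"
  have "(\<Sum>b\<in>{xs. set xs \<subseteq> D \<and> length xs = Suc n}. \<Prod>j<Suc n. K j (b ! j))
      = (\<Sum>(xs, c)\<in>?L \<times> D. \<Prod>j<Suc n. K j ((c # xs) ! j))"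
    unfolding lists_length_Suc_eq
    by (subst sum.reindex) (auto simp: inj_on_def case_prod_beta)
  also have "\<dots> = (\<Sum>(xs, c)\<in>?L \<times> D. (\<Prod>j<n. K (Suc j) (xs ! j)) * K 0 c)"
    by (intro sum.cong refl) (auto simp: prod.lessThan_Suc_shift simp del: prod.lessThan_Suc)
  also have "\<dots> = (\<Sum>xs\<in>?L. \<Prod>j<n. K (Suc j) (xs ! j)) * (\<Sum>c\<in>D. K 0 c)"
    by (simp add: sum.cartesian_product[symmetric] sum_product)
  also have "\<dots> \<le> 1 * 1"
    using Suc.prems by (intro mult_mono Suc.IH) (auto intro!: sum_nonneg)
  finally show ?case by simp
qed

lemma measure_vimage_funpow:
  assumes "f \<in> M \<rightarrow>\<^sub>M M" "distr M M f = M" "A \<in> sets M"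
  shows "measure M ((f ^^ n) -` A \<inter> space M) = measure M A"
  using measure_distr[OF measurable_funpow[OF assms(1)] assms(3), of n] distr_funpow[OF assms(1,2)] by simp

text \<open>If a block code \<open>g\<close> of the \<open>p\<close>-itinerary predicts \<open>q\<close> up to a set \<open>E\<close>, then the
  \<open>p\<close>-itinerary followed by an independent correction of each letter gives a weight on the
  \<open>q\<close>-itineraries to which Gibbs' inequality applies.\<close>

lemma code_entropy_itin_le:
  fixes M :: "'a measure" and p :: "'a \<Rightarrow> 'b" and q :: "'a \<Rightarrow> 'c"
    and g :: "'b list \<Rightarrow> 'c" and m n N :: nat and \<beta> :: real
  assumes "prob_space M" and f: "f \<in> M \<rightarrow>\<^sub>M M" "distr M M f = M"
    and p: "simple_function M p" and q: "simple_function M q"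
    and \<beta>: "0 < \<beta>" "\<beta> < 1"
  defines "E \<equiv> {x\<in>space M. g (itin f p N x) \<noteq> q ((f ^^ m) x)}"
  shows "code_entropy M (itin f q n) \<le> code_entropy M (itin f p (n + N))
    + real n * (measure M E * ln (real (card (q ` space M)) / \<beta>) - ln (1 - \<beta>))"
proof -
  interpret prob_space M by fact
  note fm = finite_measure_axioms
  note spf = measurable_space[OF measurable_funpow[OF f(1)]]
  let ?D = "q ` space M"
  let ?d = "real (card ?D)"
  \<comment> \<open>For \<open>j < n\<close> the predictor reads the \<open>N\<close> letters that
    start at \<open>j\<close>, so a word of length \<open>n + N\<close> serves all of them.\<close>
  let ?v = "itin f p (n + N)"
  let ?\<xi> = "\<lambda>x. itin f q n ((f ^^ m) x)"
  have D: "finite ?D" using q by (rule simple_functionD)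
  have D1: "?d \<ge> 1" using D not_empty by (simp add: Suc_le_eq card_gt_0_iff)
  have sv: "simple_function M ?v" by (rule simple_function_itin[OF f(1) p])
  have s\<xi>: "simple_function M ?\<xi>"
    by (rule simple_function_comp[OF measurable_funpow[OF f(1)] simple_function_itin[OF f(1) q]])
  have E: "E \<in> sets M"
  proof -
    have "simple_function M (\<lambda>x. (itin f p N x, q ((f ^^ m) x)))"
      by (intro simple_function_Pair simple_function_itin f p
        simple_function_comp[OF measurable_funpow[OF f(1)] q])
    from simple_functionD(2)[OF this, of "{(w, c). g w \<noteq> c}"] show ?thesis
      by (simp add: E_def vimage_def Int_def conj_commute)
  qed
  define u where "u b = measure M (?v -` {b} \<inter> space M)" for b
  have u0: "u b \<ge> 0" for b by (simp add: u_def)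
  have su: "(\<Sum>b\<in>?v ` space M. u b) = 1"
    using integral_simple_comp(1)[OF fm sv, of "\<lambda>_. 1"] prob_space by (simp add: u_def)
  \<comment> \<open>A correct prediction gets \<open>1 - \<beta>\<close>, any other letter an equal
    share of \<open>\<beta>\<close>: positive everywhere, with total at most 1.\<close>
  define K where "K c d = (if c = d then 1 - \<beta> else \<beta> / ?d)" for c d :: 'c
  have Kpos: "K c d > 0" for c d using \<beta> D1 by (auto simp: K_def)
  have Ksum: "(\<Sum>c\<in>?D. K c d) \<le> 1" for d
  proof -
    have "(\<Sum>c\<in>?D. K c d) \<le> (\<Sum>c\<in>?D. (if c = d then 1 - \<beta> else 0) + \<beta> / ?d)"
      using \<beta> by (intro sum_mono) (auto simp: K_def)
    also have "\<dots> \<le> 1" using D D1 \<beta> by (simp add: sum.distrib)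
    finally show ?thesis .
  qed
  define R where "R v j = g (take N (drop j v))" for v j
  define V where "V b = (\<Sum>v\<in>?v ` space M. u v * (\<Prod>j<n. K (b ! j) (R v j)))" for b
  have fin: "finite (?v ` space M)" using sv by (rule simple_functionD)
  have Vpos: "V b > 0" for b
  proof -
    obtain v where "v \<in> ?v ` space M" "u v \<noteq> 0"
      using su by (metis sum.neutral zero_neq_one)
    then show ?thesis unfolding V_def
      using u0[of v] by (intro sum_pos2[OF fin, of v]) (auto intro!: mult_pos_pos prod_pos Kpos mult_nonneg_nonneg prod_nonneg u0 simp: less_imp_le[OF Kpos])
  qed
  have "(\<Sum>b\<in>?\<xi> ` space M. V b) \<le> (\<Sum>b\<in>{xs. set xs \<subseteq> ?D \<and> length xs = n}. V b)"
    using Vpos spf by (intro sum_mono2 finite_lists_length_eq D)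
      (auto simp: less_imp_le itin_eq_map)
  also have "\<dots> = (\<Sum>v\<in>?v ` space M. u v * (\<Sum>b\<in>{xs. set xs \<subseteq> ?D \<and> length xs = n}. \<Prod>j<n. K (b ! j) (R v j)))"
    unfolding V_def by (subst sum.swap) (simp add: sum_distrib_left)
  also have "\<dots> \<le> (\<Sum>v\<in>?v ` space M. u v * 1)"
    using u0 by (intro sum_mono mult_left_mono sum_prod_lists_le_1 D Ksum) (auto simp: less_imp_le[OF Kpos])
  also have "\<dots> = 1" using su by simp
  finally have gibbs: "code_entropy M ?\<xi> \<le> ln 1 - (\<integral>x. ln (V (?\<xi> x)) \<partial>M)"
    using Vpos by (intro code_entropy_gibbs[OF assms(1) s\<xi>]) (auto simp: less_imp_le)
  let ?c = "ln (?d / \<beta>)"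
  have c0: "?c \<ge> 0" using D1 \<beta> by (simp add: ln_ge_zero)
  have l0: "ln (1 - \<beta>) \<le> 0" using \<beta> by simp
  have iE: "integrable M (\<lambda>x. indicator E ((f ^^ j) x) :: real)"
    "(\<integral>x. indicator E ((f ^^ j) x) \<partial>M) = measure M E" for j
  proof -
    have eq: "indicator E ((f ^^ j) x) = (indicator ((f ^^ j) -` E \<inter> space M) x :: real)"
      if "x \<in> space M" for x using that by (auto simp: indicator_def)
    have ms: "(f ^^ j) -` E \<inter> space M \<in> sets M" using E measurable_funpow[OF f(1)] by simp
    show "integrable M (\<lambda>x. indicator E ((f ^^ j) x) :: real)"
      using ms by (subst Bochner_Integration.integrable_cong[OF refl eq])
        (auto intro!: integrable_real_indicator simp: emeasure_eq_measure)
    show "(\<integral>x. indicator E ((f ^^ j) x) \<partial>M) = measure M E"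
      using ms measure_vimage_funpow[OF f E]
      by (subst Bochner_Integration.integral_cong[OF refl eq]) auto
  qed
  have iu: "integrable M (\<lambda>x. ln (u (?v x)))" by (rule integral_simple_comp(2)[OF fm sv])
  \<comment> \<open>Only the true \<open>p\<close>-itinerary is kept in the sum \<open>V\<close>. A
    correct prediction costs \<open>- ln (1 - \<beta>)\<close> and a wrong one \<open>?c\<close>,
    which is at most \<open>?c - ln (1 - \<beta>)\<close>.\<close>
  let ?low = "\<lambda>x. ln (u (?v x)) + (\<Sum>j<n. ln (1 - \<beta>) - ?c * indicator E ((f ^^ j) x))"
  have "(\<integral>x. ?low x \<partial>M) \<le> (\<integral>x. ln (V (?\<xi> x)) \<partial>M)"
  proof (rule integral_mono_AE)
    show "integrable M ?low" using iu iE by auto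
    show "integrable M (\<lambda>x. ln (V (?\<xi> x)))" by (rule integral_simple_comp(2)[OF fm s\<xi>])
    show "AE x in M. ?low x \<le> ln (V (?\<xi> x))"
      using AE_fibre_pos[OF fm sv] AE_space
    proof eventually_elim
      case (elim x)
      then have up: "u (?v x) > 0" by (simp add: u_def)
      let ?pr = "\<Prod>j<n. K (?\<xi> x ! j) (R (?v x) j)"
      have prp: "?pr > 0" by (intro prod_pos Kpos ballI)
      have "u (?v x) * ?pr \<le> V (?\<xi> x)"
        unfolding V_def using elim(2) fin
        by (intro member_le_sum[of "?v x" _ "\<lambda>v. u v * (\<Prod>j<n. K (?\<xi> x ! j) (R v j))"])
          (auto intro!: mult_nonneg_nonneg prod_nonneg u0 simp: less_imp_le[OF Kpos])
      then have "ln (u (?v x) * ?pr) \<le> ln (V (?\<xi> x))" using up prp by (intro ln_mono) auto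
      moreover have "ln (u (?v x) * ?pr) = ln (u (?v x)) + (\<Sum>j<n. ln (K (?\<xi> x ! j) (R (?v x) j)))"
        using less_imp_neq[OF Kpos, symmetric] by (subst ln_mult_pos[OF up prp], subst ln_prod) auto
      moreover have "ln (1 - \<beta>) - ?c * indicator E ((f ^^ j) x) \<le> ln (K (?\<xi> x ! j) (R (?v x) j))"
        if j: "j < n" for j
      proof -
        have 1: "?\<xi> x ! j = q ((f ^^ m) ((f ^^ j) x))"
          using j by (simp add: funpow_add[symmetric, unfolded comp_def, THEN fun_cong] add.commute
             flip: comp_apply[of "f ^^ j" "f ^^ m"] funpow_add)
        have 2: "R (?v x) j = g (itin f p N ((f ^^ j) x))"
          using j by (simp add: R_def drop_itin take_itin)
        show ?thesis
        proof (cases "(f ^^ j) x \<in> E")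
          case True
          then have "K (?\<xi> x ! j) (R (?v x) j) = \<beta> / ?d" by (auto simp: E_def K_def 1 2)
          then show ?thesis using True l0 \<beta> D1 by (simp add: ln_div)
        next
          case False
          then have "K (?\<xi> x ! j) (R (?v x) j) = 1 - \<beta>" using spf[OF elim(2)] by (auto simp: E_def K_def 1 2)
          then show ?thesis using False by simp
        qed
      qed
      ultimately show ?case by (smt (verit) sum_mono lessThan_iff)
    qed
  qed
  also have "(\<integral>x. ?low x \<partial>M) = - code_entropy M ?v + real n * (ln (1 - \<beta>) - ?c * measure M E)"
    using iu iE by (simp add: code_entropy_def u_def prob_space)
  finally have "code_entropy M ?\<xi> \<le> code_entropy M ?v + real n * (measure M E * ?c - ln (1 - \<beta>))"
    using gibbs by (simp add: algebra_simps)
  moreover have "code_entropy M ?\<xi> = code_entropy M (itin f q n)"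
    by (intro code_entropy_comp fm measurable_funpow distr_funpow f simple_function_itin q)
  ultimately show ?thesis by simp
qed

section \<open>Approximation of Borel sets by sets of words\<close>

definition word_approx :: "'a measure \<Rightarrow> ('a \<Rightarrow> 'a) \<Rightarrow> ('a \<Rightarrow> 'b) \<Rightarrow> real \<Rightarrow> nat \<Rightarrow> nat \<Rightarrow> 'a set \<Rightarrow> bool" where
  "word_approx M f p e m N B \<longleftrightarrow>
     (\<exists>C. measure M (sym_diff ((f ^^ m) -` B \<inter> space M) (itin f p N -` C \<inter> space M)) < e)"

text \<open>Delaying by \<open>k = m' - m\<close> amounts to ignoring the first \<open>k\<close>
  letters of a longer word, and invariance of \<open>M\<close> preserves the measure of the error.
  This brings several approximations to a common \<open>m\<close> and \<open>N\<close>.\<close>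

lemma word_approx_mono:
  assumes "prob_space M" "f \<in> M \<rightarrow>\<^sub>M M" "distr M M f = M" "simple_function M p" "B \<in> sets M"
    and "word_approx M f p e m N B" "m \<le> m'" "m' + N \<le> N'"
  shows "word_approx M f p e m' N' B"
proof -
  interpret prob_space M by fact
  define k where "k = m' - m"
  have m': "m' = m + k" using assms(7) by (simp add: k_def)
  have N': "k + N \<le> N'" using assms(8) m' by simp
  obtain C where C: "measure M (sym_diff ((f ^^ m) -` B \<inter> space M) (itin f p N -` C \<inter> space M)) < e"
    using assms(6) unfolding word_approx_def by blast
  let ?D = "sym_diff ((f ^^ m) -` B \<inter> space M) (itin f p N -` C \<inter> space M)"
  have D: "?D \<in> sets M"
    using measurable_sets[OF measurable_funpow[OF assms(2)] assms(5)]
      simple_functionD(2)[OF simple_function_itin[OF assms(2,4)]] by auto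
  let ?C = "{w. take N (drop k w) \<in> C}"
  have w: "take N (drop k (itin f p N' x)) = itin f p N ((f ^^ k) x)" for x
    using N' by (simp add: drop_itin take_itin)
  have "sym_diff ((f ^^ m') -` B \<inter> space M) (itin f p N' -` ?C \<inter> space M) = (f ^^ k) -` ?D \<inter> space M"
    using measurable_space[OF measurable_funpow[OF assms(2)]]
    by (auto simp: w m' funpow_add)
  then show ?thesis
    unfolding word_approx_def using C measure_vimage_funpow[OF assms(2,3) D, of k] by metis
qed

text \<open>At a common delay and length the errors add, because the symmetric difference of the
  unions lies in the union of the symmetric differences.\<close>

lemma word_approx_Un:
  assumes "prob_space M" "f \<in> M \<rightarrow>\<^sub>M M" "distr M M f = M" "simple_function M p" "A \<in> sets M" "B \<in> sets M"
    and "word_approx M f p e m N A" "word_approx M f p e' m' N' B"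
  shows "\<exists>m N. word_approx M f p (e + e') m N (A \<union> B)"
proof -
  interpret prob_space M by fact
  let ?m = "m + m'" let ?N = "m + m' + N + N'"
  let ?pre = "\<lambda>B. (f ^^ ?m) -` B \<inter> space M" and ?cyl = "\<lambda>C. itin f p ?N -` C \<inter> space M"
  obtain C where C: "measure M (sym_diff (?pre A) (?cyl C)) < e"
    using word_approx_mono[OF assms(1-5,7), of ?m ?N] unfolding word_approx_def by auto
  obtain D where D: "measure M (sym_diff (?pre B) (?cyl D)) < e'"
    using word_approx_mono[OF assms(1-4,6,8), of ?m ?N] unfolding word_approx_def by auto
  have ms: "?pre B \<in> sets M" "?pre A \<in> sets M"
      "?cyl X \<in> sets M" for X
    using measurable_sets[OF measurable_funpow[OF assms(2)] assms(5)]
      measurable_sets[OF measurable_funpow[OF assms(2)] assms(6)]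
      simple_functionD(2)[OF simple_function_itin[OF assms(2,4)]] by auto
  let ?D1 = "sym_diff (?pre A) (?cyl C)"
  let ?D2 = "sym_diff (?pre B) (?cyl D)"
  have "measure M (sym_diff (?pre (A \<union> B)) (?cyl (C \<union> D)))
    \<le> measure M (?D1 \<union> ?D2)"
    using ms by (intro finite_measure_mono) auto
  also have "\<dots> \<le> measure M ?D1 + measure M ?D2"
    using ms by (intro measure_Un_le) auto
  finally show ?thesis using C D unfolding word_approx_def
    by (intro exI[of _ ?m] exI[of _ ?N] exI[of _ "C \<union> D"]) linarith
qed

text \<open>Pulling back by \<open>f\<^sup>n\<close> turns a two-sided cylinder into a one-sided one, so that the
  two cases of a generating partition can be treated alike.\<close>

lemma word_approx_borel:
  assumes "prob_space M" "sets M = sets borel" "f \<in> borel_measurable borel" "distr M M f = M"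
    and P: "finite P" "measurable_partition P" "generating f P" and B: "B \<in> sets borel" and e: "e > 0"
  shows "\<exists>m N. word_approx M f (cell P) e m N B"
proof -
  interpret prob_space M by fact
  have sp: "space M = UNIV" using sets_eq_imp_space_eq[OF assms(2)] by simp
  have fM: "f \<in> M \<rightarrow>\<^sub>M M" using assms(3) by (simp cong: measurable_cong_sets add: assms(2))
  have part: "partition_on UNIV P" using P(2) by (simp add: measurable_partition_def)
  note sf = simple_function_cell[OF P(1,2) assms(2)]
  let ?p = "cell P"
  note std = assms(1) fM assms(4) sf
  have lab: "x \<in> A \<longleftrightarrow> ?p x = A" if "A \<in> P" for x A
    using cell[OF part] cell_eq[OF part that] by blast
  let ?G = "\<Union>n. if bij f then partition_join_two_sided f P n else partition_join f P n"
  have gen: "sigma_sets UNIV ?G = sets borel" using P(3) by (simp add: generating_def)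
  have exact: "word_approx M f ?p e m N B" if "(f ^^ m) -` B = itin f ?p N -` C" "e > 0" for e m N B C
    unfolding word_approx_def using that by (intro exI[of _ C]) simp
  have "B \<in> sigma_sets UNIV ?G" using B gen by simp
  then show ?thesis using e
  proof (induction arbitrary: e rule: sigma_sets.induct)
    case (Basic A)
    then obtain n where n: "A \<in> (if bij f then partition_join_two_sided f P n else partition_join f P n)" by blast
    show ?case
    proof (cases "bij f")
      case True
      then obtain a where a: "A = (\<Inter>k\<le>n. (f ^^ k) -` a (int k)) \<inter> (\<Inter>k\<le>n. (f ^^ k) ` a (- int k))"
        "\<forall>k. \<bar>k\<bar> \<le> int n \<longrightarrow> a k \<in> P"
        using n unfolding partition_join_two_sided_def by auto
      have im: "(f ^^ n) x \<in> (f ^^ k) ` Y \<longleftrightarrow> (f ^^ (n - k)) x \<in> Y" if "k \<le> n" for x k Y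
      proof -
        have "(f ^^ n) x = (f ^^ k) ((f ^^ (n - k)) x)"
          using that by (metis comp_apply funpow_add le_add_diff_inverse)
        moreover have "inj (f ^^ k)" using True by (simp add: bij_is_inj inj_fn)
        ultimately show ?thesis by (simp add: inj_image_mem_iff)
      qed
      \<comment> \<open>After the pullback the times \<open>-n\<close> to \<open>n\<close> become
        \<open>0\<close> to \<open>2 * n\<close>: time \<open>k\<close> is letter
        \<open>k + n\<close>, and time \<open>-k\<close> is letter \<open>n - k\<close>.\<close>
      have "(f ^^ n) -` A = itin f ?p (2 * n + 1) -` {w. \<forall>k\<le>n. w ! (k + n) = a (int k) \<and> w ! (n - k) = a (- int k)}"
      proof (rule set_eqI)
        fix x
        have nth: "itin f ?p (2 * n + 1) x ! (k + n) = ?p ((f ^^ k) ((f ^^ n) x))"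
          "itin f ?p (2 * n + 1) x ! (n - k) = ?p ((f ^^ (n - k)) x)" if "k \<le> n" for k
          using that by (subst nth_itin; simp add: funpow_add)+
        have aP: "a (int k) \<in> P" "a (- int k) \<in> P" if "k \<le> n" for k using a(2) that by auto
        have "x \<in> (f ^^ n) -` A \<longleftrightarrow> (\<forall>k\<le>n. (f ^^ k) ((f ^^ n) x) \<in> a (int k) \<and> (f ^^ (n - k)) x \<in> a (- int k))"
          by (auto simp: a(1) im)
        also have "\<dots> \<longleftrightarrow> (\<forall>k\<le>n. ?p ((f ^^ k) ((f ^^ n) x)) = a (int k) \<and> ?p ((f ^^ (n - k)) x) = a (- int k))"
          using lab aP by simp
        finally show "x \<in> (f ^^ n) -` A \<longleftrightarrow> x \<in> itin f ?p (2 * n + 1) -`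
            {w. \<forall>k\<le>n. w ! (k + n) = a (int k) \<and> w ! (n - k) = a (- int k)}"
          using nth by (simp del: itin.simps)
      qed
      from exact[OF this Basic.prems] show ?thesis by blast
    next
      case False
      then obtain a where a: "A = (\<Inter>k\<le>n. (f ^^ k) -` a k)" "\<forall>k\<le>n. a k \<in> P"
        using n unfolding partition_join_def by auto
      have "(f ^^ 0) -` A = itin f ?p (n + 1) -` {w. \<forall>k\<le>n. w ! k = a k}"
        using a(2) by (auto simp: a(1) lab simp del: itin.simps)
      from exact[OF this Basic.prems] show ?thesis by blast
    qed
  next
    case Empty
    have "(f ^^ 0) -` {} = itin f ?p 0 -` {}" by simp
    from exact[OF this Empty] show ?case by blast
  next
    case (Compl A)
    then obtain m N C where C: "measure M (sym_diff ((f ^^ m) -` A) (itin f ?p N -` C)) < e"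
      using Compl.IH[OF Compl.prems] unfolding word_approx_def sp Int_UNIV_right by blast
    have "sym_diff ((f ^^ m) -` (UNIV - A)) (itin f ?p N -` (- C)) = sym_diff ((f ^^ m) -` A) (itin f ?p N -` C)"
      by auto
    then show ?case using C unfolding word_approx_def sp
      by (intro exI[of _ m] exI[of _ N] exI[of _ "- C"]) simp
  next
    case (Union A)
    then have A: "A i \<in> sets M" for i using gen assms(2) by auto
    have fin: "\<exists>m N. word_approx M f ?p d m N (\<Union>i<k. A i)" if "d > 0" for k d using that
    proof (induction k arbitrary: d)
      case 0
      have "(f ^^ 0) -` (\<Union>i<0. A i) = itin f ?p 0 -` {}" by simp
      from exact[OF this 0] show ?case by blast
    next
      case (Suc k)
      have d2: "d / 2 > 0" using Suc.prems by simp
      obtain m N where 1: "word_approx M f ?p (d/2) m N (\<Union>i<k. A i)" using Suc.IH[OF d2] by blast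
      obtain m' N' where 2: "word_approx M f ?p (d/2) m' N' (A k)" using Union.IH[OF d2] by blast
      have "(\<Union>i<k. A i) \<in> sets M" using A by auto
      from word_approx_Un[OF std this A 1 2] show ?case by (simp add: lessThan_Suc Un_commute)
    qed
    let ?B = "\<Union>i. A i"
    \<comment> \<open>Half of \<open>e\<close> pays for cutting the union down to finitely many
      sets, the other half for approximating the finite union.\<close>
    have "(\<lambda>k. measure M (\<Union>i<k. A i)) \<longlonglongrightarrow> measure M (\<Union>k. \<Union>i<k. A i)"
      using A by (intro finite_Lim_measure_incseq) (auto simp: incseq_def, meson lessThan_iff order_less_le_trans)
    moreover have "(\<Union>k. \<Union>i<k. A i) = ?B" by auto
    ultimately have "(\<lambda>k. measure M (\<Union>i<k. A i)) \<longlonglongrightarrow> measure M ?B" by simp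
    then have "\<forall>\<^sub>F k in sequentially. measure M (\<Union>i<k. A i) > measure M ?B - e / 2"
      by (rule order_tendstoD) (use Union.prems in simp)
    then obtain k where "measure M (\<Union>i<k. A i) > measure M ?B - e / 2"
      unfolding eventually_sequentially by blast
    then have k: "measure M ?B - measure M (\<Union>i<k. A i) < e / 2" by simp
    obtain m N C where C: "measure M (sym_diff ((f ^^ m) -` (\<Union>i<k. A i)) (itin f ?p N -` C)) < e / 2"
      using fin[of "e / 2" k] Union.prems unfolding word_approx_def sp by auto
    let ?Ak = "\<Union>i<k. A i"
    let ?E = "sym_diff ((f ^^ m) -` ?Ak) (itin f ?p N -` C)" and ?R = "(f ^^ m) -` (?B - ?Ak)"
    have mB: "?B \<in> sets M" "?Ak \<in> sets M" using A by auto
    have "measure M (?B - ?Ak) < e / 2"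
      using k mB by (subst finite_measure_Diff) auto
    moreover have "?R \<inter> space M = ?R" by (simp add: sp)
    ultimately have 3: "measure M (?R) < e / 2"
      using measure_vimage_funpow[OF fM assms(4), of "?B - ?Ak" m] mB by auto
    have ms: "(f ^^ m) -` X \<in> sets M" if "X \<in> sets M" for X
      using measurable_sets[OF measurable_funpow[OF fM] that] by (simp add: sp)
    have mw: "itin f ?p N -` X \<in> sets M" for X
      using simple_functionD(2)[OF simple_function_itin[OF fM sf]] by (simp add: sp)
    have "measure M (sym_diff ((f ^^ m) -` ?B) (itin f ?p N -` C))
      \<le> measure M (?R \<union> ?E)"
      using ms[OF mB(1)] ms[OF mB(2)] ms[of "?B - ?Ak"] mB mw by (intro finite_measure_mono) auto
    also have "\<dots> \<le> measure M (?R) + measure M (?E)"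
      using ms[OF mB(1)] ms[OF mB(2)] ms[of "?B - ?Ak"] mB mw by (intro measure_Un_le) auto
    also have "\<dots> < e" using 3 C by simp
    finally show ?case unfolding word_approx_def sp by auto
  qed
qed

text \<open>Each cell of \<open>Q\<close> is approximated by a set of words up to
  \<open>e / card Q\<close>. A word is decoded to a cell whose set of words contains it; off the
  union of the error sets, the cell visited at time \<open>m\<close> is the only candidate.\<close>

lemma partition_predicted_by_itin:
  assumes "prob_space M" "sets M = sets borel" "f \<in> borel_measurable borel" "distr M M f = M"
    and P: "finite P" "measurable_partition P" "generating f P"
    and Q: "finite Q" "measurable_partition Q" and e: "e > 0"
  shows "\<exists>m N g. measure M {x\<in>space M. g (itin f (cell P) N x) \<noteq> cell Q ((f ^^ m) x)} < e"
proof -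
  interpret prob_space M by fact
  have sp: "space M = UNIV" using sets_eq_imp_space_eq[OF assms(2)] by simp
  have fM: "f \<in> M \<rightarrow>\<^sub>M M" using assms(3) by (simp cong: measurable_cong_sets add: assms(2))
  have part: "partition_on UNIV Q" and Qs: "Q \<subseteq> sets M"
    using Q(2) assms(2) by (auto simp: measurable_partition_def)
  note sf = simple_function_cell[OF P(1,2) assms(2)]
  let ?p = "cell P"
  note std = assms(1) fM assms(4) sf
  have "Q \<noteq> {}" using partition_onD1[OF part] by auto
  then have cQ: "real (card Q) > 0" using Q(1) by (simp add: card_gt_0_iff)
  define d where "d = e / real (card Q)"
  have d: "d > 0" using e cQ by (simp add: d_def)
  have "\<exists>m N. \<forall>B\<in>R. word_approx M f ?p d m N B" if "finite R" "R \<subseteq> Q" for R using that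
  proof (induction R)
    case (insert B R)
    then obtain m N where 1: "\<forall>B\<in>R. word_approx M f ?p d m N B" by auto
    have Bs: "B \<in> sets M" using insert.prems Qs by auto
    obtain m' N' where 2: "word_approx M f ?p d m' N' B"
      using word_approx_borel[OF assms(1-4) P _ d] Bs assms(2) by metis
    have "word_approx M f ?p d (m + m') (m + m' + N + N') A" if "A \<in> insert B R" for A
    proof (cases "A = B")
      case True
      show ?thesis unfolding True by (rule word_approx_mono[OF std Bs 2]) auto
    next
      case False
      then have A: "A \<in> R" "A \<in> sets M" using that insert.prems Qs by auto
      show ?thesis by (rule word_approx_mono[OF std A(2) bspec[OF 1 A(1)]]) auto
    qed
    then show ?case by blast
  qed simp
  from this[OF Q(1)] obtain m N where "\<forall>B\<in>Q. word_approx M f ?p d m N B" by auto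
  then obtain C where C: "\<And>B. B \<in> Q \<Longrightarrow> measure M (sym_diff ((f ^^ m) -` B) (itin f ?p N -` C B)) < d"
    unfolding word_approx_def sp Int_UNIV_right by metis
  define g where "g w = (SOME B. B \<in> Q \<and> w \<in> C B)" for w
  let ?E = "{x\<in>space M. g (itin f ?p N x) \<noteq> cell Q ((f ^^ m) x)}"
  let ?D = "\<lambda>B. sym_diff ((f ^^ m) -` B) (itin f ?p N -` C B)"
  have sub: "?E \<subseteq> (\<Union>B\<in>Q. ?D B)"
  proof (rule subsetI, rule ccontr)
    fix x assume x: "x \<in> ?E"
      and nx: "x \<notin> (\<Union>B\<in>Q. ?D B)"
    then have iff: "itin f ?p N x \<in> C B \<longleftrightarrow> (f ^^ m) x \<in> B" if "B \<in> Q" for B using that by auto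
    have "g (itin f ?p N x) = cell Q ((f ^^ m) x)"
      unfolding g_def
    proof (rule some_equality)
      show "cell Q ((f ^^ m) x) \<in> Q \<and> itin f ?p N x \<in> C (cell Q ((f ^^ m) x))"
        using cell[OF part] iff by blast
      show "B = cell Q ((f ^^ m) x)" if "B \<in> Q \<and> itin f ?p N x \<in> C B" for B
        using that iff cell_eq[OF part] by blast
    qed
    with x show False by simp
  qed
  have ms: "?D B \<in> sets M" if "B \<in> Q" for B
    using measurable_sets[OF measurable_funpow[OF fM, of m], of B] that Qs
      simple_functionD(2)[OF simple_function_itin[OF fM sf, of N], of "C B"] by (auto simp: sp)
  have "measure M ?E \<le> measure M (\<Union>B\<in>Q. ?D B)"
    using sub ms Q(1) by (intro finite_measure_mono) auto
  also have "\<dots> \<le> (\<Sum>B\<in>Q. measure M (?D B))"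
    using ms Q(1) by (intro finite_measure_subadditive_finite) auto
  also have "\<dots> < (\<Sum>B\<in>Q. d)"
    using Q(1) \<open>Q \<noteq> {}\<close> C by (intro sum_strict_mono) auto
  also have "\<dots> = e" using cQ by (simp add: d_def)
  finally show ?thesis by blast
qed

text \<open>The role of the generator: any finite \<open>Q\<close> is predicted from
  \<open>P\<close> at a cost per letter that tends to 0 with \<beta>, while \<open>N\<close> and
  \<open>c\<close> add only a constant, which disappears after division by the length.\<close>

lemma ks_entropy_le:
  assumes "prob_space M" "sets M = sets borel" "f \<in> borel_measurable borel" "distr M borel f = M"
    and P: "finite P" "measurable_partition P" "generating f P"
    and bound: "\<And>n. code_entropy M (itin f (cell P) n) \<le> r * real n + c"
  shows "ks_entropy f M \<le> ereal r"
  unfolding ks_entropy_def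
proof (intro SUP_least, unfold mem_Collect_eq ereal_less_eq)
  fix Q :: "'a set set" assume Q: "finite Q \<and> measurable_partition Q"
  interpret prob_space M by fact
  have fM: "f \<in> M \<rightarrow>\<^sub>M M" using assms(3) by (simp cong: measurable_cong_sets add: assms(2))
  have d: "distr M M f = M" using assms(4) distr_cong[OF refl assms(2), where f=f and g=f] by simp
  let ?p = "cell P" let ?q = "cell Q"
  have sp: "simple_function M ?p" by (intro simple_function_cell P assms)
  have sq: "simple_function M ?q" using Q by (intro simple_function_cell assms) auto
  have lim: "(\<lambda>n. code_entropy M (itin f ?q (Suc n)) / real (Suc n)) \<longlonglongrightarrow> entropy_wrt_partition f M Q"
    using Q by (intro entropy_wrt_partition_LIMSEQ assms) auto
  let ?d = "real (card (?q ` space M))"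
  let ?h = "\<lambda>\<beta>. \<beta> - ln (1 - \<beta>)"
  have main: "entropy_wrt_partition f M Q \<le> r + ?h \<beta>" if \<beta>: "0 < \<beta>" "\<beta> < 1" for \<beta>
  proof -
    let ?c = "ln (?d / \<beta>)"
    have D1: "?d \<ge> 1" using simple_functionD(1)[OF sq] not_empty by (simp add: Suc_le_eq card_gt_0_iff)
    have c0: "?c > 0" using D1 \<beta> by (intro ln_gt_zero) (simp add: field_simps)
    \<comment> \<open>A prediction error below \<open>\<beta> / ?c\<close> keeps the total charge
      for wrong letters at most \<beta> per step.\<close>
    have "\<beta> / ?c > 0" using \<beta> c0 by simp
    then obtain m N g where g: "measure M {x\<in>space M. g (itin f ?p N x) \<noteq> ?q ((f ^^ m) x)} < \<beta> / ?c"
      using partition_predicted_by_itin[OF assms(1-3) d P, of Q "\<beta> / ?c"] Q by blast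
    let ?E = "{x\<in>space M. g (itin f ?p N x) \<noteq> ?q ((f ^^ m) x)}"
    have E: "measure M ?E * ?c \<le> \<beta>" using g c0 by (simp add: field_simps less_imp_le)
    have le: "code_entropy M (itin f ?q (Suc n)) / real (Suc n)
        \<le> r + ?h \<beta> + (r * real N + c) / real (Suc n)" for n
    proof -
      have "code_entropy M (itin f ?q (Suc n)) \<le> code_entropy M (itin f ?p (Suc n + N))
          + real (Suc n) * (measure M ?E * ?c - ln (1 - \<beta>))"
        by (rule code_entropy_itin_le[OF assms(1) fM d sp sq \<beta>])
      also have "\<dots> \<le> r * real (Suc n + N) + c + real (Suc n) * ?h \<beta>"
        using E by (intro add_mono bound mult_left_mono) auto
      also have "\<dots> = real (Suc n) * (r + ?h \<beta>) + (r * real N + c)"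
        by (simp add: algebra_simps)
      finally have "code_entropy M (itin f ?q (Suc n)) / real (Suc n)
        \<le> (real (Suc n) * (r + ?h \<beta>) + (r * real N + c)) / real (Suc n)"
        by (rule divide_right_mono) simp
      then show ?thesis by (simp only: add_divide_distrib) simp
    qed
    have "(\<lambda>n. r + ?h \<beta> + (r * real N + c) / real (Suc n)) \<longlonglongrightarrow> r + ?h \<beta> + 0"
      by (intro tendsto_add tendsto_const LIMSEQ_Suc[OF lim_const_over_n])
    then have "entropy_wrt_partition f M Q \<le> r + ?h \<beta> + 0"
      by (rule LIMSEQ_le[OF lim]) (use le in blast)
    then show ?thesis by simp
  qed
  have t: "((\<lambda>\<beta>. r + ?h \<beta>) \<longlongrightarrow> r + (0 - ln (1 - 0))) (at_right 0)"
    by (intro tendsto_intros) auto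
  have "entropy_wrt_partition f M Q \<le> r + (0 - ln (1 - 0))"
    by (rule tendsto_lowerbound[OF t])
       (auto simp: eventually_at_right_field intro!: exI[of _ 1] main)
  then show "entropy_wrt_partition f M Q \<le> r" by simp
qed

section \<open>Weights of parsed itineraries\<close>

definition birkhoff_sum :: "('a \<Rightarrow> 'a) \<Rightarrow> ('a \<Rightarrow> real) \<Rightarrow> nat \<Rightarrow> 'a \<Rightarrow> real" where
  "birkhoff_sum f g n x = (\<Sum>j<n. g ((f ^^ j) x))"

lemma birkhoff_sum_0 [simp]: "birkhoff_sum f g 0 x = 0"
  by (simp add: birkhoff_sum_def)

lemma birkhoff_sum_add:
  "birkhoff_sum f g (m + n) x = birkhoff_sum f g m x + birkhoff_sum f g n ((f ^^ m) x)"
proof -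
  have "(\<Sum>j<m + n. g ((f ^^ j) x)) = (\<Sum>j<m. g ((f ^^ j) x)) + (\<Sum>j=m..<m + n. g ((f ^^ j) x))"
    by (subst sum.atLeastLessThan_concat[of 0 m "m + n", symmetric, simplified lessThan_atLeast0[symmetric]])
       (auto simp: lessThan_atLeast0)
  also have "(\<Sum>j=m..<m + n. g ((f ^^ j) x)) = (\<Sum>j<n. g ((f ^^ j) ((f ^^ m) x)))"
    using sum.shift_bounds_nat_ivl[of "\<lambda>j. g ((f ^^ j) x)" 0 m n]
    by (simp add: lessThan_atLeast0 funpow_add add.commute)
  finally show ?thesis by (simp add: birkhoff_sum_def)
qed

lemma birkhoff_sum_Suc: "birkhoff_sum f g (Suc n) x = g x + birkhoff_sum f g n (f x)"
  using birkhoff_sum_add[of f g 1 n x] by (simp add: birkhoff_sum_def)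

lemma birkhoff_sum_mono: "(\<And>x. g x \<le> h x) \<Longrightarrow> birkhoff_sum f g n x \<le> birkhoff_sum f h n x"
  by (simp add: birkhoff_sum_def sum_mono)

lemma birkhoff_sum_nonneg: "(\<And>x. 0 \<le> g x) \<Longrightarrow> 0 \<le> birkhoff_sum f g n x"
  by (simp add: birkhoff_sum_def sum_nonneg)

text \<open>A word is parsed into single letters, each of weight \<open>\<alpha>\<close>, and blocks \<open>nm a\<close>, each of
  weight \<open>\<beta> * s a\<close>; the weight of the word is the sum over all parses with at most \<open>k\<close> parts.\<close>

primrec word_weight :: "ennreal \<Rightarrow> ennreal \<Rightarrow> 'i set \<Rightarrow> ('i \<Rightarrow> 'b list) \<Rightarrow> ('i \<Rightarrow> ennreal) \<Rightarrow> nat \<Rightarrow> 'b list \<Rightarrow> ennreal"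
where
  "word_weight \<alpha> \<beta> S nm s 0 w = (if w = [] then 1 else 0)"
| "word_weight \<alpha> \<beta> S nm s (Suc k) w = (if w = [] then 1 else
     \<alpha> * word_weight \<alpha> \<beta> S nm s k (tl w) +
     (\<integral>\<^sup>+a. (if take (length (nm a)) w = nm a
        then \<beta> * s a * word_weight \<alpha> \<beta> S nm s k (drop (length (nm a)) w) else 0) \<partial>count_space S))"

lemma word_weight_Nil [simp]: "word_weight \<alpha> \<beta> S nm s k [] = 1"
  by (cases k) auto

lemma word_weight_letter:
  "w \<noteq> [] \<Longrightarrow> \<alpha> * word_weight \<alpha> \<beta> S nm s k (tl w) \<le> word_weight \<alpha> \<beta> S nm s (Suc k) w"
  by simp

lemma word_weight_block:
  assumes "a \<in> S" "take (length (nm a)) w = nm a" "w \<noteq> []"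
  shows "\<beta> * s a * word_weight \<alpha> \<beta> S nm s k (drop (length (nm a)) w) \<le> word_weight \<alpha> \<beta> S nm s (Suc k) w"
proof -
  let ?g = "\<lambda>a. if take (length (nm a)) w = nm a
        then \<beta> * s a * word_weight \<alpha> \<beta> S nm s k (drop (length (nm a)) w) else 0"
  have "?g a \<le> (\<integral>\<^sup>+a. ?g a \<partial>count_space S)" using assms(1) by (rule nn_integral_ge_point)
  also have "\<dots> \<le> word_weight \<alpha> \<beta> S nm s (Suc k) w" using assms(3) by simp
  finally show ?thesis using assms(2) by simp
qed

text \<open>A renewal estimate: \<open>rho\<close> says that letters and blocks, discounted by
  \<open>exp (- \<rho>)\<close> per unit of length, have total weight at most 1. Splitting off the
  first part leaves totals over shorter words, which induction on the number of parts
  bounds.\<close>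

lemma sum_word_weight_le:
  assumes P: "finite P" and len: "\<And>a. a \<in> S \<Longrightarrow> length (nm a) > 0"
    and rho: "of_nat (card P) * \<alpha> * ennreal (exp (- \<rho>))
      + \<beta> * (\<integral>\<^sup>+a. s a * ennreal (exp (- \<rho> * real (length (nm a)))) \<partial>count_space S) \<le> 1"
  shows "(\<Sum>w\<in>{w. set w \<subseteq> P \<and> length w = n}. word_weight \<alpha> \<beta> S nm s k w) \<le> ennreal (exp (\<rho> * real n))"
proof (induction k arbitrary: n)
  case 0
  let ?L = "{w. set w \<subseteq> P \<and> length w = n}"
  have "(\<Sum>w\<in>?L. word_weight \<alpha> \<beta> S nm s 0 w) \<le> (\<Sum>w\<in>?L. if w = [] then 1 else 0)" by simp
  also have "\<dots> \<le> ennreal (exp (\<rho> * real n))"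
  proof (cases n)
    case 0
    then have "?L = {[]}" by auto
    then show ?thesis using 0 by simp
  next
    case (Suc m)
    then have "(\<Sum>w\<in>?L. if w = [] then 1 else 0) = (0::ennreal)"
      by (intro sum.neutral) auto
    then show ?thesis by simp
  qed
  finally show ?case .
next
  case (Suc k)
  let ?L = "\<lambda>n. {w. set w \<subseteq> P \<and> length w = n}"
  let ?w = "word_weight \<alpha> \<beta> S nm s k"
  have finL: "finite (?L n)" for n by (rule finite_lists_length_eq[OF P])
  show ?case
  proof (cases n)
    case 0
    then have "?L n = {[]}" by auto
    then show ?thesis using 0 by simp
  next
    case (Suc m)
    let ?g = "\<lambda>w a. if take (length (nm a)) w = nm a
        then \<beta> * s a * ?w (drop (length (nm a)) w) else 0"
    have "(\<Sum>w\<in>?L n. word_weight \<alpha> \<beta> S nm s (Suc k) w)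
        = (\<Sum>w\<in>?L n. \<alpha> * ?w (tl w) + (\<integral>\<^sup>+a. ?g w a \<partial>count_space S))"
      using Suc by (intro sum.cong) auto
    also have "\<dots> = (\<Sum>w\<in>?L n. \<alpha> * ?w (tl w)) + (\<integral>\<^sup>+a. (\<Sum>w\<in>?L n. ?g w a) \<partial>count_space S)"
      by (subst nn_integral_sum) (auto simp: sum.distrib)
    also have "(\<Sum>w\<in>?L n. \<alpha> * ?w (tl w)) = of_nat (card P) * \<alpha> * (\<Sum>w\<in>?L m. ?w w)"
    proof -
      have "(\<Sum>w\<in>?L n. \<alpha> * ?w (tl w)) = (\<Sum>(w, c)\<in>?L m \<times> P. \<alpha> * ?w w)"
        unfolding Suc lists_length_Suc_eq
        by (subst sum.reindex) (auto simp: inj_on_def case_prod_beta)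
      also have "\<dots> = of_nat (card P) * \<alpha> * (\<Sum>w\<in>?L m. ?w w)"
        by (simp add: sum.cartesian_product[symmetric] sum_distrib_left[symmetric] mult.assoc)
      finally show ?thesis .
    qed
    also have "\<dots> \<le> of_nat (card P) * \<alpha> * ennreal (exp (\<rho> * real m))"
      by (intro mult_left_mono Suc.IH) auto
    also have "ennreal (exp (\<rho> * real m)) = ennreal (exp (\<rho> * real n)) * ennreal (exp (- \<rho>))"
      by (simp add: Suc ennreal_mult[symmetric] exp_add[symmetric] algebra_simps)
    also have "(\<integral>\<^sup>+a. (\<Sum>w\<in>?L n. ?g w a) \<partial>count_space S)
        \<le> (\<integral>\<^sup>+a. ennreal (exp (\<rho> * real n)) * (\<beta> * (s a * ennreal (exp (- \<rho> * real (length (nm a)))))) \<partial>count_space S)"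
    proof (rule nn_integral_mono, goal_cases)
      case (1 a)
      let ?l = "length (nm a)"
      let ?M = "{w \<in> ?L n. take ?l w = nm a}"
      have "(\<Sum>w\<in>?L n. ?g w a) = (\<Sum>w\<in>?M. \<beta> * s a * ?w (drop ?l w))"
        by (intro sum.mono_neutral_cong_right finL) auto
      also have "\<dots> = \<beta> * s a * (\<Sum>w\<in>?M. ?w (drop ?l w))" by (simp add: sum_distrib_left)
      also have "\<dots> \<le> \<beta> * s a * (ennreal (exp (\<rho> * real n)) * ennreal (exp (- \<rho> * real ?l)))"
      proof (rule mult_left_mono)
        show "(\<Sum>w\<in>?M. ?w (drop ?l w)) \<le> ennreal (exp (\<rho> * real n)) * ennreal (exp (- \<rho> * real ?l))"
      proof (cases "?l \<le> n")
        case True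
        \<comment> \<open>Words that begin with the fixed block \<open>nm a\<close> are determined
          by what follows it.\<close>
        have inj: "inj_on (drop ?l) ?M" by (rule inj_onI) (metis (mono_tags, lifting) append_take_drop_id mem_Collect_eq)
        have "(\<Sum>w\<in>?M. ?w (drop ?l w)) = (\<Sum>w\<in>drop ?l ` ?M. ?w w)"
          by (subst sum.reindex[OF inj]) simp
        also have "\<dots> \<le> (\<Sum>w\<in>?L (n - ?l). ?w w)"
          by (intro sum_mono2 finL) (auto dest: in_set_dropD)
        also have "\<dots> \<le> ennreal (exp (\<rho> * real (n - ?l)))" by (rule Suc.IH)
        also have "\<dots> = ennreal (exp (\<rho> * real n)) * ennreal (exp (- \<rho> * real ?l))"
          using True by (simp add: of_nat_diff ennreal_mult[symmetric] exp_add[symmetric] algebra_simps)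
        finally show ?thesis .
      next
        case False
        have "take ?l w \<noteq> nm a" if "length w = n" for w
          using False that by (metis length_take min.cobounded1 order.refl)
        then have "?M = {}" by auto
        then show ?thesis by (simp only: sum.empty) simp
      qed
      qed simp
      finally show ?case by (simp add: mult_ac)
    qed
    also have "\<dots> = ennreal (exp (\<rho> * real n)) *
        (\<beta> * (\<integral>\<^sup>+a. s a * ennreal (exp (- \<rho> * real (length (nm a)))) \<partial>count_space S))"
      by (subst nn_integral_cmult; simp)+
    finally have "(\<Sum>w\<in>?L n. word_weight \<alpha> \<beta> S nm s (Suc k) w) \<le> ennreal (exp (\<rho> * real n)) *
       (of_nat (card P) * \<alpha> * ennreal (exp (- \<rho>))
       + \<beta> * (\<integral>\<^sup>+a. s a * ennreal (exp (- \<rho> * real (length (nm a)))) \<partial>count_space S))"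
      by (simp add: distrib_left mult_ac)
    also have "\<dots> \<le> ennreal (exp (\<rho> * real n)) * 1" by (intro mult_left_mono rho) simp
    finally show ?thesis by simp
  qed
qed

section \<open>Lower bounds for the weight of an itinerary\<close>

lemma word_weight_itin_ge_power:
  "n \<le> k \<Longrightarrow> \<alpha> ^ n \<le> word_weight \<alpha> \<beta> S nm s k (itin f p n x)"
proof (induction n arbitrary: k x)
  case (Suc n)
  then obtain l where k: "k = Suc l" "n \<le> l" by (cases k) auto
  have "\<alpha> ^ Suc n \<le> \<alpha> * word_weight \<alpha> \<beta> S nm s l (itin f p n (f x))"
    using Suc.IH[OF k(2)] by (simp add: mult_left_mono)
  also have "\<dots> \<le> word_weight \<alpha> \<beta> S nm s k (itin f p (Suc n) x)"
    using word_weight_letter[of "itin f p (Suc n) x"] by (simp add: k del: word_weight.simps)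
  finally show ?case .
qed simp

definition induced_time :: "('a \<Rightarrow> 'a) \<Rightarrow> ('a \<Rightarrow> nat) \<Rightarrow> nat \<Rightarrow> 'a \<Rightarrow> nat" where
  "induced_time F t i x = (\<Sum>k<i. t ((F ^^ k) x))"

lemma induced_time_0 [simp]: "induced_time F t 0 x = 0"
  by (simp add: induced_time_def)

lemma induced_time_Suc: "induced_time F t (Suc i) x = t x + induced_time F t i (F x)"
  unfolding induced_time_def by (subst sum.lessThan_Suc_shift) (simp add: funpow_swap1)

text \<open>The first \<open>i\<close> induced steps are read as blocks. Each uses up one allowed
  part and at least one letter, so the parts left over still suffice for the remaining word.\<close>

lemma word_weight_itin_blocks:
  assumes F: "\<And>x. x \<in> W \<Longrightarrow> F x = (f ^^ t x) x" "\<And>x. x \<in> W \<Longrightarrow> F x \<in> W" "\<And>x. x \<in> W \<Longrightarrow> t x > 0"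
    and block: "\<And>x. x \<in> W \<Longrightarrow> \<exists>a\<in>S. nm a = itin f p (t x) x \<and> ennreal (exp (birkhoff_sum f \<phi> (t x) x)) \<le> s a"
    and "x \<in> W" "induced_time F t i x \<le> n" "n \<le> k"
  shows "\<exists>k'\<ge>n - induced_time F t i x. \<beta> ^ i * ennreal (exp (birkhoff_sum f \<phi> (induced_time F t i x) x))
      * word_weight \<alpha> \<beta> S nm s k' (itin f p (n - induced_time F t i x) ((f ^^ induced_time F t i x) x))
      \<le> word_weight \<alpha> \<beta> S nm s k (itin f p n x)"
  using assms(5-)
proof (induction i arbitrary: x n k)
  case 0 then show ?case by auto
next
  case (Suc i)
  let ?T = "induced_time F t i (F x)"
  let ?w = "word_weight \<alpha> \<beta> S nm s" and ?rest = "itin f p (n - t x - ?T) ((f ^^ ?T) (F x))"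
  note Tx = induced_time_Suc[of F t i x]
  have tx: "t x \<le> n" "t x > 0" using Suc.prems F(3) Tx by auto
  then have n: "n \<noteq> 0" by simp
  then have ne: "itin f p n x \<noteq> []" by (metis length_itin list.size(3))
  from Suc.prems n obtain l where l: "k = Suc l" by (cases k) auto
  obtain a where a: "a \<in> S" "nm a = itin f p (t x) x" "ennreal (exp (birkhoff_sum f \<phi> (t x) x)) \<le> s a"
    using block[OF Suc.prems(1)] by blast
  have "\<exists>k'\<ge>n - t x - ?T. \<beta> ^ i * ennreal (exp (birkhoff_sum f \<phi> ?T (F x)))
      * ?w k' ?rest
      \<le> ?w l (itin f p (n - t x) (F x))"
    using Suc.prems Tx tx l by (intro Suc.IH F) auto
  then obtain k' where k': "k' \<ge> n - t x - ?T"
    "\<beta> ^ i * ennreal (exp (birkhoff_sum f \<phi> ?T (F x)))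
      * ?w k' ?rest
      \<le> ?w l (itin f p (n - t x) (F x))" by blast
  have Fx: "F x = (f ^^ t x) x" using F(1) Suc.prems by simp
  have fT: "(f ^^ induced_time F t (Suc i) x) x = (f ^^ ?T) (F x)"
    by (simp add: Tx Fx funpow_add[symmetric, unfolded comp_def, THEN fun_cong] add.commute
       flip: comp_apply[of "f ^^ ?T" "f ^^ t x"] funpow_add)
  have "\<beta> ^ Suc i * ennreal (exp (birkhoff_sum f \<phi> (induced_time F t (Suc i) x) x))
      * ?w k' ?rest
     = \<beta> * ennreal (exp (birkhoff_sum f \<phi> (t x) x)) * (\<beta> ^ i * ennreal (exp (birkhoff_sum f \<phi> ?T (F x)))
      * ?w k' ?rest)"
    by (simp add: Tx birkhoff_sum_add Fx exp_add ennreal_mult mult_ac)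
  also have "\<dots> \<le> \<beta> * s a * ?w l (itin f p (n - t x) (F x))"
    using a(3) k'(2) by (intro mult_mono) auto
  also have "itin f p (n - t x) (F x) = drop (length (nm a)) (itin f p n x)"
    using tx by (simp add: a(2) drop_itin Fx)
  also have "\<beta> * s a * ?w l (drop (length (nm a)) (itin f p n x))
      \<le> ?w k (itin f p n x)"
    unfolding l using tx a(1) ne by (intro word_weight_block) (simp_all add: a(2) take_itin)
  finally show ?case using k'(1) unfolding fT by (intro exI[of _ k']) (simp add: Tx)
qed

text \<open>The parse behind this bound: from a point of \<open>G\<close> read \<open>i\<close> blocks, otherwise read a letter.
  Letters are read only on \<open>B\<close>, within the \<open>m\<close> steps before a visit to \<open>G\<close>, and in the last \<open>L\<close> steps.\<close>

lemma word_weight_itin_ge: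
  fixes \<epsilon> \<eta> A A' c T m L :: real
  assumes F: "\<And>x. x \<in> W \<Longrightarrow> F x = (f ^^ t x) x" "\<And>x. x \<in> W \<Longrightarrow> F x \<in> W" "\<And>x. x \<in> W \<Longrightarrow> t x > 0"
    and block: "\<And>x. x \<in> W \<Longrightarrow> \<exists>a\<in>S. nm a = itin f p (t x) x \<and> ennreal (exp (birkhoff_sum f \<phi> (t x) x)) \<le> s a"
    and const: "0 \<le> A" "0 \<le> c" "A' + T \<le> c" "0 \<le> \<epsilon>" "0 \<le> \<eta>" "0 \<le> L"
    and e: "\<And>x. 0 \<le> e x" "\<And>x. \<phi> x - e x \<le> T"
    and G: "\<And>x. x \<in> G \<Longrightarrow> x \<in> W \<and> (\<exists>i. 0 < induced_time F t i x \<and> m \<le> \<eta> * induced_time F t i x \<and>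
        induced_time F t i x \<le> L \<and> i \<le> \<epsilon> * induced_time F t i x)"
    and h: "\<And>x. 0 \<le> h x" "\<And>x. h x \<le> m" "\<And>x. x \<notin> G \<Longrightarrow> x \<notin> B \<Longrightarrow> h (f x) + 1 \<le> h x"
       "\<And>x. x \<in> B \<Longrightarrow> h (f x) \<le> h x"
    and nk: "n \<le> k"
  defines "bound \<equiv> (\<lambda>n x. birkhoff_sum f (\<lambda>x. \<phi> x - e x) n x - A * \<epsilon> * real n
      - c * (birkhoff_sum f (indicator B) n x + h x + \<eta> * real n + L))"
  shows "ennreal (exp (bound n x))
    \<le> word_weight (ennreal (exp (- A'))) (ennreal (exp (- A))) S nm s k (itin f p n x)"
  using nk
proof (induction n arbitrary: k x rule: less_induct)
  case (less n)
  let ?w = "word_weight (ennreal (exp (- A'))) (ennreal (exp (- A))) S nm s"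
  let ?pen = "\<lambda>n x. birkhoff_sum f (indicator B) n x + h x + \<eta> * real n + L"
  let ?S = "birkhoff_sum f (\<lambda>x. \<phi> x - e x)"
  have B0: "0 \<le> birkhoff_sum f (indicator B) n x" for n x by (rule birkhoff_sum_nonneg) simp
  show ?case
  proof (cases "real n < L \<or> n = 0")
    \<comment> \<open>The end of the word is read letter by letter. The reserve \<open>c * L\<close>
      pays for it: each letter needs \<open>A'\<close> for its weight and at most \<open>T\<close>
      for the potential, and \<open>A' + T \<le> c\<close>.\<close>
    case True
    have s1: "?S n x \<le> real n * T"
      unfolding birkhoff_sum_def using sum_bounded_above[of "{..<n}" "\<lambda>j. \<phi> ((f ^^ j) x) - e ((f ^^ j) x)" T] e(2)
      by simp
      have "bound n x \<le> real n * T - c * L"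
      proof -
        have "c * L \<le> c * (?pen n x)"
          using const h(1)[of x] B0[of n x] by (intro mult_left_mono) auto
        moreover have "0 \<le> A * \<epsilon> * real n" using const by simp
        ultimately show ?thesis unfolding bound_def using s1 by linarith
      qed
      also have "\<dots> \<le> - A' * real n"
      proof -
        have "(A' + T) * real n \<le> c * real n" using const by (intro mult_right_mono) auto
        also have "\<dots> \<le> c * L" using True const by (intro mult_left_mono) auto
        finally show ?thesis by (simp add: algebra_simps)
      qed
      finally have "ennreal (exp (bound n x)) \<le> ennreal (exp (- A' * real n))" by (simp add: ennreal_leI)
      also have "\<dots> = ennreal (exp (- A')) ^ n"
        by (simp add: ennreal_power exp_of_nat_mult[symmetric] mult.commute)
      also have "\<dots> \<le> ?w k (itin f p n x)" by (rule word_weight_itin_ge_power[OF less.prems])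
      finally show ?thesis .
  next
    case False
    then have n: "n > 0" "L \<le> real n" by auto
    show ?thesis
    proof (cases "x \<in> G")
      case True
      then obtain i where i: "0 < induced_time F t i x" "m \<le> \<eta> * induced_time F t i x"
        "induced_time F t i x \<le> L" "i \<le> \<epsilon> * induced_time F t i x" and xW: "x \<in> W" using G by blast
      define l where "l = induced_time F t i x"
      \<comment> \<open>The blocks fit into the remaining word because their length is at most
        \<open>L\<close>, and \<open>L \<le> n\<close> in this case.\<close>
      have ln: "l \<le> n" "l > 0" using i n by (auto simp: l_def)
      obtain k' where k': "k' \<ge> n - l" "ennreal (exp (- A)) ^ i * ennreal (exp (birkhoff_sum f \<phi> l x))
          * ?w k' (itin f p (n - l) ((f ^^ l) x)) \<le> ?w k (itin f p n x)"
        using word_weight_itin_blocks[OF F block xW, of i n k "ennreal (exp (- A))" "ennreal (exp (- A'))"]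
          ln less.prems unfolding l_def by blast
      let ?y = "(f ^^ l) x"
      have IH: "ennreal (exp (bound (n - l) ?y)) \<le> ?w k' (itin f p (n - l) ?y)"
        using ln k'(1) by (intro less.IH) auto
      have "bound n x \<le> - A * real i + birkhoff_sum f \<phi> l x + bound (n - l) ?y"
      proof -
        have add: "birkhoff_sum f g n x = birkhoff_sum f g l x + birkhoff_sum f g (n - l) ?y" for g
          using birkhoff_sum_add[of f g l "n - l" x] ln by simp
        have 1: "?S l x \<le> birkhoff_sum f \<phi> l x"
          by (rule birkhoff_sum_mono) (use e(1) in auto)
        have 2: "A * real i \<le> A * \<epsilon> * real l" using i(4) const by (simp add: l_def mult_left_mono mult.assoc)
        have nl: "real (n - l) = real n - real l" using ln by (simp add: of_nat_diff)
        \<comment> \<open>After the blocks \<open>h\<close> may jump, but at most to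
          \<open>m\<close>, and \<eta> times the length just read is at least
          \<open>m\<close>.\<close>
        have 3: "c * (?pen (n - l) ?y)
            \<le> c * (?pen n x)"
          using const i(2) h(2)[of ?y] h(1)[of x] B0[of l x] unfolding add nl
          by (intro mult_left_mono) (auto simp: l_def algebra_simps)
        have 4: "A * \<epsilon> * real n = A * \<epsilon> * real l + A * \<epsilon> * real (n - l)" by (simp add: nl algebra_simps)
        show ?thesis unfolding bound_def using 1 2 3 4 add[of "\<lambda>x. \<phi> x - e x"] by linarith
      qed
      then have "ennreal (exp (bound n x)) \<le> ennreal (exp (- A * real i + birkhoff_sum f \<phi> l x + bound (n - l) ?y))"
        by (simp add: ennreal_leI)
      also have "\<dots> = ennreal (exp (- A)) ^ i * ennreal (exp (birkhoff_sum f \<phi> l x)) * ennreal (exp (bound (n - l) ?y))"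
        by (simp add: ennreal_power ennreal_mult[symmetric] exp_of_nat_mult[symmetric] exp_add[symmetric] algebra_simps)
      also have "\<dots> \<le> ennreal (exp (- A)) ^ i * ennreal (exp (birkhoff_sum f \<phi> l x)) * ?w k' (itin f p (n - l) ?y)"
        by (intro mult_left_mono IH) simp
      finally show ?thesis using k'(2) by (rule order_trans)
    next
      case xG: False
      obtain n' where n': "n = Suc n'" using n by (cases n) auto
      obtain l where l: "k = Suc l" "n' \<le> l" using less.prems n' by (cases k) auto
      have IH: "ennreal (exp (bound n' (f x))) \<le> ?w l (itin f p n' (f x))"
        using n' l by (intro less.IH) auto
      have "bound n x \<le> - A' + bound n' (f x)"
      proof -
        \<comment> \<open>Reading a letter lowers the penalty by at least 1: either \<open>h\<close>
          drops or a visit to \<open>B\<close> is charged. The factor \<open>c\<close> then pays for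
          \<open>A'\<close> and \<open>T\<close>.\<close>
        have "h (f x) + 1 \<le> indicator B x + h x" using h(3,4)[of x] xG by (cases "x \<in> B") auto
        then have "c * 1 \<le> c * (?pen n x
           - (?pen n' (f x)))"
          using const unfolding n' birkhoff_sum_Suc by (intro mult_left_mono) (auto simp: algebra_simps)
        then have 1: "c \<le> c * (?pen n x)
           - c * (?pen n' (f x))"
          by (simp only: right_diff_distrib mult_1_right)
        have 2: "A * \<epsilon> * real n' \<le> A * \<epsilon> * real n" using const n' by (intro mult_left_mono) auto
        have 3: "?S n x = (\<phi> x - e x) + ?S n' (f x)"
          by (simp add: n' birkhoff_sum_Suc)
        show ?thesis unfolding bound_def using 1 2 3 e(2)[of x] const by linarith
      qed
      then have "ennreal (exp (bound n x)) \<le> ennreal (exp (- A' + bound n' (f x)))"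
        by (simp add: ennreal_leI)
      also have "\<dots> = ennreal (exp (- A')) * ennreal (exp (bound n' (f x)))"
        by (simp add: ennreal_mult[symmetric] exp_add[symmetric])
      also have "\<dots> \<le> ennreal (exp (- A')) * ?w l (itin f p n' (f x))"
        by (intro mult_left_mono IH) simp
      also have "\<dots> \<le> ?w k (itin f p n x)"
        using word_weight_letter[of "itin f p (Suc n') x"] by (simp add: l n' del: word_weight.simps)
      finally show ?thesis .
    qed
  qed
qed

section \<open>Induced systems with few blocks\<close>

locale ergodic_system = prob_space M for M :: "'a measure" +
  fixes f :: "'a \<Rightarrow> 'a"
  assumes space_UNIV: "space M = UNIV"
    and measurable_f [measurable]: "f \<in> M \<rightarrow>\<^sub>M M"
    and distr_f: "distr M M f = M"
    and ergodic: "\<And>A. A \<in> sets M \<Longrightarrow> f -` A = A \<Longrightarrow> emeasure M A = 0 \<or> emeasure M A = 1"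
begin

lemma measurable_fn [measurable]: "(f ^^ n) \<in> M \<rightarrow>\<^sub>M M"
  by (rule measurable_funpow[OF measurable_f])

lemma vimage_funpow_sets: "A \<in> sets M \<Longrightarrow> (f ^^ n) -` A \<in> sets M"
  using measurable_sets[OF measurable_fn, of A n] by (simp add: space_UNIV)

lemma measure_vimage: "A \<in> sets M \<Longrightarrow> measure M ((f ^^ n) -` A) = measure M A"
  using measure_vimage_funpow[OF measurable_f distr_f, of A n] by (simp add: space_UNIV)

lemma AE_comp_funpow:
  assumes "AE x in M. Q x" shows "AE x in M. \<forall>n. Q ((f ^^ n) x)"
proof -
  have "AE x in M. Q ((f ^^ n) x)" for n
  proof -
    have "AE x in distr M M (f ^^ n). Q x"
      by (subst distr_funpow[OF measurable_f distr_f]) (rule assms)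
    from AE_distrD[OF measurable_fn this] show ?thesis .
  qed
  then show ?thesis by (simp add: AE_all_countable)
qed

lemma integral_comp_funpow:
  fixes g :: "'a \<Rightarrow> real"
  assumes "integrable M g"
  shows "integrable M (\<lambda>x. g ((f ^^ n) x))" "(\<integral>x. g ((f ^^ n) x) \<partial>M) = (\<integral>x. g x \<partial>M)"
proof -
  have d: "distr M M (f ^^ n) = M" by (rule distr_funpow[OF measurable_f distr_f])
  have "g \<in> borel_measurable M" using assms by simp
  then show "integrable M (\<lambda>x. g ((f ^^ n) x))" "(\<integral>x. g ((f ^^ n) x) \<partial>M) = (\<integral>x. g x \<partial>M)"
    using integrable_distr_eq[OF measurable_fn, of g n] integral_distr[OF measurable_fn, of g n] d assms
    by auto
qed

lemma integral_birkhoff_sum: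
  assumes "integrable M g"
  shows "integrable M (birkhoff_sum f g n)" "(\<integral>x. birkhoff_sum f g n x \<partial>M) = real n * (\<integral>x. g x \<partial>M)"
  unfolding birkhoff_sum_def using integral_comp_funpow[OF assms] by auto

text \<open>Ergodicity is stated for strictly invariant sets, hence the detour through the points
  that visit \<open>A\<close> infinitely often: the sets \<open>Z n\<close> decrease to this set and
  all have the measure of \<open>Z 0\<close>, which contains \<open>A\<close>.\<close>

lemma AE_hits:
  assumes A: "A \<in> sets M" "measure M A > 0"
  shows "AE x in M. \<exists>k. (f ^^ k) x \<in> A"
proof -
  define Z where "Z n = (\<Union>k. (f ^^ (n + k)) -` A)" for n
  have Zs: "Z n \<in> sets M" for n unfolding Z_def using vimage_funpow_sets[OF A(1)] by auto
  have Zn: "Z n = (f ^^ n) -` Z 0" for n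
    by (auto simp: Z_def funpow_add add.commute[of n])
  have mZ: "measure M (Z n) = measure M (Z 0)" for n
    unfolding Zn[of n] by (rule measure_vimage[OF Zs])
  have dec: "decseq Z"
  proof (rule decseq_SucI)
    show "Z (Suc n) \<subseteq> Z n" for n
    proof
      fix x assume "x \<in> Z (Suc n)"
      then obtain k where "(f ^^ (Suc n + k)) x \<in> A" by (auto simp: Z_def)
      then have "(f ^^ (n + Suc k)) x \<in> A" by simp
      then show "x \<in> Z n" unfolding Z_def by blast
    qed
  qed
  let ?Z = "\<Inter>n. Z n"
  have "(\<lambda>n. measure M (Z n)) \<longlonglongrightarrow> measure M ?Z"
    using Zs dec by (intro finite_Lim_measure_decseq) auto
  moreover have "(\<lambda>n. measure M (Z n)) = (\<lambda>_. measure M (Z 0))" by (rule ext) (rule mZ)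
  ultimately have mZ': "measure M ?Z = measure M (Z 0)" by (simp add: LIMSEQ_const_iff)
  have "A \<subseteq> Z 0" unfolding Z_def by (rule subsetI, rule UN_I[of 0]) auto
  then have "measure M A \<le> measure M (Z 0)" using Zs by (intro finite_measure_mono)
  then have pos: "measure M ?Z > 0" using A(2) mZ' by simp
  have fZ: "f -` Z n = Z (Suc n)" for n
    by (auto simp: Z_def funpow_swap1)
  have "f -` ?Z = (\<Inter>n. Z (Suc n))" by (simp add: vimage_INT fZ)
  also have "\<dots> = ?Z"
  proof
    show "?Z \<subseteq> (\<Inter>n. Z (Suc n))" by auto
    show "(\<Inter>n. Z (Suc n)) \<subseteq> ?Z" using dec by (force simp: decseq_Suc_iff)
  qed
  finally have "emeasure M ?Z = 0 \<or> emeasure M ?Z = 1" using Zs by (intro ergodic) auto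
  then have "measure M ?Z = 1" using pos by (auto simp: measure_def)
  then have "AE x in M. x \<in> ?Z" using Zs by (intro AE_prob_1) auto
  then show ?thesis by eventually_elim (auto simp: Z_def)
qed

text \<open>If the complement had positive measure, almost every orbit would enter it, whereas the
  orbit of almost every point of \<open>A\<close> stays in \<open>A\<close>.\<close>

lemma AE_forward_invariant:
  assumes A: "A \<in> sets M" "measure M A > 0" and inv: "AE x in M. x \<in> A \<longrightarrow> f x \<in> A"
  shows "AE x in M. x \<in> A"
proof (rule ccontr)
  assume "\<not> (AE x in M. x \<in> A)"
  then have "measure M A \<noteq> 1" using AE_prob_1[of A] A(1) by blast
  then have "measure M A < 1" using prob_le_1[of A] by (simp add: less_le)
  then have "measure M (UNIV - A) > 0"
    using A(1) prob_compl[of A] prob_le_1[of A] by (simp add: space_UNIV)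
  then have hit: "AE x in M. \<exists>k. (f ^^ k) x \<in> UNIV - A" using A(1) sets.compl_sets[of A M] by (intro AE_hits) (auto simp: space_UNIV)
  have "AE x in M. \<forall>n. (f ^^ n) x \<in> A \<longrightarrow> f ((f ^^ n) x) \<in> A" by (rule AE_comp_funpow[OF inv])
  with hit have "AE x in M. x \<notin> A"
  proof eventually_elim
    case (elim x)
    show ?case
    proof
      assume "x \<in> A"
      have "(f ^^ n) x \<in> A" for n by (induction n) (use elim \<open>x \<in> A\<close> in auto)
      then show False using elim by auto
    qed
  qed
  then have "measure M A = 0" using A(1) by (simp add: AE_iff_measurable[OF _ refl] measure_eq_0_null_sets AE_iff_null space_UNIV prob_eq_0)
  then show False using A(2) by simp
qed

end

section \<open>The induced map and the number of its steps\<close>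

locale induced_system = ergodic_system M f for M :: "'a measure" and f +
  fixes W :: "'a set" and t :: "'a \<Rightarrow> nat" and F :: "'a \<Rightarrow> 'a"
  assumes W [measurable]: "W \<in> sets M" and W_pos: "measure M W > 0"
    and measurable_t [measurable]: "t \<in> M \<rightarrow>\<^sub>M count_space UNIV"
    and F: "F x = (f ^^ t x) x"
    and F_W: "x \<in> W \<Longrightarrow> F x \<in> W"
    and t_pos: "x \<in> W \<Longrightarrow> t x > 0"
    and t_outside: "x \<notin> W \<Longrightarrow> t x = 0"
begin

abbreviation "T \<equiv> induced_time F t"

lemma measurable_F [measurable]: "F \<in> M \<rightarrow>\<^sub>M M"
proof -
  have "(\<lambda>x. (f ^^ t x) x) \<in> M \<rightarrow>\<^sub>M M"
    by (rule measurable_compose_countable[OF _ measurable_t]) simp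
  then show ?thesis by (simp add: F[abs_def])
qed

lemma measurable_T [measurable]: "T i \<in> M \<rightarrow>\<^sub>M count_space UNIV"
proof (induction i)
  case (Suc i)
  have "(\<lambda>x. t x + T i (F x)) \<in> M \<rightarrow>\<^sub>M count_space UNIV"
    by (rule measurable_compose_countable[OF _ measurable_t]) (use Suc in measurable)
  then show ?case by (simp add: induced_time_Suc[abs_def])
qed (simp add: induced_time_def[abs_def])

lemma Fn_W: "x \<in> W \<Longrightarrow> (F ^^ i) x \<in> W"
  by (induction i) (auto simp: F_W)

lemma T_Suc': "T (Suc i) x = T i x + t ((F ^^ i) x)"
  by (simp add: induced_time_def)

lemma T_strict_mono: "x \<in> W \<Longrightarrow> i < j \<Longrightarrow> T i x < T j x"
proof (induction j)
  case (Suc j)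
  have "t ((F ^^ j) x) > 0" by (intro t_pos Fn_W Suc.prems)
  then show ?case using Suc by (cases "i = j") (auto simp: T_Suc')
qed simp

lemma T_ge: "x \<in> W \<Longrightarrow> i \<le> T i x"
proof (induction i)
  case (Suc i)
  then show ?case using T_strict_mono[of x i "Suc i"] by simp
qed simp

lemma funpow_F: "(F ^^ i) x = (f ^^ T i x) x"
proof (induction i)
  case (Suc i)
  have "(F ^^ Suc i) x = F ((F ^^ i) x)" by simp
  also have "\<dots> = (f ^^ t ((F ^^ i) x)) ((F ^^ i) x)" by (rule F)
  also have "\<dots> = (f ^^ t ((F ^^ i) x)) ((f ^^ T i x) x)" by (subst (2) Suc) (rule refl)
  also have "\<dots> = (f ^^ (t ((F ^^ i) x) + T i x)) x" by (simp add: funpow_add)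
  finally show ?case by (simp add: T_Suc' add.commute)
qed simp

text \<open>On \<open>W\<close> one has \<open>i \<le> T i x\<close>, so the bound
  \<open>i < n\<close> loses nothing there; it keeps the set finite off \<open>W\<close>, where
  \<open>T\<close> vanishes.\<close>

definition num_blocks :: "nat \<Rightarrow> 'a \<Rightarrow> nat" where
  "num_blocks n x = card {i. i < n \<and> T i x < n}"

text \<open>On \<open>W\<close> the times \<open>T i x\<close> increase strictly with
  \<open>i\<close>, so the counted indices form an initial segment.\<close>

lemma less_num_blocks_iff:
  assumes "x \<in> W" shows "i < num_blocks n x \<longleftrightarrow> T i x < n"
proof -
  let ?X = "{i. i < n \<and> T i x < n}"
  have down: "j \<in> ?X" if "i \<in> ?X" "j \<le> i" for i j
    using that T_strict_mono[OF assms, of j i] by (cases "j = i") auto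
  have fin: "finite ?X" by simp
  have "?X = {..<card ?X}"
  proof (rule card_subset_eq[symmetric])
    show "{..<card ?X} \<subseteq> ?X"
    proof (rule ccontr)
      assume "\<not> {..<card ?X} \<subseteq> ?X"
      then obtain j where j: "j < card ?X" "j \<notin> ?X" by auto
      have "?X \<subseteq> {..<j}" using j(2) down by (metis (no_types, lifting) lessThan_iff not_less subsetI)
      then have "card ?X \<le> card {..<j}" by (intro card_mono) auto
      with j show False by simp
    qed
  qed auto
  then have "i < num_blocks n x \<longleftrightarrow> i \<in> ?X" unfolding num_blocks_def by blast
  also have "\<dots> \<longleftrightarrow> T i x < n" using T_ge[OF assms, of i] by auto
  finally show ?thesis .
qed

lemma num_blocks_le: "num_blocks n x \<le> n"
  unfolding num_blocks_def by (rule order_trans[OF card_mono[of "{..<n}"]]) auto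

lemma measurable_num_blocks [measurable]: "num_blocks n \<in> M \<rightarrow>\<^sub>M count_space UNIV"
proof -
  have "(\<lambda>x. card {i. i < n \<and> T i x < n}) \<in> M \<rightarrow>\<^sub>M count_space UNIV"
    by measurable
  then show ?thesis by (simp add: num_blocks_def[abs_def])
qed

definition block_freq :: "nat \<Rightarrow> real" where
  "block_freq n = (\<integral>x. indicator W x * real (num_blocks n x) \<partial>M) / real n"

lemma measure_decreasing_small:
  assumes "\<And>n. A n \<in> sets M" "\<And>n. A (Suc n) \<subseteq> A n" "AE x in M. \<exists>n. x \<notin> A n" "d > 0"
  shows "\<exists>n::nat. measure M (A n) < d"
proof -
  have "(\<lambda>n. measure M (A n)) \<longlonglongrightarrow> measure M (\<Inter>n. A n)"
    using assms(1,2) by (intro finite_Lim_measure_decseq decseq_SucI) auto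
  moreover have "measure M (\<Inter>n. A n) = 0"
  proof -
    have "AE x in M. x \<notin> (\<Inter>n. A n)" using assms(3) by eventually_elim auto
    then show ?thesis using assms(1) by (intro prob_eq_0[THEN iffD2]) auto
  qed
  ultimately have "\<forall>\<^sub>F n in sequentially. measure M (A n) < d" using assms(4) order_tendstoD(2) by fastforce
  then show ?thesis by (auto simp: eventually_sequentially)
qed

text \<open>The data for the parse. \<open>G\<close> consists of the points of \<open>W\<close> that
  start few induced steps before time \<open>n\<close> and finish them by time \<open>L\<close>;
  \<open>h\<close> is the waiting time for \<open>G\<close>, and \<open>B\<close> is where this wait
  exceeds \<open>m\<close>.\<close>

lemma good_set:
  fixes \<epsilon> \<eta> :: real
  assumes lim: "block_freq \<longlonglongrightarrow> 0" and \<epsilon>: "\<epsilon> > 0" and \<eta>: "\<eta> > 0"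
  obtains G B h and m L :: real where "B \<in> sets M" "measure M B \<le> \<eta>" "0 \<le> m" "0 \<le> L"
    "\<And>x. x \<in> G \<Longrightarrow> x \<in> W \<and> (\<exists>i. 0 < T i x \<and> m \<le> \<eta> * T i x \<and> T i x \<le> L \<and> i \<le> \<epsilon> * T i x)"
    "\<And>x. 0 \<le> h x" "\<And>x. h x \<le> m" "\<And>x. x \<notin> G \<Longrightarrow> x \<notin> B \<Longrightarrow> h (f x) + 1 \<le> h x"
    "\<And>x. x \<in> B \<Longrightarrow> h (f x) \<le> h x"
proof -
  have "\<exists>m::nat. measure M {x. \<forall>k\<le>m. (f ^^ k) x \<notin> W} < \<eta> / 2"
  proof (rule measure_decreasing_small)
    show "{x. \<forall>k\<le>m. (f ^^ k) x \<notin> W} \<in> sets M" for m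
    proof -
      have "{x\<in>space M. \<forall>k\<le>m. (f ^^ k) x \<notin> W} \<in> sets M" by measurable
      then show ?thesis by (simp add: space_UNIV)
    qed
    show "AE x in M. \<exists>n. x \<notin> {x. \<forall>k\<le>n. (f ^^ k) x \<notin> W}"
      using AE_hits[OF W W_pos] by eventually_elim auto
  qed (use \<eta> in auto)
  then obtain m :: nat where m: "measure M {x. \<forall>k\<le>m. (f ^^ k) x \<notin> W} < \<eta> / 2" by blast
  \<comment> \<open>\<open>W - G\<close> will have measure at most \<open>2 * d\<close>, and
    \<open>B\<close> involves \<open>m + 1\<close> of its preimages; this \<open>d\<close> bounds
    their total by \<open>\<eta> / 2\<close>. The other half is for orbits that miss
    \<open>W\<close> up to time \<open>m\<close>.\<close>
  define d where "d = \<eta> / (4 * (real m + 1))"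
  have d: "d > 0" using \<eta> by (simp add: d_def)
  have "\<forall>\<^sub>F n in sequentially. block_freq n < d * \<epsilon>"
    using lim d \<epsilon> by (intro order_tendstoD) auto
  moreover obtain n1 :: nat where n1: "real m / \<eta> < real n1" using reals_Archimedean2 by blast
  ultimately obtain n where n: "block_freq n < d * \<epsilon>" "n > 0" "n \<ge> n1"
    unfolding eventually_sequentially by (metis le_add1 le_add2 less_add_Suc2 less_imp_le_nat add.commute zero_less_Suc add_Suc_right)
  have mn: "real m \<le> \<eta> * real n"
  proof -
    have "real m / \<eta> \<le> real n" using n1 n(3) by linarith
    then show ?thesis using \<eta> by (simp add: field_simps)
  qed
  \<comment> \<open>Markov's inequality is applied to \<open>num_blocks n\<close>; the factor
    \<epsilon> in the bound \<open>d * \<epsilon>\<close> cancels against the threshold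
    \<open>\<epsilon> * n\<close>.\<close>
  let ?A = "{x\<in>space M. x \<in> W \<and> real (num_blocks n x) > \<epsilon> * real n}"
  have A: "?A \<in> sets M" by measurable
  let ?l = "\<lambda>x. indicator ?A x * (\<epsilon> * real n)" and ?r = "\<lambda>x. indicator W x * real (num_blocks n x)"
  have "measure M ?A * (\<epsilon> * real n) = (\<integral>x. ?l x \<partial>M)"
    using A by (simp add: emeasure_eq_measure)
  also have "\<dots> \<le> (\<integral>x. ?r x \<partial>M)"
  proof (rule integral_mono)
    show "integrable M ?l"
      using A by (intro integrable_mult_left integrable_real_indicator) (auto simp: emeasure_eq_measure)
    show "integrable M ?r"
      using num_blocks_le by (intro integrable_const_bound[of _ "real n"]) (auto simp: indicator_def)
  qed (auto simp: indicator_def)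
  also have "\<dots> = block_freq n * real n" using n by (simp add: block_freq_def)
  also have "\<dots> \<le> d * \<epsilon> * real n" using n by (intro mult_right_mono) auto
  finally have Ad: "measure M ?A \<le> d" using \<epsilon> n by (simp add: mult.assoc)
  have "\<exists>L::nat. measure M {x\<in>space M. x \<in> W \<and> T (num_blocks n x) x > L} < d"
  proof (rule measure_decreasing_small[OF _ _ _ d])
    show "{x\<in>space M. x \<in> W \<and> T (num_blocks n x) x > L} \<in> sets M" for L
      by measurable
  qed (auto intro!: AE_I2)
  then obtain L :: nat where L: "measure M {x\<in>space M. x \<in> W \<and> T (num_blocks n x) x > L} < d" by blast
  let ?C = "{x\<in>space M. x \<in> W \<and> T (num_blocks n x) x > L}"
  define G where "G = {x\<in>space M. x \<in> W \<and> real (num_blocks n x) \<le> \<epsilon> * real n \<and> T (num_blocks n x) x \<le> L}"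
  have Gs [measurable]: "G \<in> sets M" unfolding G_def by measurable
  have "measure M (W - G) \<le> measure M (?A \<union> ?C)"
    by (intro finite_measure_mono) (auto simp: G_def space_UNIV)
  also have "\<dots> \<le> measure M ?A + measure M ?C"
    by (intro measure_Un_le) auto
  also have "\<dots> \<le> 2 * d" using Ad L by simp
  finally have WG: "measure M (W - G) \<le> 2 * d" .
  define B where "B = {x\<in>space M. \<forall>j\<le>m. (f ^^ j) x \<notin> G}"
  have Bs: "B \<in> sets M" unfolding B_def by measurable
  let ?H = "{x. \<forall>k\<le>m. (f ^^ k) x \<notin> W}" and ?V = "\<Union>j\<in>{..m}. (f ^^ j) -` (W - G)"
  have "B \<subseteq> ?H \<union> ?V"
    by (auto simp: B_def)
  moreover have ms: "?H \<in> sets M"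
  proof -
    have "{x\<in>space M. \<forall>k\<le>m. (f ^^ k) x \<notin> W} \<in> sets M" by measurable
    then show ?thesis by (simp add: space_UNIV)
  qed
  moreover have msj: "(f ^^ j) -` (W - G) \<in> sets M" for j by (intro vimage_funpow_sets) measurable
  ultimately have "measure M B \<le> measure M (?H \<union> ?V)"
    by (intro finite_measure_mono) auto
  also have "\<dots> \<le> measure M ?H + measure M ?V"
    using ms msj by (intro measure_Un_le) auto
  also have "measure M ?V \<le> (\<Sum>j\<in>{..m}. measure M ((f ^^ j) -` (W - G)))"
    using msj by (intro finite_measure_subadditive_finite) auto
  also have "(\<Sum>j\<in>{..m}. measure M ((f ^^ j) -` (W - G))) = (real m + 1) * measure M (W - G)"
    by (simp add: measure_vimage)
  also have "\<dots> \<le> (real m + 1) * (2 * d)" using WG by (intro mult_left_mono) auto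
  also have "\<dots> = \<eta> / 2" by (simp add: d_def field_simps)
  finally have mB: "measure M B \<le> \<eta>" using m by simp
  \<comment> \<open>The default \<open>m\<close> is used exactly on \<open>B\<close>, where
    \<open>h\<close> is thus maximal and cannot increase under \<open>f\<close>.\<close>
  define h where "h x = (if \<exists>j\<le>m. (f ^^ j) x \<in> G then real (LEAST j. (f ^^ j) x \<in> G) else real m)" for x
  have h0: "0 \<le> h x" and hm: "h x \<le> real m" for x
    by (auto simp: h_def intro: order_trans[OF Least_le])
  show thesis
  proof (rule that[OF Bs mB])
    show "x \<in> W \<and> (\<exists>i. 0 < T i x \<and> real m \<le> \<eta> * T i x \<and> T i x \<le> real L \<and> i \<le> \<epsilon> * T i x)" if x: "x \<in> G" for x
    proof -
      have xW: "x \<in> W" using x by (simp add: G_def)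
      let ?i = "num_blocks n x"
      \<comment> \<open>\<open>num_blocks n x\<close> is the first index whose time reaches
        \<open>n\<close>; this makes the group of blocks long.\<close>
      have Tn: "T ?i x \<ge> n" using less_num_blocks_iff[OF xW, of ?i n] by simp
      have "\<eta> * real n \<le> \<eta> * T ?i x" "\<epsilon> * real n \<le> \<epsilon> * T ?i x"
        using Tn \<eta> \<epsilon> by auto
      moreover have "0 < T ?i x" using Tn n by linarith
      ultimately show ?thesis using x xW mn by (auto simp: G_def intro!: exI[of _ ?i])
    qed
    show "h (f x) + 1 \<le> h x" if x: "x \<notin> G" "x \<notin> B" for x
    proof -
      have ex: "\<exists>j\<le>m. (f ^^ j) x \<in> G" using x by (auto simp: B_def space_UNIV)
      define j where "j = (LEAST j. (f ^^ j) x \<in> G)"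
      have j: "(f ^^ j) x \<in> G" unfolding j_def using ex by (meson LeastI)
      have jm: "j \<le> m" unfolding j_def using ex by (meson Least_le order_trans)
      have hx: "h x = real j" using ex by (simp add: h_def j_def)
      obtain j' where j': "j = Suc j'" using j x(1) by (cases j) auto
      have fj: "(f ^^ j') (f x) \<in> G" using j by (simp add: j' funpow_swap1)
      have "(LEAST j. (f ^^ j) (f x) \<in> G) \<le> j'" by (rule Least_le) (rule fj)
      then have "h (f x) \<le> real j'" using fj jm j' by (auto simp: h_def intro!: exI[of _ j'])
      then show ?thesis by (simp add: hx j')
    qed
    show "h (f x) \<le> h x" if "x \<in> B" for x
      using that hm[of "f x"] by (auto simp: h_def B_def)
  qed (use h0 hm in auto)
qed

lemma integral_positive_part_small:
  fixes g :: "'a \<Rightarrow> real"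
  assumes "integrable M g" "d > 0"
  shows "\<exists>K. (\<integral>x. max 0 (g x - K) \<partial>M) < d"
proof -
  have "(\<lambda>n::nat. \<integral>x. max 0 (g x - real n) \<partial>M) \<longlonglongrightarrow> (\<integral>x. 0 \<partial>M)"
  proof (rule integral_dominated_convergence[where w = "\<lambda>x. \<bar>g x\<bar>"])
    show "AE x in M. (\<lambda>n. max 0 (g x - real n)) \<longlonglongrightarrow> 0"
    proof (intro AE_I2 tendsto_eventually)
      fix x obtain n0 :: nat where "g x < real n0" using reals_Archimedean2 by blast
      then show "\<forall>\<^sub>F n in sequentially. max 0 (g x - real n) = 0"
        by (intro eventually_sequentiallyI[of n0]) auto
    qed
  qed (use assms(1) in auto)
  then have "\<forall>\<^sub>F n in sequentially. (\<integral>x. max 0 (g x - real n) \<partial>M) < d"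
    using assms(2) by (intro order_tendstoD) auto
  then show ?thesis by (auto simp: eventually_sequentially)
qed

text \<open>Gibbs' inequality, with the total weight bounded above by
  \<open>exp (\<rho> * n)\<close> and the weight of each itinerary bounded below by the explicit
  parse. The losses grow by at most \<delta> per step.\<close>

lemma code_entropy_itin_le_weights:
  fixes S :: "'i set" and p :: "'a \<Rightarrow> 'b"
  assumes lim: "block_freq \<longlonglongrightarrow> 0"
    and P: "finite P" "range p \<subseteq> P" "simple_function M p"
    and nm: "\<And>a. a \<in> S \<Longrightarrow> length (nm a) > 0"
    and block: "\<And>x. x \<in> W \<Longrightarrow> \<exists>a\<in>S. nm a = itin f p (t x) x \<and> ennreal (exp (birkhoff_sum f \<phi> (t x) x)) \<le> s a"
    and fin: "(\<integral>\<^sup>+a. s a * ennreal (exp (- \<rho> * real (length (nm a)))) \<partial>count_space S) < \<infinity>"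
    and \<phi>: "integrable M \<psi>" "AE x in M. \<phi> x = \<psi> x" and \<delta>: "\<delta> > 0"
  shows "\<exists>C. \<forall>n. code_entropy M (itin f p n) \<le> (\<rho> - (\<integral>x. \<psi> x \<partial>M) + \<delta>) * real n + C"
proof -
  let ?J = "\<integral>x. \<psi> x \<partial>M"
  let ?I = "\<integral>\<^sup>+a. s a * ennreal (exp (- \<rho> * real (length (nm a)))) \<partial>count_space S"
  define U where "U = enn2real ?I"
  have U: "?I = ennreal U" "U \<ge> 0"
    using fin by (auto simp: U_def)
  \<comment> \<open>With these costs the blocks and the letters contribute at most 1/2 each to the
    condition on \<rho>.\<close>
  define A where "A = ln (2 * (U + 1))"
  define A' where "A' = ln (2 * (real (card P) + 1) * exp (- \<rho>))"
  have A0: "A \<ge> 0" using U by (simp add: A_def ln_ge_zero)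
  have eA: "exp (- A) * U \<le> 1 / 2" using U by (simp add: A_def exp_minus field_simps)
  have eA': "real (card P) * exp (- A') * exp (- \<rho>) \<le> 1 / 2"
    by (simp add: A'_def exp_minus field_simps exp_diff)
  have rho: "of_nat (card P) * ennreal (exp (- A')) * ennreal (exp (- \<rho>))
      + ennreal (exp (- A)) * ?I \<le> 1"
  proof -
    have "of_nat (card P) * ennreal (exp (- A')) * ennreal (exp (- \<rho>)) + ennreal (exp (- A)) * ennreal U
      = ennreal (real (card P) * exp (- A') * exp (- \<rho>) + exp (- A) * U)"
      using U by (simp add: ennreal_mult ennreal_plus ennreal_of_nat_eq_real_of_nat)
    also have "\<dots> \<le> ennreal 1" using eA eA' by (intro ennreal_leI) simp
    finally show ?thesis by (simp only: U(1) ennreal_1)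
  qed
  \<comment> \<open>A letter has a weight that ignores \<phi>, so a bound from above is needed where
    letters are read; the excess over \<open>K\<close> is given up and is small in mean.\<close>
  obtain K where K: "(\<integral>x. max 0 (\<psi> x - K) \<partial>M) < \<delta> / 4"
    using integral_positive_part_small[OF \<phi>(1), of "\<delta> / 4"] \<delta> by auto
  define c where "c = max 0 (A' + K)"
  \<comment> \<open>The budget is \<open>\<delta> / 4\<close> for the cost of blocks,
    \<open>\<delta> / 4\<close> for the truncation, and \<open>\<delta> / 8\<close> each for visits
    to \<open>B\<close> and for jumps of \<open>h\<close>.\<close>
  define \<epsilon> where "\<epsilon> = \<delta> / (4 * (A + 1))"
  define \<eta> where "\<eta> = \<delta> / (8 * (c + 1))"
  have c0: "c \<ge> 0" "A' + K \<le> c" by (auto simp: c_def)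
  have \<epsilon>: "\<epsilon> > 0" "A * \<epsilon> \<le> \<delta> / 4" using A0 \<delta> by (auto simp: \<epsilon>_def field_simps)
  have \<eta>: "\<eta> > 0" "c * \<eta> \<le> \<delta> / 8" using c0 \<delta> by (auto simp: \<eta>_def field_simps)
  obtain G B h and m L :: real where B: "B \<in> sets M" "measure M B \<le> \<eta>" and mL: "0 \<le> m" "0 \<le> L" and
    G: "\<And>x. x \<in> G \<Longrightarrow> x \<in> W \<and> (\<exists>i. 0 < T i x \<and> m \<le> \<eta> * T i x \<and> T i x \<le> L \<and> i \<le> \<epsilon> * T i x)" and
    h: "\<And>x. 0 \<le> h x" "\<And>x. h x \<le> m" "\<And>x. x \<notin> G \<Longrightarrow> x \<notin> B \<Longrightarrow> h (f x) + 1 \<le> h x"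
    "\<And>x. x \<in> B \<Longrightarrow> h (f x) \<le> h x"
    using good_set[OF lim \<epsilon>(1) \<eta>(1)] by metis
  have iB: "integrable M (indicator B :: 'a \<Rightarrow> real)"
    using B by (intro integrable_real_indicator) (auto simp: emeasure_eq_measure)
  have ie: "integrable M (\<lambda>x. max 0 (\<psi> x - K))"
    using \<phi>(1) by (intro integrable_max) auto
  have "code_entropy M (itin f p n) \<le> (\<rho> - ?J + \<delta>) * real n + c * (m + L)" for n
  proof -
    let ?w = "word_weight (ennreal (exp (- A'))) (ennreal (exp (- A))) S nm s n"
    let ?L = "{w. set w \<subseteq> P \<and> length w = n}"
    define bound where "bound x = birkhoff_sum f (\<lambda>x. \<phi> x - max 0 (\<phi> x - K)) n x - A * \<epsilon> * real n
      - c * (birkhoff_sum f (indicator B) n x + h x + \<eta> * real n + L)" for x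
    have lower: "ennreal (exp (bound x)) \<le> ?w (itin f p n x)" for x
      unfolding bound_def
      by (rule word_weight_itin_ge[where e = "\<lambda>x. max 0 (\<phi> x - K)" and T = K and F = F and t = t and W = W and G = G and m = m])
        (use F F_W t_pos block A0 c0 \<epsilon>(1) \<eta>(1) mL G h in auto)
    have upper: "(\<Sum>w\<in>?L. ?w w) \<le> ennreal (exp (\<rho> * real n))"
      by (rule sum_word_weight_le[OF P(1) nm rho])
    have sub: "itin f p n ` space M \<subseteq> ?L"
      using set_itin_subset[of f p n] P(2) by force
    have finL: "finite ?L" by (rule finite_lists_length_eq[OF P(1)])
    have wfin: "?w b < \<infinity>" if "set b \<subseteq> P" "length b = n" for b
    proof -
      have "?w b \<le> (\<Sum>w\<in>?L. ?w w)"
        using that finL by (intro member_le_sum) auto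
      also have "\<dots> \<le> ennreal (exp (\<rho> * real n))" by (rule upper)
      also have "\<dots> < \<infinity>" by simp
      finally show ?thesis .
    qed
    define V where "V b = enn2real (?w b)" for b
    have V: "exp (bound x) \<le> V (itin f p n x)" for x
    proof -
      have "?w (itin f p n x) < \<infinity>" using sub by (intro wfin) (auto simp: space_UNIV)
      then show ?thesis unfolding V_def using lower[of x] by (metis enn2real_ennreal enn2real_mono exp_ge_zero infinity_ennreal_def)
    qed
    let ?lV = "\<lambda>x. ln (V (itin f p n x))"
    note sf = simple_function_itin[OF measurable_f P(3), of n]
    have "(\<Sum>b\<in>itin f p n ` space M. V b) \<le> exp (\<rho> * real n)"
    proof -
      have "(\<Sum>b\<in>itin f p n ` space M. V b) \<le> (\<Sum>w\<in>?L. V w)"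
        by (intro sum_mono2 finL sub) (auto simp: V_def)
      also have "\<dots> \<le> exp (\<rho> * real n)"
      proof -
        have "ennreal (\<Sum>w\<in>?L. V w) = (\<Sum>w\<in>?L. ?w w)"
          by (subst sum_ennreal[symmetric]) (use wfin in \<open>auto simp: V_def intro!: sum.cong\<close>)
        then show ?thesis using upper by (metis ennreal_le_iff exp_ge_zero)
      qed
      finally show ?thesis .
    qed
    moreover have "V b > 0" if "measure M (itin f p n -` {b} \<inter> space M) > 0" for b
    proof -
      have "itin f p n -` {b} \<inter> space M \<noteq> {}" using that by auto
      then obtain x where "b = itin f p n x" by auto
      then show ?thesis using V[of x] by (metis exp_gt_zero order_less_le_trans)
    qed
    ultimately have "code_entropy M (itin f p n) \<le> ln (exp (\<rho> * real n)) - (\<integral>x. ?lV x \<partial>M)"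
      by (intro code_entropy_gibbs[OF prob_space_axioms sf]) (auto simp: V_def)
    moreover
    let ?b = "\<lambda>x. birkhoff_sum f (\<lambda>x. \<psi> x - max 0 (\<psi> x - K)) n x - A * \<epsilon> * real n
      - c * (birkhoff_sum f (indicator B) n x + m + \<eta> * real n + L)"
    have ipsi: "integrable M (\<lambda>x. \<psi> x - max 0 (\<psi> x - K))" using \<phi>(1) ie by (rule Bochner_Integration.integrable_diff)
    have "(\<integral>x. ?b x \<partial>M) \<le> (\<integral>x. ?lV x \<partial>M)"
    proof (rule integral_mono_AE)
      show "integrable M ?b"
        using integral_birkhoff_sum(1)[OF ipsi] integral_birkhoff_sum(1)[OF iB] by auto
      show "integrable M (\<lambda>x. ?lV x)"
        by (rule integral_simple_comp(2)[OF finite_measure_axioms sf])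
      \<comment> \<open>The parse bound holds pointwise for \<phi>; the version \<psi> agrees with
        it along almost every orbit.\<close>
      show "AE x in M. ?b x \<le> ?lV x"
        using AE_comp_funpow[OF \<phi>(2)]
      proof eventually_elim
        case (elim x)
        have "birkhoff_sum f (\<lambda>x. \<psi> x - max 0 (\<psi> x - K)) n x = birkhoff_sum f (\<lambda>x. \<phi> x - max 0 (\<phi> x - K)) n x"
          using elim by (simp add: birkhoff_sum_def)
        moreover have "c * h x \<le> c * m" using h c0 by (intro mult_left_mono) auto
        ultimately have "?b x \<le> bound x" unfolding bound_def by (simp add: algebra_simps)
        also have "\<dots> = ln (exp (bound x))" by simp
        also have "\<dots> \<le> ?lV x" using V[of x] by (intro ln_mono) auto
        finally show ?case .
      qed
    qed
    moreover have "(\<integral>x. ?b x \<partial>M) = real n * (?J - (\<integral>x. max 0 (\<psi> x - K) \<partial>M)) - A * \<epsilon> * real n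
       - c * (real n * measure M B + m + \<eta> * real n + L)"
      using integral_birkhoff_sum[OF ipsi] integral_birkhoff_sum[OF iB] \<phi>(1) ie
      by (simp add: prob_space[unfolded space_UNIV] space_UNIV)
    moreover have "real n * (\<integral>x. max 0 (\<psi> x - K) \<partial>M) \<le> real n * (\<delta> / 4)" using K by (intro mult_left_mono) auto
    moreover have "A * \<epsilon> * real n \<le> \<delta> / 4 * real n" using \<epsilon> by (intro mult_right_mono) auto
    moreover have "c * (real n * measure M B) \<le> \<delta> / 8 * real n"
    proof -
      have "c * measure M B \<le> c * \<eta>" using B c0 by (intro mult_left_mono) auto
      then have "c * measure M B * real n \<le> \<delta> / 8 * real n" using \<eta> by (intro mult_right_mono) auto
      then show ?thesis by (simp add: mult_ac)
    qed
    moreover have "c * (\<eta> * real n) \<le> \<delta> / 8 * real n"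
      using mult_right_mono[OF \<eta>(2), of "real n"] by (simp add: mult_ac)
    moreover have "0 \<le> \<delta> * real n" using \<delta> by simp
    ultimately show ?thesis by (simp add: algebra_simps)
  qed
  then show ?thesis by blast
qed

end

section \<open>Lifts of invariant measures of the induced map\<close>

text \<open>Tychonoff's theorem for a power of the unit interval. A filter takes the place of a
  subsequence because limits for possibly uncountably many indices are wanted at once.\<close>

lemma cluster_filter:
  fixes u :: "nat \<Rightarrow> 'b \<Rightarrow> real" and G :: "nat filter"
  assumes G: "G \<noteq> bot" and u: "\<And>n A. u n A \<in> {0..1}"
  obtains H g where "H \<noteq> bot" "H \<le> G" "\<And>A. ((\<lambda>n. u n A) \<longlongrightarrow> g A) H"
proof -
  have "compactin (product_topology (\<lambda>_::'b. euclideanreal) UNIV) (PiE UNIV (\<lambda>_. {0..1}))"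
    by (simp add: compactin_PiE)
  then have "compact (PiE UNIV (\<lambda>_::'b. {0..1::real}))"
    by (simp add: euclidean_product_topology flip: compactin_euclidean_iff)
  moreover have "filtermap u G \<noteq> bot" using G by (simp add: filtermap_bot_iff)
  moreover have "\<forall>\<^sub>F x in filtermap u G. x \<in> PiE UNIV (\<lambda>_. {0..1})"
    unfolding eventually_filtermap using u by (intro always_eventually) auto
  ultimately obtain g where g: "inf (nhds g) (filtermap u G) \<noteq> bot"
    unfolding compact_filter by meson
  \<comment> \<open>The indices in \<open>G\<close> whose \<open>u n\<close> is close to
    \<open>g\<close>; this filter is proper because \<open>g\<close> is a cluster point of
    \<open>u\<close> along \<open>G\<close>.\<close>
  define H where "H = inf (filtercomap u (nhds g)) G"
  have "H \<noteq> bot"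
  proof
    assume "H = bot"
    then have "eventually (\<lambda>_. False) H" by simp
    then obtain P Q where PQ: "eventually P (filtercomap u (nhds g))" "eventually Q G" "\<And>n. P n \<Longrightarrow> Q n \<Longrightarrow> False"
      unfolding H_def eventually_inf by blast
    then obtain P' where P': "eventually P' (nhds g)" "\<And>n. P' (u n) \<Longrightarrow> P n"
      unfolding eventually_filtercomap by blast
    have "eventually (\<lambda>y. \<not> P' y) (filtermap u G)"
      unfolding eventually_filtermap using PQ(2) by eventually_elim (use PQ(3) P'(2) in blast)
    then have "eventually (\<lambda>_. False) (inf (nhds g) (filtermap u G))"
      unfolding eventually_inf using P'(1) by blast
    then show False using g by (simp add: eventually_False)
  qed
  moreover have "H \<le> G" by (simp add: H_def)
  moreover have "((\<lambda>n. u n A) \<longlongrightarrow> g A) H" for A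
  proof -
    have "(u \<longlongrightarrow> g) H"
      using filterlim_filtercomap[of u "nhds g"] by (rule filterlim_mono) (auto simp: H_def)
    from continuous_on_tendsto_compose[OF continuous_on_product_coordinates[of A] this]
    show ?thesis by simp
  qed
  ultimately show thesis by (rule that)
qed

section \<open>Invariant measures dominated by an ergodic measure\<close>

context ergodic_system
begin

text \<open>Let \<open>D\<close> be the density and \<open>c\<close> its mean. By invariance each of
  the two measures gives the points leaving \<open>Y = {D > c}\<close> the same mass as the points
  entering it. Now \<open>D - c\<close> is positive on the former and nonpositive on the latter, so
  almost no point leaves \<open>Y\<close>. Hence \<open>Y\<close> has full or zero measure, and the
  mean excludes the former. So \<open>D \<le> c\<close>, and then \<open>D = c\<close>, almost
  everywhere.\<close>

lemma dominated_invariant_measure: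
  assumes \<theta>: "sets \<theta> = sets M" "\<And>A. A \<in> sets M \<Longrightarrow> emeasure \<theta> A \<le> emeasure M A"
    and inv: "\<And>A. A \<in> sets M \<Longrightarrow> emeasure \<theta> (f -` A) = emeasure \<theta> A"
    and A: "A \<in> sets M"
  shows "emeasure \<theta> A = emeasure \<theta> UNIV * emeasure M A"
proof -
  have sp\<theta>: "space \<theta> = UNIV" using sets_eq_imp_space_eq[OF \<theta>(1)] space_UNIV by simp
  have U: "UNIV \<in> sets M" using sets.top[of M] space_UNIV by simp
  have "emeasure \<theta> UNIV < \<infinity>"
    using \<theta>(2)[OF U] emeasure_space_1 by (simp add: space_UNIV) (metis ennreal_one_less_top order_le_less_trans)
  then interpret L: finite_measure \<theta> by (intro finite_measureI) (simp add: sp\<theta>)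
  have ac: "absolutely_continuous M \<theta>"
    unfolding absolutely_continuous_def using \<theta> by (auto simp: null_sets_def) (metis le_zero_eq)
  obtain D where D: "D \<in> borel_measurable M" "AE x in M. RN_deriv M \<theta> x = ennreal (D x)" "\<And>x. 0 \<le> D x"
    using real_RN_deriv[OF L.finite_measure_axioms ac \<theta>(1)] by metis
  have dens: "density M (\<lambda>x. ennreal (D x)) = \<theta>"
  proof -
    have "density M (\<lambda>x. ennreal (D x)) = density M (RN_deriv M \<theta>)"
      using D by (intro density_cong) auto
    then show ?thesis using density_RN_deriv[OF ac \<theta>(1)] by simp
  qed
  have iD: "integrable M D"
  proof (rule integrableI_nonneg)
    have "(\<integral>\<^sup>+x. ennreal (D x) \<partial>M) = emeasure (density M (\<lambda>x. ennreal (D x))) (space M)"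
      using D(1) by (subst emeasure_density) (auto intro!: nn_integral_cong)
    also have "\<dots> < \<infinity>" unfolding dens using L.emeasure_finite by (simp add: less_top[symmetric])
    finally show "(\<integral>\<^sup>+x. ennreal (D x) \<partial>M) < \<infinity>" .
  qed (use D in auto)
  have mD: "measure \<theta> B = (\<integral>x. indicator B x * D x \<partial>M)" if "B \<in> sets M" for B
  proof -
    have "emeasure \<theta> B = (\<integral>\<^sup>+x. ennreal (indicator B x * D x) \<partial>M)"
      unfolding dens[symmetric] using that D(1)
      by (subst emeasure_density) (auto intro!: nn_integral_cong simp: indicator_def)
    also have "\<dots> = ennreal (\<integral>x. indicator B x * D x \<partial>M)"
      using integrable_mult_indicator[OF that iD] D(3) by (intro nn_integral_eq_integral) auto
    finally show ?thesis using D(3) by (simp add: measure_def Bochner_Integration.integral_nonneg)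
  qed
  define c where "c = measure \<theta> UNIV"
  have cD: "c = (\<integral>x. D x \<partial>M)" unfolding c_def mD[OF U] by simp
  define Y where "Y = {x \<in> space M. D x > c}"
  have Y: "Y \<in> sets M" unfolding Y_def using D(1) by measurable
  have fY: "f -` Y \<in> sets M" using vimage_funpow_sets[OF Y, of 1] by simp
  define D1 where "D1 = Y - f -` Y"
  define D2 where "D2 = f -` Y - Y"
  have D12: "D1 \<in> sets M" "D2 \<in> sets M" using Y fY by (auto simp: D1_def D2_def)
  have eq: "measure m D1 = measure m D2" if "finite_measure m" "sets m = sets M" "measure m (f -` Y) = measure m Y" for m
  proof -
    interpret m: finite_measure m by fact
    show ?thesis unfolding D1_def D2_def using that Y fY
      by (simp add: m.finite_measure_Diff' Int_commute)
  qed
  have e1: "measure M D1 = measure M D2"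
    using measure_vimage[OF Y, of 1] by (intro eq finite_measure_axioms) auto
  have e2: "measure \<theta> D1 = measure \<theta> D2"
    using inv[OF Y] \<theta>(1) by (intro eq L.finite_measure_axioms) (auto simp: measure_def)
  let ?h = "\<lambda>B x. indicator B x * (D x - c)"
  have iI: "integrable M (\<lambda>x. indicator B x * D x)" "integrable M (\<lambda>x. indicator B x * c)" if "B \<in> sets M" for B
    using integrable_mult_indicator[OF that iD] that by (auto simp: emeasure_eq_measure)
  have "(\<integral>x. ?h D1 x \<partial>M) = measure \<theta> D1 - c * measure M D1"
    using iI[OF D12(1)] D12 mD[OF D12(1)] by (simp add: right_diff_distrib)
  also have "\<dots> = measure \<theta> D2 - c * measure M D2" using e1 e2 by simp
  also have "\<dots> = (\<integral>x. ?h D2 x \<partial>M)"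
    using iI[OF D12(2)] D12 mD[OF D12(2)] by (simp add: right_diff_distrib)
  also have "\<dots> \<le> (\<integral>x. 0 \<partial>M)"
    using iI[OF D12(2)] by (intro integral_mono) (auto simp: right_diff_distrib D2_def Y_def indicator_def space_UNIV)
  finally have le: "(\<integral>x. ?h D1 x \<partial>M) \<le> 0" by simp
  have iD1: "integrable M (\<lambda>x. ?h D1 x)" using iI[OF D12(1)] by (simp add: right_diff_distrib)
  have nn1: "?h D1 x \<ge> 0" for x by (auto simp: D1_def Y_def indicator_def)
  have "AE x in M. indicator D1 x * (D x - c) = 0"
    using le iD1 nn1 by (subst integral_nonneg_eq_0_iff_AE[symmetric]) (auto intro!: antisym Bochner_Integration.integral_nonneg)
  then have stay: "AE x in M. x \<in> Y \<longrightarrow> f x \<in> Y"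
    by eventually_elim (auto simp: D1_def Y_def indicator_def split: if_splits)
  have notY: "\<not> (AE x in M. x \<in> Y)"
  proof
    assume Yae: "AE x in M. x \<in> Y"
    have i: "integrable M (\<lambda>x. D x - c)" using iD by auto
    have "(\<integral>x. D x - c \<partial>M) = 0" using iD cD by (simp add: prob_space)
    moreover have "AE x in M. 0 \<le> D x - c" using Yae by eventually_elim (simp add: Y_def)
    ultimately have "AE x in M. D x - c = 0" using integral_nonneg_eq_0_iff_AE[OF i] by simp
    with Yae have "AE x in M. False" by eventually_elim (simp add: Y_def)
    then show False by (simp add: AE_False)
  qed
  have Y0: "AE x in M. x \<notin> Y"
  proof -
    have "\<not> measure M Y > 0" using AE_forward_invariant[OF Y _ stay] notY by blast
    then show ?thesis using prob_eq_0[OF Y] by (simp add: zero_less_measure_iff)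
  qed
  have i: "integrable M (\<lambda>x. c - D x)" using iD by auto
  have "(\<integral>x. c - D x \<partial>M) = 0" using iD cD by (simp add: prob_space)
  moreover have "AE x in M. 0 \<le> c - D x" using Y0 by eventually_elim (simp add: Y_def space_UNIV)
  ultimately have "AE x in M. c - D x = 0" using integral_nonneg_eq_0_iff_AE[OF i] by simp
  then have "(\<integral>x. indicator A x * D x \<partial>M) = (\<integral>x. indicator A x * c \<partial>M)"
    using D(1) A by (intro integral_cong_AE) (auto elim: eventually_mono)
  then have "measure \<theta> A = c * measure M A" using mD[OF A] A by (simp add: mult.commute)
  then show ?thesis by (simp add: L.emeasure_eq_measure emeasure_eq_measure c_def ennreal_mult)
qed

end

section \<open>Occupation measures of the induced steps\<close>

context induced_system
begin

definition block_count :: "nat \<Rightarrow> 'a set \<Rightarrow> 'a \<Rightarrow> real" where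
  "block_count n A x = indicator W x * (\<Sum>i<num_blocks n x. indicator A ((F ^^ i) x))"

definition block_avg :: "nat \<Rightarrow> 'a set \<Rightarrow> real" where
  "block_avg n A = (\<integral>x. block_count n A x \<partial>M) / real n"

lemma block_count_bounds:
  "block_count n A x \<in> {0..real n}"
proof -
  have "(\<Sum>i<num_blocks n x. indicator A ((F ^^ i) x)) \<le> (\<Sum>i<num_blocks n x. 1 :: real)"
    by (intro sum_mono) (auto simp: indicator_def)
  also have "\<dots> \<le> real n" using num_blocks_le by simp
  finally show ?thesis by (auto simp: block_count_def indicator_def intro!: sum_nonneg)
qed

lemma block_avg_bounds: "block_avg n A \<in> {0..1}"
proof -
  have "0 \<le> (\<integral>x. block_count n A x \<partial>M)" using block_count_bounds by (intro Bochner_Integration.integral_nonneg) auto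
  moreover have "(\<integral>x. block_count n A x \<partial>M) \<le> real n"
  proof (cases "integrable M (block_count n A)")
    case True
    then have "(\<integral>x. block_count n A x \<partial>M) \<le> (\<integral>x. real n \<partial>M)" using block_count_bounds by (intro integral_mono) auto
    then show ?thesis by (simp add: prob_space)
  qed (simp add: not_integrable_integral_eq)
  ultimately show ?thesis unfolding block_avg_def by (auto simp: divide_le_eq)
qed

lemma measurable_Fn [measurable]: "(F ^^ i) \<in> M \<rightarrow>\<^sub>M M"
  by (rule measurable_funpow[OF measurable_F])

lemma integrable_block_count:
  assumes [measurable]: "A \<in> sets M"
  shows "integrable M (block_count n A)"
proof (rule integrable_const_bound[of _ "real n"])
  show "AE x in M. norm (block_count n A x) \<le> real n"
    using block_count_bounds by (intro AE_I2) auto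
  have eq: "(\<Sum>i<num_blocks n x. indicator A ((F ^^ i) x)) =
      (\<Sum>i<n. if i < num_blocks n x then indicator A ((F ^^ i) x) else 0 :: real)" for x
    using num_blocks_le[of n x] by (subst sum.If_cases) (auto intro!: sum.cong)
  show "(block_count n A) \<in> borel_measurable M"
    unfolding block_count_def[abs_def] eq by measurable
qed

lemma block_avg_Un:
  assumes "A \<in> sets M" "B \<in> sets M" "A \<inter> B = {}"
  shows "block_avg n (A \<union> B) = block_avg n A + block_avg n B"
proof -
  have "indicator (A \<union> B) y = (indicator A y + indicator B y :: real)" for y
    using assms(3) by (auto simp: indicator_def)
  then have "block_count n (A \<union> B) = (\<lambda>x. block_count n A x + block_count n B x)"
    by (simp add: block_count_def[abs_def] sum.distrib distrib_left)
  then show ?thesis unfolding block_avg_def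
    using integrable_block_count[OF assms(1)] integrable_block_count[OF assms(2)]
    by (simp add: add_divide_distrib)
qed

text \<open>Along an \<open>F\<close>-orbit the difference telescopes, leaving only the first and
  the last term.\<close>

lemma block_avg_vimage:
  assumes A: "A \<in> sets M"
  shows "\<bar>block_avg n (F -` A) - block_avg n A\<bar> \<le> 1 / real n"
proof -
  have FA: "F -` A \<in> sets M" using measurable_sets[OF measurable_F A] by (simp add: space_UNIV)
  have "\<bar>block_count n (F -` A) x - block_count n A x\<bar> \<le> 1" for x
  proof -
    have "(\<Sum>i<N. indicator (F -` A) ((F ^^ i) x)) - (\<Sum>i<N. indicator A ((F ^^ i) x))
      = (indicator A ((F ^^ N) x) - indicator A x :: real)" for N
      by (induction N) (auto simp: indicator_def)
    then have "block_count n (F -` A) x - block_count n A x = indicator W x * (indicator A ((F ^^ num_blocks n x) x) - indicator A x)"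
      by (simp add: block_count_def right_diff_distrib[symmetric])
    then show ?thesis by (auto simp: indicator_def)
  qed
  then have "\<bar>\<integral>x. block_count n (F -` A) x - block_count n A x \<partial>M\<bar> \<le> (\<integral>x. 1 \<partial>M)"
    using integrable_block_count[OF A] integrable_block_count[OF FA]
    by (intro order_trans[OF integral_abs_bound] integral_mono) auto
  then have "\<bar>(\<integral>x. block_count n (F -` A) x \<partial>M) - (\<integral>x. block_count n A x \<partial>M)\<bar> \<le> 1"
    using integrable_block_count[OF A] integrable_block_count[OF FA] by (simp add: prob_space)
  then have "\<bar>(\<integral>x. block_count n (F -` A) x \<partial>M) - (\<integral>x. block_count n A x \<partial>M)\<bar> / real n \<le> 1 / real n"
    by (intro divide_right_mono) auto
  then show ?thesis by (simp add: block_avg_def diff_divide_distrib[symmetric] abs_divide)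
qed

text \<open>The times \<open>T i x + k\<close>, \<open>k < t (F\<^sup>i x)\<close>, of the tower over the orbit of \<open>x\<close> are distinct,
  so that time averages along the tower are dominated by time averages along the orbit under \<open>f\<close>.\<close>

lemma tower_sum_le:
  assumes x: "x \<in> W"
  shows "(\<Sum>k<K. \<Sum>i<num_blocks n x. indicator ((f ^^ k) -` E \<inter> {y. k < t y}) ((F ^^ i) x))
    \<le> (\<Sum>j<n + K. indicator E ((f ^^ j) x) :: real)"
proof -
  let ?I = "{(k, i). k < K \<and> i < num_blocks n x \<and> k < t ((F ^^ i) x)}"
  let ?j = "\<lambda>(k, i). T i x + k"
  have finI: "finite ?I" by (rule finite_subset[of _ "{..<K} \<times> {..<num_blocks n x}"]) auto
  have "(\<Sum>k<K. \<Sum>i<num_blocks n x. indicator ((f ^^ k) -` E \<inter> {y. k < t y}) ((F ^^ i) x))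
     = (\<Sum>(k, i)\<in>{..<K} \<times> {..<num_blocks n x}. indicator ((f ^^ k) -` E \<inter> {y. k < t y}) ((F ^^ i) x) :: real)"
    by (simp add: sum.cartesian_product)
  also have "\<dots> = (\<Sum>(k, i)\<in>?I. indicator ((f ^^ k) -` E \<inter> {y. k < t y}) ((F ^^ i) x))"
    by (intro sum.mono_neutral_right) (auto simp: indicator_def)
  also have "\<dots> = (\<Sum>z\<in>?I. indicator E ((f ^^ ?j z) x))"
    by (intro sum.cong) (auto simp: indicator_def funpow_F funpow_add add.commute[of "T _ _"])
  also have "\<dots> = (\<Sum>j\<in>?j ` ?I. indicator E ((f ^^ j) x))"
  proof (rule sum.reindex[symmetric, unfolded comp_def])
    have less: "T i x + k < T i' x + k'" if "k < t ((F ^^ i) x)" "i < i'" for i i' k k'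
    proof -
      have "T i x + k < T (Suc i) x" using that by (simp add: T_Suc')
      also have "\<dots> \<le> T i' x" using T_strict_mono[OF x, of "Suc i" i'] that by (cases "Suc i = i'") auto
      finally show ?thesis by simp
    qed
    show "inj_on ?j ?I"
    proof (rule inj_onI, clarify)
      fix k i k' i' assume h: "T i x + k = T i' x + k'" "k < t ((F ^^ i) x)" "k' < t ((F ^^ i') x)"
      have "i = i'" using less[of k i i' k'] less[of k' i' i k] h by (metis linorder_neqE_nat less_irrefl)
      then show "k = k' \<and> i = i'" using h by simp
    qed
  qed
  also have "\<dots> \<le> (\<Sum>j<n + K. indicator E ((f ^^ j) x))"
    by (intro sum_mono2) (auto simp: less_num_blocks_iff[OF x])
  finally show ?thesis .
qed

lemma tower_sets:
  assumes "E \<in> sets M" shows "(f ^^ k) -` E \<inter> {y. k < t y} \<in> sets M"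
proof -
  have "{y \<in> space M. k < t y} \<in> sets M" by measurable
  then show ?thesis using vimage_funpow_sets[OF assms] by (auto simp: space_UNIV)
qed

text \<open>Steps that start before time \<open>n\<close> stay below time \<open>n + K\<close> on
  the first \<open>K\<close> levels; invariance turns the count along the orbit into
  \<open>(n + K) * measure M E\<close>, and the excess is negligible for large
  \<open>n\<close>.\<close>

lemma block_avg_tower_le:
  assumes E: "E \<in> sets M" and n: "n > 0"
  shows "(\<Sum>k<K. block_avg n ((f ^^ k) -` E \<inter> {y. k < t y})) \<le> (1 + real K / real n) * measure M E"
proof -
  let ?A = "\<lambda>k. (f ^^ k) -` E \<inter> {y. k < t y}"
  have iE: "integrable M (indicator E :: 'a \<Rightarrow> real)" using E by (simp add: emeasure_eq_measure)
  have "(\<Sum>k<K. block_avg n (?A k)) = (\<integral>x. (\<Sum>k<K. block_count n (?A k) x) \<partial>M) / real n"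
    unfolding block_avg_def sum_divide_distrib[symmetric]
    using integrable_block_count[OF tower_sets[OF E]] by (subst Bochner_Integration.integral_sum) auto
  also have "(\<integral>x. (\<Sum>k<K. block_count n (?A k) x) \<partial>M) \<le> (\<integral>x. birkhoff_sum f (indicator E) (n + K) x \<partial>M)"
  proof (rule integral_mono)
    show "integrable M (\<lambda>x. \<Sum>k<K. block_count n (?A k) x)"
      using integrable_block_count[OF tower_sets[OF E]] by (intro Bochner_Integration.integrable_sum)
    show "integrable M (birkhoff_sum f (indicator E) (n + K))" by (rule integral_birkhoff_sum[OF iE])
    show "(\<Sum>k<K. block_count n (?A k) x) \<le> birkhoff_sum f (indicator E) (n + K) x" for x
      using tower_sum_le[where x=x and K=K and n=n and E=E] birkhoff_sum_nonneg[of "indicator E" f "n + K" x]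
      by (cases "x \<in> W") (auto simp: block_count_def birkhoff_sum_def)
  qed
  also have "(\<integral>x. birkhoff_sum f (indicator E) (n + K) x \<partial>M) = real (n + K) * measure M E"
    using integral_birkhoff_sum[OF iE] E by simp
  finally show ?thesis using n by (simp add: divide_right_mono field_simps)
qed

definition base_measure :: "'a measure \<Rightarrow> bool" where
  "base_measure N \<longleftrightarrow> sets N = sets M \<and> finite_measure N \<and>
     (\<forall>A\<in>sets M. emeasure N (F -` A) = emeasure N A) \<and> emeasure N (UNIV - W) = 0"

text \<open>The lift before normalisation, summed over the heights \<open>k\<close> of the tower
  instead of over the elements of the scheme.\<close>

definition lift :: "'a measure \<Rightarrow> 'a set \<Rightarrow> ennreal" where
  "lift N E = (\<Sum>k. emeasure N ((f ^^ k) -` E \<inter> {x. k < t x}))"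

text \<open>A setwise cluster point \<nu> of the averages, taken along those \<open>n\<close> whose
  frequency is at least \<open>d\<close>, so that its mass stays positive. The tower inequality
  passes to the limit for each finite number \<open>K\<close> of levels.\<close>

lemma exists_dominated_base_measure:
  assumes "\<not> block_freq \<longlonglongrightarrow> 0"
  shows "\<exists>N. base_measure N \<and> emeasure N UNIV > 0 \<and> (\<forall>E\<in>sets M. lift N E \<le> emeasure M E)"
proof -
  let ?A = "\<lambda>E k. (f ^^ k) -` E \<inter> {y. k < t y}"
  have freq: "block_freq n = block_avg n UNIV" for n
    by (simp add: block_freq_def block_avg_def block_count_def)
  have U: "UNIV \<in> sets M" using sets.top[of M] space_UNIV by simp
  obtain d where d: "d > 0" "\<not> (\<forall>\<^sub>F n in sequentially. block_freq n < d)"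
  proof -
    have "\<not> (\<forall>e>0. \<forall>\<^sub>F n in sequentially. dist (block_freq n) 0 < e)"
      using assms unfolding tendsto_iff .
    moreover have "dist (block_freq n) 0 = block_freq n" for n
      using block_avg_bounds[of n UNIV] by (simp add: freq)
    ultimately show ?thesis using that by auto
  qed
  define G where "G = inf sequentially (principal {n. d \<le> block_freq n})"
  have "G \<noteq> bot"
  proof
    assume "G = bot"
    then have "eventually (\<lambda>_. False) G" by simp
    then have "\<forall>\<^sub>F n in sequentially. block_freq n < d"
      by (simp add: G_def eventually_inf_principal not_le)
    with d show False by simp
  qed
  then obtain H \<nu> where H: "H \<noteq> bot" "H \<le> G" and lim: "\<And>A. ((\<lambda>n. block_avg n A) \<longlongrightarrow> \<nu> A) H"
    using cluster_filter[of G block_avg] block_avg_bounds by metis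
  have Hs: "H \<le> sequentially" using H(2) by (simp add: G_def)
  have seq: "(X \<longlongrightarrow> l) H" if "X \<longlonglongrightarrow> l" for X and l :: real
    using that Hs by (rule filterlim_mono[OF _ order_refl])
  have nn: "0 \<le> \<nu> A" for A
    by (rule tendsto_lowerbound[OF lim _ H(1)]) (use block_avg_bounds in auto)
  have pos: "d \<le> \<nu> UNIV"
  proof (rule tendsto_lowerbound[OF lim _ H(1)])
    have "eventually (\<lambda>n. d \<le> block_freq n) G" by (simp add: G_def eventually_inf_principal)
    then show "\<forall>\<^sub>F n in H. d \<le> block_avg n UNIV" using H(2) by (simp add: freq filter_leD)
  qed
  have add: "\<nu> (A \<union> B) = \<nu> A + \<nu> B" if "A \<in> sets M" "B \<in> sets M" "A \<inter> B = {}" for A B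
  proof (rule tendsto_unique[OF H(1) lim])
    show "((\<lambda>n. block_avg n (A \<union> B)) \<longlongrightarrow> \<nu> A + \<nu> B) H"
      unfolding block_avg_Un[OF that] by (intro tendsto_add lim)
  qed
  have FA: "F -` A \<in> sets M" if "A \<in> sets M" for A
    using measurable_sets[OF measurable_F that] by (simp add: space_UNIV)
  have inv: "\<nu> (F -` A) = \<nu> A" if A: "A \<in> sets M" for A
  proof -
    have "(\<lambda>n. block_avg n (F -` A) - block_avg n A) \<longlonglongrightarrow> 0"
      by (rule Lim_null_comparison[OF _ lim_1_over_n]) (use block_avg_vimage[OF A] in auto)
    then have "((\<lambda>n. block_avg n (F -` A) - block_avg n A) \<longlongrightarrow> 0) H" by (rule seq)
    moreover have "((\<lambda>n. block_avg n (F -` A) - block_avg n A) \<longlongrightarrow> \<nu> (F -` A) - \<nu> A) H"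
      by (intro tendsto_diff lim)
    ultimately show ?thesis using tendsto_unique[OF H(1)] by force
  qed
  have outside: "\<nu> (UNIV - W) = 0"
  proof (rule tendsto_unique[OF H(1) lim])
    have "block_avg n (UNIV - W) = 0" for n
    proof -
      have "block_count n (UNIV - W) = (\<lambda>x. 0)"
        using Fn_W by (auto simp: block_count_def indicator_def fun_eq_iff)
      then show ?thesis unfolding block_avg_def by simp
    qed
    then show "((\<lambda>n. block_avg n (UNIV - W)) \<longlongrightarrow> 0) H" by simp
  qed
  have tower: "(\<Sum>k<K. \<nu> (?A E k)) \<le> measure M E" if E: "E \<in> sets M" for E K
  proof (rule tendsto_le[OF H(1)])
    let ?s = "\<lambda>n. \<Sum>k<K. block_avg n (?A E k)" and ?b = "\<lambda>n. (1 + real K / real n) * measure M E"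
    show "(?s \<longlongrightarrow>
        (\<Sum>k<K. \<nu> (?A E k))) H"
      by (intro tendsto_sum lim)
    have "?b \<longlonglongrightarrow> (1 + 0) * measure M E"
      by (intro tendsto_intros lim_const_over_n)
    then show "(?b \<longlongrightarrow> measure M E) H" using seq by simp
    have "\<forall>\<^sub>F n in sequentially. ?s n \<le> ?b n"
      using eventually_gt_at_top[of 0] by eventually_elim (rule block_avg_tower_le[OF E])
    then show "\<forall>\<^sub>F n in H. ?s n \<le> ?b n"
      using Hs by (rule filter_leD[rotated])
  qed
  have tW: "{y. 0 < t y} = W" using t_pos t_outside by (metis (mono_tags, lifting) Collect_mem_eq Collect_cong less_numeral_extra(3))
  \<comment> \<open>Level 0 of the tower inequality gives domination inside \<open>W\<close>;
    outside \<open>W\<close> the limit vanishes.\<close>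
  have le: "\<nu> A \<le> measure M A" if A: "A \<in> sets M" for A
  proof -
    have AW: "A \<inter> W \<in> sets M" "A - W \<in> sets M" "UNIV - W \<in> sets M" "(UNIV - W) - (A - W) \<in> sets M" using A U by auto
    have "\<nu> A = \<nu> (A \<inter> W) + \<nu> (A - W)" using add[OF AW(1,2)] by (simp add: Int_Diff_Un) (metis Int_Diff_Un Diff_disjoint Int_Diff inf_commute)
    moreover have "\<nu> (UNIV - W) = \<nu> (A - W) + \<nu> ((UNIV - W) - (A - W))"
      using add[OF AW(2,4)] by (metis Diff_disjoint Diff_mono Un_Diff_cancel order_refl subset_UNIV sup.absorb2)
    moreover have "\<nu> (A \<inter> W) \<le> measure M A" using tower[OF A, of 1] tW by simp
    ultimately show ?thesis using outside nn[of "A - W"] nn[of "(UNIV - W) - (A - W)"] by linarith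
  qed
  define N where "N = measure_of UNIV (sets M) (\<lambda>A. ennreal (\<nu> A))"
  have sig: "sigma_algebra UNIV (sets M)" using sets.sigma_algebra_axioms[of M] by (simp add: space_UNIV)
  interpret sm: sigma_algebra UNIV "sets M" by (rule sig)
  let ?n = "\<lambda>A. ennreal (\<nu> A)"
  have e0: "\<nu> {} = 0" using le[of "{}"] nn[of "{}"] by simp
  have N: "emeasure N A = ennreal (\<nu> A)" if "A \<in> sets M" for A
    unfolding N_def
  proof (rule emeasure_measure_of_sigma[OF sig _ _ that])
    show p: "positive (sets M) ?n" by (simp add: positive_def e0)
    have a: "additive (sets M) ?n" by (simp add: additive_def add nn)
    \<comment> \<open>Domination by \<open>M\<close> transfers continuity at the empty set to \<nu>,
      which so far is only finitely additive.\<close>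
    show "countably_additive (sets M) ?n"
    proof (rule sm.empty_continuous_imp_countably_additive[OF p a])
      fix A :: "nat \<Rightarrow> 'a set" assume A: "range A \<subseteq> sets M" "decseq A" "(\<Inter>i. A i) = {}"
      have "(\<lambda>i. measure M (A i)) \<longlonglongrightarrow> measure M (\<Inter>i. A i)" using A by (intro finite_Lim_measure_decseq) auto
      then have "(\<lambda>i. measure M (A i)) \<longlonglongrightarrow> 0" by (simp add: A(3))
      then have "(\<lambda>i. \<nu> (A i)) \<longlonglongrightarrow> 0"
        by (rule Lim_null_comparison[rotated]) (use A nn le in \<open>auto intro!: always_eventually\<close>)
      then show "(\<lambda>i. ennreal (\<nu> (A i))) \<longlonglongrightarrow> 0"
        using tendsto_ennrealI by fastforce
    qed simp
  qed
  have setsN: "sets N = sets M" unfolding N_def using sm.sets_measure_of_eq by simp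
  have "base_measure N"
    unfolding base_measure_def
  proof (intro conjI ballI setsN)
    show "finite_measure N" by (rule finite_measureI) (use N[OF U] sets_eq_imp_space_eq[OF setsN] in \<open>simp add: space_UNIV\<close>)
    show "emeasure N (F -` A) = emeasure N A" if "A \<in> sets M" for A
      using that inv by (simp add: N FA)
    show "emeasure N (UNIV - W) = 0" using U outside by (simp add: N sets.Diff)
  qed
  moreover have "emeasure N UNIV > 0" using N[OF U] pos d by simp
  moreover have "lift N E \<le> emeasure M E" if E: "E \<in> sets M" for E
    unfolding lift_def
  proof (rule suminf_le_const)
    fix K
    have "(\<Sum>k<K. emeasure N ((f ^^ k) -` E \<inter> {x. k < t x})) = ennreal (\<Sum>k<K. \<nu> (?A E k))"
      by (simp add: N tower_sets[OF E] nn sum_ennreal)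
    also have "\<dots> \<le> emeasure M E" using tower[OF E] by (simp add: emeasure_eq_measure ennreal_leI)
    finally show "(\<Sum>k<K. emeasure N ((f ^^ k) -` E \<inter> {x. k < t x})) \<le> emeasure M E" .
  qed simp
  ultimately show ?thesis by blast
qed

end

section \<open>Lifts of measures on the base\<close>

context induced_system
begin

lemma vimage_F_sets: "A \<in> sets M \<Longrightarrow> F -` A \<in> sets M"
  using measurable_sets[OF measurable_F, of A] by (simp add: space_UNIV)

lemma UNIV_sets [simp]: "UNIV \<in> sets M"
  using sets.top[of M] space_UNIV by simp

lemma pos_t_eq: "{x. 0 < t x} = W"
  using t_pos t_outside by (metis (mono_tags, lifting) Collect_mem_eq Collect_cong less_numeral_extra(3))

lemma emeasure_base_Int_W:
  assumes "base_measure N" "A \<in> sets M" shows "emeasure N (A \<inter> W) = emeasure N A"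
proof -
  have sN: "sets N = sets M" using assms(1) by (simp add: base_measure_def)
  have "A - W \<in> null_sets N"
    by (rule null_sets_subset[of "UNIV - W"]) (use assms W sN in \<open>auto simp: base_measure_def null_sets_def\<close>)
  then have "emeasure N (A - (A - W)) = emeasure N A"
    using assms(2) sN by (intro emeasure_Diff_null_set) auto
  then show ?thesis by (simp add: Diff_Diff_Int)
qed

lemma lift_countably_additive:
  assumes "sets N = sets M" shows "countably_additive (sets M) (lift N)"
proof (rule countably_additiveI)
  fix A :: "nat \<Rightarrow> 'a set" assume A: "range A \<subseteq> sets M" "disjoint_family A"
  let ?P = "\<lambda>k B. (f ^^ k) -` B \<inter> {x. k < t x}" let ?e = "\<lambda>k B. emeasure N (?P k B)"
  have "(\<Sum>i. lift N (A i)) = (\<Sum>i. \<integral>\<^sup>+k. ?e k (A i) \<partial>count_space UNIV)"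
    by (simp add: lift_def nn_integral_count_space_nat)
  also have "\<dots> = (\<integral>\<^sup>+k. (\<Sum>i. ?e k (A i)) \<partial>count_space UNIV)"
    by (rule nn_integral_suminf[symmetric]) simp
  also have "(\<lambda>k. \<Sum>i. ?e k (A i)) = (\<lambda>k. ?e k (\<Union>i. A i))"
  proof
    fix k
    have "(\<Sum>i. ?e k (A i)) = emeasure N (\<Union>i. ?P k (A i))"
      using A tower_sets assms by (intro suminf_emeasure) (auto simp: disjoint_family_on_def)
    also have "(\<Union>i. ?P k (A i)) = ?P k (\<Union>i. A i)" by auto
    finally show "(\<Sum>i. ?e k (A i)) = ?e k (\<Union>i. A i)" .
  qed
  finally show "(\<Sum>i. lift N (A i)) = lift N (\<Union>i. A i)"
    by (simp add: lift_def nn_integral_count_space_nat)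
qed

text \<open>\<open>f\<close> moves height \<open>k\<close> to \<open>k + 1\<close>, except for
  points with \<open>t x = k + 1\<close>, which return to the base by \<open>F\<close>. Invariance
  of \<open>N\<close> under \<open>F\<close> makes these returns restore level 0.\<close>

lemma lift_vimage:
  assumes N: "base_measure N" and E: "E \<in> sets M"
  shows "lift N (f -` E) = lift N E"
proof -
  have sN: "sets N = sets M" using N by (simp add: base_measure_def)
  let ?A = "\<lambda>k. (f ^^ Suc k) -` E \<inter> {x. Suc k < t x}"
  let ?B = "\<lambda>k. F -` E \<inter> {x. t x = Suc k}"
  have B: "?B k \<in> sets N" for k
  proof -
    have "{x \<in> space M. t x = Suc k} \<in> sets M" by measurable
    then show ?thesis using vimage_F_sets[OF E] sN by (simp add: space_UNIV)
  qed
  have A: "?A k \<in> sets N" for k using tower_sets[OF E] sN by blast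
  have "lift N (f -` E) = (\<Sum>k. emeasure N (?A k) + emeasure N (?B k))"
    unfolding lift_def
  proof (rule suminf_cong)
    fix k
    have "(f ^^ k) -` f -` E \<inter> {x. k < t x} = ?A k \<union> ?B k"
    proof (rule set_eqI)
      fix x show "x \<in> (f ^^ k) -` f -` E \<inter> {x. k < t x} \<longleftrightarrow> x \<in> ?A k \<union> ?B k"
        by (cases "t x = Suc k") (auto simp: F)
    qed
    moreover have "?A k \<inter> ?B k = {}" by auto
    ultimately show "emeasure N ((f ^^ k) -` f -` E \<inter> {x. k < t x}) = emeasure N (?A k) + emeasure N (?B k)"
      using A B plus_emeasure by metis
  qed
  also have "\<dots> = (\<Sum>k. emeasure N (?A k)) + (\<Sum>k. emeasure N (?B k))"
    by (rule suminf_add[symmetric]) auto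
  also have "(\<Sum>k. emeasure N (?B k)) = emeasure N (\<Union>k. ?B k)"
    using B by (intro suminf_emeasure) (auto simp: disjoint_family_on_def)
  also have "(\<Union>k. ?B k) = F -` E \<inter> W"
    unfolding pos_t_eq[symmetric] by (auto simp: gr0_conv_Suc)
  also have "emeasure N (F -` E \<inter> W) = emeasure N E"
    using emeasure_base_Int_W[OF N vimage_F_sets[OF E]] N E by (simp add: base_measure_def)
  also have "\<dots> = emeasure N (E \<inter> W)" by (rule emeasure_base_Int_W[OF N E, symmetric])
  also have "(\<Sum>k. emeasure N (?A k)) + emeasure N (E \<inter> W) = lift N E"
    unfolding lift_def using suminf_offset[of "\<lambda>k. emeasure N ((f ^^ k) -` E \<inter> {x. k < t x})" 1]
    by (simp add: pos_t_eq)
  finally show ?thesis .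
qed

lemma lift_eq_multiple:
  assumes N: "base_measure N" and le: "\<And>E. E \<in> sets M \<Longrightarrow> lift N E \<le> emeasure M E" and A: "A \<in> sets M"
  shows "lift N A = lift N UNIV * emeasure M A"
proof -
  have sN: "sets N = sets M" using N by (simp add: base_measure_def)
  have sig: "sigma_algebra UNIV (sets M)" using sets.sigma_algebra_axioms[of M] by (simp add: space_UNIV)
  interpret sm: sigma_algebra UNIV "sets M" by (rule sig)
  define L where "L = measure_of UNIV (sets M) (lift N)"
  have L: "emeasure L B = lift N B" if "B \<in> sets M" for B
    unfolding L_def using lift_countably_additive[OF sN]
    by (intro emeasure_measure_of_sigma[OF sig _ _ that]) (auto simp: positive_def lift_def)
  have "sets L = sets M" unfolding L_def using sm.sets_measure_of_eq by simp
  moreover have "f -` B \<in> sets M" if "B \<in> sets M" for B using vimage_funpow_sets[OF that, of 1] by simp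
  ultimately have "emeasure L A = emeasure L UNIV * emeasure M A"
    using L le lift_vimage[OF N] A by (intro dominated_invariant_measure) auto
  then show ?thesis using L A by simp
qed

lemma lift_UNIV:
  assumes "sets N = sets M"
  shows "lift N UNIV = (\<integral>\<^sup>+x. of_nat (t x) \<partial>N)"
proof -
  have [measurable_cong]: "sets N = sets M" by fact
  have sp: "space N = UNIV" using sets_eq_imp_space_eq[OF assms] space_UNIV by simp
  have ms: "{x. k < t x} \<in> sets N" for k
    using tower_sets[of UNIV k] assms by simp
  have "(\<integral>\<^sup>+x. of_nat (t x) \<partial>N) = (\<integral>\<^sup>+x. (\<Sum>k. indicator {x. k < t x} x) \<partial>N)"
  proof (rule nn_integral_cong)
    fix x
    have "(\<Sum>k. indicator {x. k < t x} x :: ennreal) = (\<Sum>k<t x. indicator {x. k < t x} x)"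
      by (rule suminf_finite) auto
    then show "of_nat (t x) = (\<Sum>k. indicator {x. k < t x} x :: ennreal)" by simp
  qed
  also have "\<dots> = (\<Sum>k. emeasure N {x. k < t x})"
    using ms by (subst nn_integral_suminf) auto
  finally show ?thesis by (simp add: lift_def)
qed

section \<open>Ergodic components of a dominated base measure\<close>

definition invariant_sets :: "'a set set" where
  "invariant_sets = {A \<in> sets M. F -` A = A}"

lemma sigma_algebra_invariant_sets: "sigma_algebra UNIV invariant_sets"
  unfolding sigma_algebra_iff2
  by (auto simp: invariant_sets_def)

definition cut :: "'a measure \<Rightarrow> 'a set \<Rightarrow> 'a measure" where
  "cut N A = density N (indicator A)"

lemma emeasure_cut:
  assumes "sets N = sets M" "A \<in> sets M" "E \<in> sets M"
  shows "emeasure (cut N A) E = emeasure N (A \<inter> E)"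
proof -
  have "emeasure (cut N A) E = (\<integral>\<^sup>+x. indicator A x * indicator E x \<partial>N)"
    unfolding cut_def using assms by (intro emeasure_density) auto
  also have "\<dots> = (\<integral>\<^sup>+x. indicator (A \<inter> E) x \<partial>N)" by (simp only: indicator_inter_arith)
  finally show ?thesis using assms by simp
qed

lemma base_measure_cut:
  assumes N: "base_measure N" and A: "A \<in> invariant_sets"
  shows "base_measure (cut N A)"
proof -
  have sN: "sets N = sets M" and fN: "finite_measure N" and As: "A \<in> sets M" and FA: "F -` A = A"
    and N0: "emeasure N (UNIV - W) = 0"
    using assms by (auto simp: base_measure_def invariant_sets_def)
  interpret N: finite_measure N by fact
  note e = emeasure_cut[OF sN As]
  have sc: "sets (cut N A) = sets M" by (simp add: cut_def sN)
  have inv: "emeasure (cut N A) (F -` E) = emeasure (cut N A) E" if E: "E \<in> sets M" for E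
  proof -
    have "A \<inter> F -` E = F -` (A \<inter> E)" using FA by auto
    then show ?thesis using N As E by (simp add: e vimage_F_sets[OF E] base_measure_def sets.Int del: vimage_Int)
  qed
  have "emeasure (cut N A) (UNIV - W) \<le> emeasure N (UNIV - W)"
    unfolding e[OF sets.Diff[OF UNIV_sets W]]
    by (rule emeasure_mono) (use sN W sets.Diff[OF UNIV_sets W] in auto)
  with N0 have "emeasure (cut N A) (UNIV - W) = 0" by simp
  moreover have "finite_measure (cut N A)"
    using sets_eq_imp_space_eq[OF sc] e[OF UNIV_sets] N.emeasure_finite
    by (intro finite_measureI) (simp add: space_UNIV less_top)
  ultimately show ?thesis using sc inv by (simp add: base_measure_def)
qed

lemma lift_cut_le:
  assumes "sets N = sets M" "A \<in> sets M" "E \<in> sets M"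
  shows "lift (cut N A) E \<le> lift N E"
  unfolding lift_def using assms tower_sets[OF assms(3)]
  by (intro suminf_le) (auto simp: emeasure_cut intro!: emeasure_mono)

text \<open>For invariant \<open>A\<close>, the lift of \<open>N\<close> cut down to \<open>A\<close> is \<open>c \<mu>\<close> with \<open>c = \<integral>\<^sub>A t dN\<close>,
  and it is at least \<open>N(A)\<close> on \<open>A\<close>. This bounds \<open>\<mu>(A)\<close> from below, so that \<open>N\<close> has an ergodic component.\<close>

lemma invariant_set_mass:
  assumes N: "base_measure N" and le: "\<And>E. E \<in> sets M \<Longrightarrow> lift N E \<le> emeasure M E"
    and A: "A \<in> invariant_sets"
  shows "emeasure N A \<le> lift (cut N A) UNIV * emeasure M A"
proof -
  have sN: "sets N = sets M" and As: "A \<in> sets M" using assms by (auto simp: base_measure_def invariant_sets_def)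
  have "emeasure N A = emeasure (cut N A) ((f ^^ 0) -` A \<inter> {x. 0 < t x})"
    using emeasure_base_Int_W[OF N As] As W sN by (simp add: pos_t_eq emeasure_cut sets.Int Int_absorb Int_assoc[symmetric])
  also have "\<dots> = (\<Sum>k<1. emeasure (cut N A) ((f ^^ k) -` A \<inter> {x. k < t x}))" by simp
  also have "\<dots> \<le> lift (cut N A) A"
    unfolding lift_def by (rule sum_le_suminf) auto
  also have "\<dots> = lift (cut N A) UNIV * emeasure M A"
    using le lift_cut_le[OF sN As] by (intro lift_eq_multiple base_measure_cut N A As) (blast intro: order_trans)
  finally show ?thesis .
qed

lemma lift_cut_UNIV:
  assumes "sets N = sets M" "A \<in> sets M"
  shows "lift (cut N A) UNIV = emeasure (density N (\<lambda>x. of_nat (t x))) A"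
proof -
  have [measurable_cong]: "sets N = sets M" by fact
  have "lift (cut N A) UNIV = (\<integral>\<^sup>+x. of_nat (t x) \<partial>cut N A)"
    using assms by (intro lift_UNIV) (simp add: cut_def)
  also have "\<dots> = (\<integral>\<^sup>+x. indicator A x * of_nat (t x) \<partial>N)"
    unfolding cut_def using assms by (subst nn_integral_density) auto
  also have "\<dots> = emeasure (density N (\<lambda>x. of_nat (t x))) A"
    using assms by (subst emeasure_density) (auto simp: mult.commute)
  finally show ?thesis .
qed

text \<open>For invariant subsets of a Hahn set \<open>Y\<close>, the integral of \<open>t\<close>
  is at most \<open>R\<close> times the \<open>N\<close>-mass; the mass bound then gives
  \<open>measure M X \<ge> 1 / R\<close> for every charged invariant \<open>X\<close> inside
  \<open>Y\<close>. A set that nearly minimises \<open>measure M\<close> among these cannot split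
  into two of them.\<close>

lemma exists_invariant_atom:
  assumes N: "base_measure N" "emeasure N UNIV > 0" and le: "\<And>E. E \<in> sets M \<Longrightarrow> lift N E \<le> emeasure M E"
  shows "\<exists>A\<in>invariant_sets. emeasure N A > 0 \<and>
    (\<forall>X\<in>invariant_sets. emeasure N (A \<inter> X) = 0 \<or> emeasure N (A - X) = 0)"
proof -
  have sN: "sets N = sets M" and fN: "finite_measure N" using N by (auto simp: base_measure_def)
  have [measurable_cong]: "sets N = sets M" by fact
  interpret N: finite_measure N by fact
  let ?C = "density N (\<lambda>x. of_nat (t x))"
  have C: "lift (cut N A) UNIV = emeasure ?C A" if "A \<in> sets M" for A by (rule lift_cut_UNIV[OF sN that])
  have CU: "emeasure ?C UNIV \<le> 1"
  proof -
    have "emeasure ?C UNIV = lift (cut N UNIV) UNIV" using C by simp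
    also have "\<dots> \<le> lift N UNIV" by (intro lift_cut_le sN) auto
    also have "\<dots> \<le> emeasure M UNIV" by (intro le) simp
    also have "\<dots> = 1" using emeasure_space_1 by (simp add: space_UNIV)
    finally show ?thesis .
  qed
  have spC: "space ?C = UNIV" using sets_eq_imp_space_eq[OF sN] by (simp add: space_UNIV)
  interpret C: finite_measure ?C
    using CU spC by (intro finite_measureI) (auto simp: top_unique)
  \<comment> \<open>The factor 2 ensures that \<open>N\<close> charges \<open>Y\<close>: otherwise
    \<open>R * measure N UNIV = 2\<close> would be at most the total mass of \<open>?C\<close>,
    which is at most 1.\<close>
  define R where "R = 2 / measure N UNIV"
  have N0: "measure N UNIV > 0" using N(2) by (simp add: N.emeasure_eq_measure)
  then have R: "R > 0" by (simp add: R_def)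
  \<comment> \<open>Both measures are restricted to the invariant sets, so that the Hahn set is
    itself invariant.\<close>
  let ?I = "sigma UNIV invariant_sets"
  have setsI: "sets ?I = invariant_sets" and spI: "space ?I = UNIV"
    using sigma_algebra.sets_measure_of_eq[OF sigma_algebra_invariant_sets] by auto
  have idN: "(\<lambda>x. x) \<in> N \<rightarrow>\<^sub>M ?I" and idC: "(\<lambda>x. x) \<in> ?C \<rightarrow>\<^sub>M ?I"
    by (rule measurableI; use sN spC spI setsI in \<open>auto simp: invariant_sets_def sets_eq_imp_space_eq[OF sN] space_UNIV\<close>)+
  let ?NI = "scale_measure (ennreal R) (distr N ?I (\<lambda>x. x))" and ?CI = "distr ?C ?I (\<lambda>x. x)"
  have NI: "emeasure ?NI X = ennreal (R * measure N X)" and CI: "emeasure ?CI X = ennreal (measure ?C X)"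
    if "X \<in> invariant_sets" for X
    using that idN idC setsI R spC sets_eq_imp_space_eq[OF sN]
    by (auto simp: emeasure_distr N.emeasure_eq_measure C.emeasure_eq_measure space_UNIV ennreal_mult)
  have UI: "UNIV \<in> invariant_sets" by (simp add: invariant_sets_def)
  have "\<exists>Y\<in>sets ?NI. (\<forall>X\<in>sets ?NI. X \<subseteq> Y \<longrightarrow> emeasure ?CI X \<le> emeasure ?NI X) \<and>
      (\<forall>X\<in>sets ?NI. X \<inter> Y = {} \<longrightarrow> emeasure ?NI X \<le> emeasure ?CI X)"
  proof (rule finite_unsigned_Hahn_decomposition)
    have "space ?NI = UNIV" "space ?CI = UNIV" by (simp_all add: spI space_scale_measure)
    then show "finite_measure ?NI" "finite_measure ?CI"
      by (intro finite_measureI, simp only: NI[OF UI] CI[OF UI], simp)+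
  qed simp
  then obtain Y where Y: "Y \<in> invariant_sets"
    and Y1: "\<forall>X\<in>invariant_sets. X \<subseteq> Y \<longrightarrow> emeasure ?CI X \<le> emeasure ?NI X"
    and Y2: "\<forall>X\<in>invariant_sets. X \<inter> Y = {} \<longrightarrow> emeasure ?NI X \<le> emeasure ?CI X"
    unfolding sets_scale_measure sets_distr setsI by (elim bexE conjE) (rule that)
  have YC: "measure ?C X \<le> R * measure N X" if "X \<in> invariant_sets" "X \<subseteq> Y" for X
    using Y1[rule_format, OF that] R unfolding NI[OF that(1)] CI[OF that(1)] by (subst (asm) ennreal_le_iff) auto
  have YN: "R * measure N X \<le> measure ?C X" if "X \<in> invariant_sets" "X \<inter> Y = {}" for X
    using Y2[rule_format, OF that] unfolding NI[OF that(1)] CI[OF that(1)] by (subst (asm) ennreal_le_iff) auto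
  have diff: "X - Z \<in> invariant_sets" "X \<inter> Z \<in> invariant_sets" if "X \<in> invariant_sets" "Z \<in> invariant_sets" for X Z
    using that by (auto simp: invariant_sets_def)
  have toM: "X \<in> sets M" if "X \<in> invariant_sets" for X using that by (simp add: invariant_sets_def)
  have NY: "measure N Y > 0"
  proof (rule ccontr)
    assume "\<not> measure N Y > 0"
    then have "measure N Y = 0" by (simp add: zero_less_measure_iff)
    then have "measure N (UNIV - Y) = measure N UNIV"
      using toM[OF Y] sN by (simp add: N.finite_measure_Diff)
    moreover have "R * measure N (UNIV - Y) \<le> measure ?C (UNIV - Y)"
      by (rule YN[OF diff(1)[OF UI Y]]) blast
    ultimately have "R * measure N UNIV \<le> measure ?C (UNIV - Y)" by (simp only:)
    also have "\<dots> \<le> 1"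
      using order_trans[OF emeasure_mono[of "UNIV - Y" UNIV ?C] CU] sN by (simp add: C.emeasure_eq_measure)
    finally show False using N0 by (simp add: R_def)
  qed
  have mass: "measure M X \<ge> 1 / R" if X: "X \<in> invariant_sets" "X \<subseteq> Y" "measure N X > 0" for X
  proof -
    have "ennreal (measure N X) \<le> ennreal (measure ?C X * measure M X)"
      using invariant_set_mass[OF N(1) le X(1)] C[OF toM[OF X(1)]]
      by (simp add: N.emeasure_eq_measure C.emeasure_eq_measure emeasure_eq_measure ennreal_mult)
    then have "measure N X \<le> measure ?C X * measure M X" by (simp add: ennreal_le_iff)
    also have "\<dots> \<le> R * measure N X * measure M X" using YC[OF X(1,2)] by (intro mult_right_mono) auto
    finally have "measure N X * 1 \<le> measure N X * (R * measure M X)" by (simp add: mult_ac)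
    then have "1 \<le> R * measure M X" using X(3) by (subst (asm) mult_le_cancel_left_pos) auto
    then show ?thesis using R by (simp add: field_simps)
  qed
  define V where "V = {X \<in> invariant_sets. X \<subseteq> Y \<and> measure N X > 0}"
  define m where "m = (INF X\<in>V. measure M X)"
  have V: "Y \<in> V" using Y NY by (simp add: V_def)
  have bdd: "bdd_below (measure M ` V)" by (rule bdd_belowI[of _ 0]) auto
  \<comment> \<open>If \<open>A\<close> split, one piece would have measure at least
    \<open>m\<close> and the other at least \<open>1 / R\<close>.\<close>
  have "m < m + 1 / R" using R by simp
  then obtain A where A: "A \<in> V" "measure M A < m + 1 / R"
    unfolding m_def using cINF_less_iff[OF _ bdd] V by (metis empty_iff)
  show ?thesis
  proof (intro bexI[of _ A] conjI ballI)
    show AI: "A \<in> invariant_sets" using A by (simp add: V_def)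
    show "emeasure N A > 0" using A by (simp add: V_def N.emeasure_eq_measure)
    fix X assume X: "X \<in> invariant_sets"
    show "emeasure N (A \<inter> X) = 0 \<or> emeasure N (A - X) = 0"
    proof (rule ccontr)
      assume "\<not> ?thesis"
      then have p: "measure N (A \<inter> X) > 0" "measure N (A - X) > 0"
        by (auto simp: N.emeasure_eq_measure zero_less_measure_iff)
      have "A \<subseteq> Y" using A by (simp add: V_def)
      then have "A \<inter> X \<in> V" using diff(2)[OF AI X] p by (auto simp: V_def)
      then have "m \<le> measure M (A \<inter> X)" unfolding m_def by (intro cINF_lower bdd)
      moreover have "1 / R \<le> measure M (A - X)"
        using \<open>A \<subseteq> Y\<close> p by (intro mass diff AI X) auto
      moreover have "measure M A = measure M (A \<inter> X) + measure M (A - X)"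
        using toM[OF AI] toM[OF X] by (subst finite_measure_Union[symmetric]) (auto simp: Int_Diff_Un)
      ultimately show False using A(2) by simp
    qed
  qed
qed

text \<open>Restriction to an atom and normalisation by \<open>r\<close> give an ergodic measure;
  its lift is still dominated by a multiple of \<open>M\<close>, hence finite and proportional to
  \<open>M\<close>.\<close>

lemma exists_ergodic_lift:
  assumes "\<not> block_freq \<longlonglongrightarrow> 0"
  shows "\<exists>N. base_measure N \<and> prob_space N \<and> (\<forall>X\<in>invariant_sets. emeasure N X = 0 \<or> emeasure N X = 1) \<and>
    lift N UNIV < \<infinity> \<and> (\<forall>E\<in>sets M. lift N E = lift N UNIV * emeasure M E)"
proof -
  obtain N0 where N0: "base_measure N0" "emeasure N0 UNIV > 0" "\<And>E. E \<in> sets M \<Longrightarrow> lift N0 E \<le> emeasure M E"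
    using exists_dominated_base_measure[OF assms] by blast
  obtain A where A: "A \<in> invariant_sets" "emeasure N0 A > 0"
    and atom: "\<And>X. X \<in> invariant_sets \<Longrightarrow> emeasure N0 (A \<inter> X) = 0 \<or> emeasure N0 (A - X) = 0"
    using exists_invariant_atom[OF N0] by blast
  have sN0: "sets N0 = sets M" and fN0: "finite_measure N0" and As: "A \<in> sets M"
    using N0 A by (auto simp: base_measure_def invariant_sets_def)
  interpret N0: finite_measure N0 by fact
  define r where "r = 1 / measure N0 A"
  have mA: "measure N0 A > 0" using A by (simp add: N0.emeasure_eq_measure)
  have r: "r > 0" using mA by (simp add: r_def)
  have b: "base_measure (cut N0 A)" by (rule base_measure_cut[OF N0(1) A(1)])
  have sc: "sets (cut N0 A) = sets M" using b by (simp add: base_measure_def)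
  define N where "N = scale_measure (ennreal r) (cut N0 A)"
  have eN: "emeasure N E = ennreal r * emeasure (cut N0 A) E" for E by (simp add: N_def)
  have eN': "emeasure N E = ennreal (r * measure N0 (A \<inter> E))" if "E \<in> sets M" for E
    using that r by (simp add: eN emeasure_cut[OF sN0 As] N0.emeasure_eq_measure ennreal_mult)
  have sN: "sets N = sets M" by (simp add: N_def sc)
  have spN: "space N = UNIV" using sets_eq_imp_space_eq[OF sN] by (simp add: space_UNIV)
  have pN: "prob_space N" by (rule prob_spaceI) (use eN'[OF UNIV_sets] mA in \<open>simp add: spN r_def\<close>)
  interpret N: prob_space N by (rule pN)
  have bN: "base_measure N"
    using b sN N.finite_measure_axioms by (simp add: base_measure_def eN)
  have liftN: "lift N E = ennreal r * lift (cut N0 A) E" for E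
    by (simp add: lift_def eN ennreal_suminf_cmult)
  have lc: "lift (cut N0 A) E \<le> emeasure M E" if "E \<in> sets M" for E
    using lift_cut_le[OF sN0 As that] N0(3)[OF that] by (rule order_trans)
  have "lift N E = lift N UNIV * emeasure M E" if "E \<in> sets M" for E
    unfolding liftN by (subst lift_eq_multiple[OF b lc that]) (auto simp: mult.assoc)
  moreover have "lift N UNIV < \<infinity>"
  proof -
    have "lift N UNIV \<le> ennreal r * emeasure M UNIV" unfolding liftN by (intro mult_left_mono lc) auto
    also have "\<dots> < \<infinity>" using r by (simp add: emeasure_eq_measure ennreal_mult[symmetric])
    finally show ?thesis .
  qed
  moreover have "emeasure N X = 0 \<or> emeasure N X = 1" if X: "X \<in> invariant_sets" for X
  proof -
    have Xs: "X \<in> sets M" using X by (simp add: invariant_sets_def)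
    show ?thesis using atom[OF X]
    proof
      assume "emeasure N0 (A \<inter> X) = 0"
      then show ?thesis using eN'[OF Xs] by (simp add: N0.emeasure_eq_measure)
    next
      assume "emeasure N0 (A - X) = 0"
      then have "measure N0 (A - X) = 0" by (simp add: measure_def)
      then have "measure N0 (A \<inter> X) = measure N0 A"
        using N0.finite_measure_Diff'[of A X] As Xs sN0 by simp
      then show ?thesis using eN'[OF Xs] mA by (simp add: r_def)
    qed
  qed
  ultimately show ?thesis using bN pN by blast
qed

end

section \<open>Inducing schemes\<close>

lemma nn_integral_count_space_subset:
  fixes g :: "'i \<Rightarrow> ennreal"
  assumes "B \<subseteq> A"
  shows "(\<integral>\<^sup>+a. g a * indicator B a \<partial>count_space A) = (\<integral>\<^sup>+a. g a \<partial>count_space B)"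
  using nn_integral_restrict_space[of B "count_space A" g] assms
  by (simp add: restrict_count_space Int_absorb1 Int_absorb2)

lemma infsum_ennreal_eq_nn_integral:
  fixes g :: "'i \<Rightarrow> ennreal"
  assumes "countable A"
  shows "infsum g A = (\<integral>\<^sup>+a. g a \<partial>count_space A)"
proof -
  let ?F = "{F. finite F \<and> F \<subseteq> A}"
  let ?I = "\<integral>\<^sup>+a. g a \<partial>count_space A"
  let ?S = "SUP F\<in>?F. sum g F"
  have "infsum g A = ?S"
    by (rule nonneg_infsum_complete) simp
  also have "\<dots> = ?I"
  proof (rule antisym)
    show "?S \<le> ?I"
    proof (rule SUP_least)
      fix F assume F: "F \<in> ?F"
      then have "sum g F = (\<integral>\<^sup>+a. g a \<partial>count_space F)" by (simp add: nn_integral_count_space_finite)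
      also have "\<dots> = (\<integral>\<^sup>+a. g a * indicator F a \<partial>count_space A)"
        using F by (intro nn_integral_count_space_subset[symmetric]) auto
      also have "\<dots> \<le> ?I" by (intro nn_integral_mono) (auto simp: indicator_def)
      finally show "sum g F \<le> ?I" .
    qed
    show "?I \<le> ?S"
    proof (cases "finite A")
      case True
      then show ?thesis by (auto simp: nn_integral_count_space_finite intro!: SUP_upper)
    next
      case False
      let ?e = "from_nat_into A"
      have e: "bij_betw ?e UNIV A" using bij_betw_from_nat_into[OF assms False] .
      have "?I = (\<integral>\<^sup>+n. g (?e n) \<partial>count_space UNIV)"
        by (rule nn_integral_bij_count_space[OF e, symmetric])
      also have "\<dots> = (SUP n. \<Sum>i<n. g (?e i))"
        by (simp add: nn_integral_count_space_nat suminf_eq_SUP)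
      also have "\<dots> \<le> ?S"
      proof (rule SUP_least)
        fix n
        have inj: "inj_on ?e {..<n}" using e by (auto simp: bij_betw_def intro: inj_on_subset)
        have "(\<Sum>i<n. g (?e i)) = sum g (?e ` {..<n})" using inj by (simp add: sum.reindex)
        also have "\<dots> \<le> ?S"
          using e by (intro SUP_upper) (auto simp: bij_betw_def)
        finally show "(\<Sum>i<n. g (?e i)) \<le> ?S" .
      qed
      finally show ?thesis .
    qed
  qed
  finally show ?thesis .
qed

text \<open>A point is fixed iff for every \<open>n\<close> it shares with its image some ball of
  the \<open>n\<close>-th finite cover, the radii tending to 0; only countably many preimages of
  balls are involved.\<close>

lemma fixed_points_borel:
  fixes \<Phi> :: "'a::metric_space \<Rightarrow> 'a"
  assumes "compact (UNIV :: 'a set)" and \<Phi>: "\<Phi> \<in> borel_measurable borel"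
  shows "{y. \<Phi> y = y} \<in> sets borel"
proof -
  have "\<exists>K. finite K \<and> (UNIV :: 'a set) \<subseteq> (\<Union>x\<in>K. ball x (1 / real (Suc n)))" for n
    using assms(1) unfolding compact_eq_totally_bounded by simp
  then obtain K where K: "\<And>n. finite (K n)" "\<And>n. (UNIV :: 'a set) \<subseteq> (\<Union>x\<in>K n. ball x (1 / real (Suc n)))"
    by metis
  let ?R = "\<Inter>n. \<Union>x\<in>K n. ball x (1 / real (Suc n)) \<inter> \<Phi> -` ball x (1 / real (Suc n))"
  have "{y. \<Phi> y = y} = ?R"
  proof (intro equalityI subsetI)
    fix y assume "y \<in> {y. \<Phi> y = y}"
    then show "y \<in> ?R"
      using K(2) by fastforce
  next
    fix y assume y: "y \<in> ?R"
    have "dist (\<Phi> y) y \<le> 2 / real (Suc n)" for n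
    proof -
      obtain x where "dist x y < 1 / real (Suc n)" "dist x (\<Phi> y) < 1 / real (Suc n)"
        using y by (auto simp: mem_ball simp del: of_nat_Suc)
      then have "dist (\<Phi> y) y < 1 / real (Suc n) + 1 / real (Suc n)"
        using dist_triangle3[of "\<Phi> y" y x] by linarith
      then show ?thesis by simp
    qed
    then have "dist (\<Phi> y) y \<le> 0"
      by (intro LIMSEQ_le_const[OF LIMSEQ_Suc[OF lim_const_over_n[of 2]]]) auto
    then show "y \<in> {y. \<Phi> y = y}" by simp
  qed
  moreover have "\<Phi> -` ball x r \<in> sets borel" for x r
    using measurable_sets[OF \<Phi>, of "ball x r"] by simp
  ultimately show ?thesis using K(1) by (auto intro!: sets.countable_INT sets.finite_UN)
qed

context inducing_scheme
begin

abbreviation "W \<equiv> inducing_domain S J"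
abbreviation "t \<equiv> inducing_time S J \<tau>"
abbreviation "F \<equiv> induced_map f S J \<tau>"

lemma inducing_time_eq:
  assumes "a \<in> S" "x \<in> J a" shows "t x = \<tau> a"
proof -
  have "(THE a. a \<in> S \<and> x \<in> J a) = a"
    using assms disjoint_base by (intro the_equality) (auto simp: disjoint_family_on_def)
  then show ?thesis using assms by (auto simp: inducing_time_def inducing_domain_def)
qed

lemma inducing_time_outside: "x \<notin> W \<Longrightarrow> t x = 0"
  by (simp add: inducing_time_def)

lemma W_borel: "W \<in> sets borel"
  unfolding inducing_domain_def using countable_index borel_base by (intro sets.countable_UN') auto

lemma measurable_inducing_time: "t \<in> borel \<rightarrow>\<^sub>M count_space UNIV"
  unfolding measurable_count_space_eq_countable[OF countableI_type]
proof (intro conjI ballI)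
  fix n :: nat
  have "t -` {n} \<inter> space borel = (\<Union>a\<in>{a\<in>S. \<tau> a = n}. J a) \<union> (if n = 0 then UNIV - W else {})"
  proof (rule set_eqI)
    fix x
    show "x \<in> t -` {n} \<inter> space borel \<longleftrightarrow>
        x \<in> (\<Union>a\<in>{a\<in>S. \<tau> a = n}. J a) \<union> (if n = 0 then UNIV - W else {})"
    proof (cases "x \<in> W")
      case True
      then obtain a where a: "a \<in> S" "x \<in> J a" by (auto simp: inducing_domain_def)
      have "t x = n \<longleftrightarrow> (\<exists>b\<in>S. \<tau> b = n \<and> x \<in> J b)"
      proof
        show "\<exists>b\<in>S. \<tau> b = n \<and> x \<in> J b" if "t x = n" using that a inducing_time_eq[OF a] by auto
        show "t x = n" if "\<exists>b\<in>S. \<tau> b = n \<and> x \<in> J b" using that inducing_time_eq by auto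
      qed
      then show ?thesis using True by auto
    next
      case False
      then have "x \<notin> J b" if "b \<in> S" for b using that by (auto simp: inducing_domain_def)
      then show ?thesis using False inducing_time_outside[of x] by auto
    qed
  qed
  moreover have "(\<Union>a\<in>{a\<in>S. \<tau> a = n}. J a) \<in> sets borel"
    using countable_index borel_base by (intro sets.countable_UN') (auto intro: countable_subset)
  ultimately show "t -` {n} \<inter> space borel \<in> sets borel" using W_borel by auto
qed auto

text \<open>Direct images of Borel sets need not be Borel, but on \<open>J a\<close> the map
  \<open>f ^^ k\<close> has a Borel inverse: continue for \<open>\<tau> a - k\<close> steps and
  apply the inverse \<open>h\<close> of the extension. Conditions on this inverse \<Phi> cut out the
  image.\<close>

lemma tower_level_borel:
  assumes c: "compact (UNIV :: 'a set)" and f: "f \<in> borel_measurable borel" and a: "a \<in> S" and k: "k < \<tau> a"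
  shows "(f ^^ k) ` J a \<in> sets borel"
proof -
  obtain g U h where g: "\<forall>x\<in>J a. g x = (f ^^ \<tau> a) x" and U: "open U" "closure (J a) \<subseteq> U"
    and h: "homeomorphism U (g ` U) g h"
    using I1_extension[OF a] unfolding homeo_extension_def by blast
  define C where "C = closure (J a)"
  have C: "compact C" "C \<subseteq> U" "J a \<subseteq> C"
    using c U(2) closure_subset[of "J a"] compact_Int_closed[OF c, of C] by (auto simp: C_def)
  have "continuous_on C g" using h C by (auto simp: homeomorphism_def intro: continuous_on_subset)
  then have gC: "compact (g ` C)" using C(1) by (rule compact_continuous_image)
  then have gCs: "g ` C \<in> sets borel" by (intro borel_closed compact_imp_closed)
  have "continuous_on (g ` C) h" using h C by (auto simp: homeomorphism_def intro: continuous_on_subset)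
  then have "h \<in> borel_measurable (restrict_space borel (g ` C))"
    by (rule borel_measurable_continuous_on_restrict)
  then have h': "(\<lambda>z. if z \<in> g ` C then h z else undefined) \<in> borel_measurable borel" (is "?h \<in> _")
    using gCs by (subst (asm) measurable_restrict_space_iff[where c = undefined]) auto
  have fn: "(f ^^ n) \<in> borel_measurable borel" for n by (rule measurable_funpow[OF f])
  define \<Phi> where "\<Phi> = (\<lambda>y. ?h ((f ^^ (\<tau> a - k)) y))"
  have \<Phi>: "\<Phi> \<in> borel_measurable borel"
    unfolding \<Phi>_def by (rule measurable_compose[OF fn h'])
  have f\<Phi>: "(\<lambda>y. (f ^^ k) (\<Phi> y)) \<in> borel_measurable borel"
    by (rule measurable_compose[OF \<Phi> fn])
  let ?R = "(f ^^ (\<tau> a - k)) -` (g ` C) \<inter> \<Phi> -` J a \<inter> {y. (f ^^ k) (\<Phi> y) = y}"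
  have "(f ^^ k) ` J a = ?R"
  proof (intro equalityI subsetI)
    fix y assume "y \<in> (f ^^ k) ` J a"
    then obtain x where x: "x \<in> J a" "y = (f ^^ k) x" by auto
    have "(f ^^ (\<tau> a - k)) y = (f ^^ (\<tau> a - k + k)) x" by (simp add: x(2) funpow_add)
    then have y: "(f ^^ (\<tau> a - k)) y = g x" using g x k by simp
    have "h (g x) = x" using h x(1) C by (auto simp: homeomorphism_def)
    moreover have "g x \<in> g ` C" using x(1) C(3) by auto
    ultimately have "\<Phi> y = x" unfolding \<Phi>_def y by simp
    then show "y \<in> ?R"
      using x C y by auto
  next
    fix y assume "y \<in> ?R"
    then have "\<Phi> y \<in> J a" "(f ^^ k) (\<Phi> y) = y" by auto
    then show "y \<in> (f ^^ k) ` J a" by (auto intro!: image_eqI[of y "f ^^ k" "\<Phi> y"])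
  qed
  moreover have "(f ^^ (\<tau> a - k)) -` (g ` C) \<in> sets borel" "\<Phi> -` J a \<in> sets borel"
    using measurable_sets[OF fn gCs] measurable_sets[OF \<Phi> borel_base[OF a]] by auto
  ultimately show ?thesis using fixed_points_borel[OF c f\<Phi>] by auto
qed

lemma F_W: "x \<in> W \<Longrightarrow> F x \<in> W"
proof -
  assume "x \<in> W"
  then obtain a where a: "a \<in> S" "x \<in> J a" by (auto simp: inducing_domain_def)
  then show "F x \<in> W" using I1_maps_into[OF a(1)] by (auto simp: induced_map_def inducing_time_eq)
qed

lemma t_pos: "x \<in> W \<Longrightarrow> t x > 0"
  using time_pos by (auto simp: inducing_domain_def inducing_time_eq)

lemma induced_system:
  assumes \<mu>: "\<mu> \<in> ergodic_measures borel f" and pos: "emeasure \<mu> W > 0"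
  shows "induced_system \<mu> f W t F"
proof -
  have s: "sets \<mu> = sets borel" and p: "prob_space \<mu>" and f: "f \<in> borel \<rightarrow>\<^sub>M borel" and d: "distr \<mu> borel f = \<mu>"
    and e: "\<And>A. A \<in> sets borel \<Longrightarrow> f -` A \<inter> space borel = A \<Longrightarrow> emeasure \<mu> A = 0 \<or> emeasure \<mu> A = 1"
    using \<mu> by (auto simp: ergodic_measures_def)
  interpret prob_space \<mu> by (rule p)
  have sp: "space \<mu> = UNIV" using sets_eq_imp_space_eq[OF s] by simp
  show ?thesis
  proof
    show "distr \<mu> \<mu> f = \<mu>" using d distr_cong[OF refl s, where f=f and g=f] by simp
    show "f \<in> \<mu> \<rightarrow>\<^sub>M \<mu>" using f by (simp cong: measurable_cong_sets add: s)
    show "t \<in> \<mu> \<rightarrow>\<^sub>M count_space UNIV" using measurable_inducing_time measurable_cong_sets[OF s refl] by blast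
    show "measure \<mu> W > 0" using pos by (simp add: emeasure_eq_measure)
  qed (use sp e W_borel s F_W t_pos inducing_time_outside in \<open>auto simp: induced_map_def\<close>)
qed

text \<open>The levels below the inducing time form a Borel set that contains \<open>W\<close> and
  is mapped into itself by \<open>f\<close>, so ergodicity gives it full measure.\<close>

lemma AE_tower:
  assumes c: "compact (UNIV :: 'a set)" and \<mu>: "\<mu> \<in> ergodic_measures borel f" and pos: "emeasure \<mu> W > 0"
  shows "AE x in \<mu>. x \<in> tower f S J"
proof -
  interpret induced_system \<mu> f W t F by (rule induced_system[OF \<mu> pos])
  have s: "sets \<mu> = sets borel" and f: "f \<in> borel_measurable borel" using \<mu> by (auto simp: ergodic_measures_def)
  define Y where "Y = (\<Union>a\<in>S. \<Union>k\<in>{..<\<tau> a}. (f ^^ k) ` J a)"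
  have Y: "Y \<in> sets \<mu>"
    unfolding Y_def s using tower_level_borel[OF c f] countable_index
    by (intro sets.countable_UN' sets.finite_UN) auto
  have WY: "W \<subseteq> Y"
  proof
    fix x assume "x \<in> W"
    then obtain a where "a \<in> S" "x \<in> J a" by (auto simp: inducing_domain_def)
    then show "x \<in> Y" using time_pos[of a] unfolding Y_def by (intro UN_I[of a] UN_I[of 0]) auto
  qed
  have "f x \<in> Y" if xY: "x \<in> Y" for x
  proof -
    obtain a k z where x: "a \<in> S" "k < \<tau> a" "z \<in> J a" "x = (f ^^ k) z" using xY unfolding Y_def by blast
    show ?thesis
    proof (cases "Suc k = \<tau> a")
      case True
      then have "f x = (f ^^ \<tau> a) z" using x by (metis comp_apply funpow.simps(2))
      then have "f x \<in> W" using I1_maps_into[OF x(1)] x(3) by auto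
      then show ?thesis using WY by auto
    next
      case False
      then have "f x \<in> (f ^^ Suc k) ` J a" "Suc k < \<tau> a" using x by auto
      then show ?thesis using x(1) unfolding Y_def by blast
    qed
  qed
  moreover have "measure \<mu> Y > 0"
    using finite_measure_mono[OF WY Y] W_pos by linarith
  ultimately have "AE x in \<mu>. x \<in> Y" using Y by (intro AE_forward_invariant) auto
  moreover have "Y \<subseteq> tower f S J" by (auto simp: Y_def tower_def inducing_domain_def)
  ultimately show ?thesis by (auto elim!: eventually_mono)
qed

text \<open>The ergodic base measure, restricted to \<open>W\<close>, is the measure to be lifted:
  its unnormalised lift is a constant multiple of \<mu>, and the constant is the mean inducing
  time.\<close>

lemma liftable_if_recurrent:
  assumes c: "compact (UNIV :: 'a set)" and \<mu>: "\<mu> \<in> ergodic_measures borel f" and pos: "emeasure \<mu> W > 0"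
    and rec: "\<not> induced_system.block_freq \<mu> W t F \<longlonglongrightarrow> 0"
  shows "\<mu> \<in> liftable_measures f S J \<tau>"
proof -
  interpret induced_system \<mu> f W t F by (rule induced_system[OF \<mu> pos])
  have s: "sets \<mu> = sets borel" and f: "f \<in> borel_measurable borel" using \<mu> by (auto simp: ergodic_measures_def)
  obtain N where N: "base_measure N" "prob_space N" and erg: "\<And>X. X \<in> invariant_sets \<Longrightarrow> emeasure N X = 0 \<or> emeasure N X = 1"
    and fin: "lift N UNIV < \<infinity>" and mult: "\<And>E. E \<in> sets \<mu> \<Longrightarrow> lift N E = lift N UNIV * emeasure \<mu> E"
    using exists_ergodic_lift[OF rec] by blast
  interpret N: prob_space N by fact
  have sN: "sets N = sets borel" using N(1) s by (simp add: base_measure_def)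
  have spN: "space N = UNIV" using sets_eq_imp_space_eq[OF sN] by simp
  have WN: "W \<in> sets N" using W_borel sN by simp
  have NW: "emeasure N W = 1"
    using emeasure_base_Int_W[OF N(1) UNIV_sets] N.emeasure_space_1 spN by simp
  define \<nu> where "\<nu> = restrict_space N W"
  let ?B = "restrict_space borel W"
  have \<nu>: "emeasure \<nu> A = emeasure N A" if "A \<subseteq> W" for A
    unfolding \<nu>_def using WN that by (intro emeasure_restrict_space) auto
  have s\<nu>: "sets \<nu> = sets ?B" unfolding \<nu>_def by (rule sets_restrict_space_cong[OF sN])
  have sp\<nu>: "space \<nu> = W" using spN by (simp add: \<nu>_def space_restrict_space)
  have sB: "A \<in> sets ?B \<longleftrightarrow> A \<in> sets borel \<and> A \<subseteq> W" for A
    using W_borel by (auto simp: sets_restrict_space_iff)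
  have spB: "space ?B = W" by (simp add: space_restrict_space)
  have FB: "F \<in> ?B \<rightarrow>\<^sub>M ?B"
  proof (rule measurable_restrict_space3)
    show "F \<in> borel \<rightarrow>\<^sub>M borel" using measurable_F by (simp cong: measurable_cong_sets add: s)
  qed (use F_W in auto)
  have F\<nu>: "F \<in> \<nu> \<rightarrow>\<^sub>M ?B" using FB by (simp cong: measurable_cong_sets add: s\<nu>)
  have inv: "distr \<nu> ?B F = \<nu>"
  proof (rule measure_eqI)
    fix A assume "A \<in> sets (distr \<nu> ?B F)"
    then have A: "A \<in> sets borel" "A \<subseteq> W" using sB by auto
    have "emeasure (distr \<nu> ?B F) A = emeasure \<nu> (F -` A \<inter> W)"
      using A sB F\<nu> by (simp add: emeasure_distr sp\<nu>)
    also have "\<dots> = emeasure N (F -` A)"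
      using \<nu>[of "F -` A \<inter> W"] emeasure_base_Int_W[OF N(1) vimage_F_sets, of A] A s by simp
    also have "\<dots> = emeasure N A" using N(1) A s by (simp add: base_measure_def)
    finally show "emeasure (distr \<nu> ?B F) A = emeasure \<nu> A" using \<nu>[OF A(2)] by simp
  qed (simp add: s\<nu>)
  have "\<nu> \<in> induced_ergodic_measures f S J \<tau>"
    unfolding induced_ergodic_measures_def ergodic_measures_def
  proof (intro CollectI conjI ballI impI s\<nu> inv FB)
    show "prob_space \<nu>" by (rule prob_spaceI) (simp add: sp\<nu> \<nu> NW)
    fix A assume A: "A \<in> sets ?B" "F -` A \<inter> space ?B = A"
    \<comment> \<open>Off \<open>W\<close> the inducing time is 0 and \<open>F\<close> is the
      identity, so a subset of \<open>W\<close> that is invariant within \<open>W\<close> is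
      invariant in the whole space.\<close>
    have "F -` A = A"
    proof -
      have out: "F x = x" if "x \<notin> W" for x using that by (simp add: induced_map_def inducing_time_outside)
      have eq: "F -` A \<inter> W = A" using A(2) by (simp only: spB)
      show ?thesis
      proof (rule set_eqI)
        fix x show "x \<in> F -` A \<longleftrightarrow> x \<in> A"
        proof (cases "x \<in> W")
          case True
          have "x \<in> A \<longleftrightarrow> x \<in> F -` A \<inter> W" by (rule arg_cong[where f = "\<lambda>X. x \<in> X", OF eq[symmetric]])
          then show ?thesis using True by simp
        next
          case False
          then show ?thesis by (simp add: out)
        qed
      qed
    qed
    then have "A \<in> invariant_sets" using A sB s by (simp add: invariant_sets_def)
    then show "emeasure \<nu> A = 0 \<or> emeasure \<nu> A = 1" using erg \<nu>[of A] A sB by auto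
  qed
  moreover have Q: "mean_inducing_time S J \<tau> \<nu> = lift N UNIV"
  proof -
    have "mean_inducing_time S J \<tau> \<nu> = (\<integral>\<^sup>+x. of_nat (t x) * indicator W x \<partial>N)"
      unfolding mean_inducing_time_def \<nu>_def using WN by (intro nn_integral_restrict_space) auto
    also have "\<dots> = (\<integral>\<^sup>+x. of_nat (t x) \<partial>N)"
      by (intro nn_integral_cong) (auto simp: indicator_def inducing_time_outside)
    finally show ?thesis using lift_UNIV[of N] sN s by simp
  qed
  moreover have "lifted_measure f S J \<tau> \<nu> = \<mu>"
  proof -
    let ?L = "\<lambda>E. \<Sum>\<^sub>\<infinity>a\<in>S. \<Sum>k<\<tau> a. emeasure \<nu> ((f ^^ k) -` E \<inter> J a)"
    \<comment> \<open>Level 0 of the tower is \<open>W\<close> and has mass 1, so the normalising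
      constant is not 0.\<close>
    have Q0: "lift N UNIV \<noteq> 0"
    proof -
      have "(\<Sum>k<1. emeasure N ((f ^^ k) -` UNIV \<inter> {x. k < t x})) \<le> lift N UNIV"
        unfolding lift_def by (rule sum_le_suminf) auto
      moreover have "(\<Sum>k<1. emeasure N ((f ^^ k) -` UNIV \<inter> {x. k < t x})) = 1"
        by (simp add: pos_t_eq NW)
      ultimately show ?thesis by (metis not_one_le_zero)
    qed
    \<comment> \<open>The sums over blocks and over heights are interchanged; at a fixed height the
      pieces in the sets \<open>J a\<close> are disjoint.\<close>
    have val: "?L E = lift N E" if E: "E \<in> sets borel" for E
    proof -
      let ?A = "\<lambda>k a. if k < \<tau> a then (f ^^ k) -` E \<inter> J a else {}"
      have As: "?A k a \<in> sets N" if "a \<in> S" for k a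
        using vimage_funpow_sets[of E k] E s sN borel_base[OF that] by auto
      have "?L E
         = (\<integral>\<^sup>+a. (\<Sum>k<\<tau> a. emeasure \<nu> ((f ^^ k) -` E \<inter> J a)) \<partial>count_space S)"
        by (rule infsum_ennreal_eq_nn_integral[OF countable_index])
      also have "\<dots> = (\<integral>\<^sup>+a. (\<Sum>k. emeasure N (?A k a)) \<partial>count_space S)"
      proof (rule nn_integral_cong)
        fix a assume "a \<in> space (count_space S)"
        then have a: "J a \<subseteq> W" by (auto simp: inducing_domain_def)
        have "(\<Sum>k. emeasure N (?A k a)) = (\<Sum>k<\<tau> a. emeasure N (?A k a))"
          by (rule suminf_finite) auto
        also have "\<dots> = (\<Sum>k<\<tau> a. emeasure \<nu> ((f ^^ k) -` E \<inter> J a))"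
          using a by (intro sum.cong refl) (auto intro!: \<nu>[symmetric])
        finally show "(\<Sum>k<\<tau> a. emeasure \<nu> ((f ^^ k) -` E \<inter> J a)) = (\<Sum>k. emeasure N (?A k a))" ..
      qed
      also have "\<dots> = (\<Sum>k. \<integral>\<^sup>+a. emeasure N (?A k a) \<partial>count_space S)"
        by (rule nn_integral_suminf) simp
      also have "\<dots> = (\<Sum>k. emeasure N (\<Union>a\<in>S. ?A k a))"
      proof (rule suminf_cong)
        fix k
        show "(\<integral>\<^sup>+a. emeasure N (?A k a) \<partial>count_space S) = emeasure N (\<Union>a\<in>S. ?A k a)"
        proof (rule emeasure_UN_countable[symmetric, OF As countable_index])
          show "disjoint_family_on (?A k) S"
            unfolding disjoint_family_on_def
          proof (intro ballI impI)
            fix m n assume "m \<in> S" "n \<in> S" "m \<noteq> n"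
            then have "J m \<inter> J n = {}" using disjoint_base by (auto simp: disjoint_family_on_def)
            then show "?A k m \<inter> ?A k n = {}" by auto
          qed
        qed
      qed
      also have "\<dots> = lift N E"
      proof -
        have "(\<Union>a\<in>S. ?A k a) = (f ^^ k) -` E \<inter> {x. k < t x}" for k
        proof (intro equalityI subsetI)
          fix x assume "x \<in> (\<Union>a\<in>S. ?A k a)"
          then show "x \<in> (f ^^ k) -` E \<inter> {x. k < t x}"
            using inducing_time_eq by (auto split: if_splits)
        next
          fix x assume x: "x \<in> (f ^^ k) -` E \<inter> {x. k < t x}"
          then have "x \<in> W" using inducing_time_outside[of x] by force
          then obtain a where "a \<in> S" "x \<in> J a" by (auto simp: inducing_domain_def)
          then show "x \<in> (\<Union>a\<in>S. ?A k a)" using x inducing_time_eq[of a x] by auto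
        qed
        then show ?thesis by (simp add: lift_def)
      qed
      finally show ?thesis .
    qed
    have "lifted_measure f S J \<tau> \<nu> = measure_of (space \<mu>) (sets \<mu>) (emeasure \<mu>)"
      unfolding lifted_measure_def Q s space_UNIV
    proof (rule measure_of_eq)
      fix E :: "'a set" assume "E \<in> sigma_sets UNIV (sets borel)"
      then have E: "E \<in> sets borel" using sets.sigma_sets_eq[of "borel :: 'a measure"] by simp
      show "?L E / lift N UNIV = emeasure \<mu> E"
        unfolding val[OF E] using mult[of E] E s fin Q0
        by (simp add: ennreal_mult_divide_eq mult.commute)
    qed simp
    then show ?thesis by (simp add: measure_of_of_measure)
  qed
  ultimately show ?thesis
    using \<mu> AE_tower[OF c \<mu> pos] fin unfolding liftable_measures_def tower_ergodic_measures_def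
    by (auto intro!: bexI[of _ \<nu>])
qed

end

text \<open>\<phi> is measurable with respect to the completion, so it is replaced by a Borel
  version \<psi>. With the convention \<open>\<infinity> - \<infinity> = \<infinity>\<close>, a
  finite value forces the positive and the negative part to be finite.\<close>

lemma extended_integral_finite:
  assumes \<phi>: "\<phi> \<in> borel_measurable (completion M)"
    and I: "extended_integral (completion M) \<phi> \<noteq> \<infinity>" "extended_integral (completion M) \<phi> \<noteq> - \<infinity>"
  obtains \<psi> where "integrable M \<psi>" "AE x in M. \<phi> x = \<psi> x"
    "extended_integral (completion M) \<phi> = ereal (\<integral>x. \<psi> x \<partial>M)"
proof -
  obtain \<psi> where \<psi>: "\<psi> \<in> borel_measurable M" "AE x in M. \<phi> x = \<psi> x"
    using completion_ex_borel_measurable_real[OF \<phi>] by blast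
  have AEc: "AE x in completion M. \<phi> x = \<psi> x" using \<psi>(2) by (rule AE_completion)
  have pn: "(\<integral>\<^sup>+x. ennreal (c * \<phi> x) \<partial>completion M) = (\<integral>\<^sup>+x. ennreal (c * \<psi> x) \<partial>M)" for c
  proof -
    have "(\<integral>\<^sup>+x. ennreal (c * \<phi> x) \<partial>completion M) = (\<integral>\<^sup>+x. ennreal (c * \<psi> x) \<partial>completion M)"
      using AEc by (intro nn_integral_cong_AE) (auto elim: eventually_mono)
    also have "\<dots> = (\<integral>\<^sup>+x. ennreal (c * \<psi> x) \<partial>M)" using \<psi>(1) by (intro nn_integral_completion)
    finally show ?thesis .
  qed
  let ?p = "\<integral>\<^sup>+x. ennreal (\<psi> x) \<partial>M" and ?n = "\<integral>\<^sup>+x. ennreal (- \<psi> x) \<partial>M"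
  have E: "extended_integral (completion M) \<phi> = enn2ereal ?p - enn2ereal ?n"
    using pn[of 1] pn[of "-1"] by (simp add: extended_integral_def)
  have pf: "?p \<noteq> \<infinity>" using I(1) E by auto
  then obtain P where P: "?p = ennreal P" "P \<ge> 0" by (cases ?p) auto
  have nf: "?n \<noteq> \<infinity>"
  proof
    assume "?n = \<infinity>"
    then have "extended_integral (completion M) \<phi> = - \<infinity>" using P unfolding E by (simp add: enn2ereal_ennreal)
    with I(2) show False by simp
  qed
  then obtain Q where Q: "?n = ennreal Q" "Q \<ge> 0" by (cases ?n) auto
  have i: "integrable M \<psi>"
    using pf nf \<psi>(1) by (simp add: real_integrable_def)
  have "extended_integral (completion M) \<phi> = ereal (\<integral>x. \<psi> x \<partial>M)"
    using P Q by (simp add: E real_lebesgue_integral_def[OF i] enn2ereal_ennreal)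
  with i \<psi>(2) show thesis by (rule that)
qed

section \<open>Complexity as a bound for the pressure\<close>

context inducing_scheme
begin

text \<open>Sorted by inducing time, the series has the terms \<open>v n\<close>. For large
  \<open>n\<close> they are dominated by a geometric series with ratio
  \<open>exp (- (\<rho> - \<kappa>))\<close>, and each of the finitely many others is
  finite.\<close>

lemma weighted_series_finite:
  assumes fin: "finite_complexity S J \<tau> \<omega>" and \<kappa>: "complexity S J \<tau> \<omega> < ereal \<kappa>" and \<rho>: "\<kappa> < \<rho>"
  shows "(\<integral>\<^sup>+a. (SUP x\<in>J a. ennreal (exp (\<omega> x))) * ennreal (exp (- \<rho> * real (\<tau> a))) \<partial>count_space S) < \<infinity>"
proof -
  define s where "s a = (SUP x\<in>J a. ennreal (exp (\<omega> x)))" for a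
  let ?e = "\<lambda>n. ennreal (exp (- \<rho> * real n))"
  let ?r = "\<lambda>n a. s a * ?e n * indicator {a. \<tau> a = n} a"
  let ?U = "weighted_count S J \<tau> \<omega>"
  define v where "v n = ?U n * ?e n" for n
  \<comment> \<open>Finite complexity speaks of \<open>n \<ge> 1\<close> only, but no element has
    inducing time 0.\<close>
  have v0: "v 0 = 0"
  proof -
    have S0: "{a\<in>S. \<tau> a = 0} = {}" using time_pos by auto
    show ?thesis unfolding v_def weighted_count_def S0 by simp
  qed
  have vfin: "v n < \<infinity>" for n
  proof (cases "n = 0")
    case False
    then have "?U n < \<infinity>" using fin by (simp add: finite_complexity_def)
    then show ?thesis by (simp add: v_def ennreal_mult_less_top)
  qed (simp add: v0)
  have "\<forall>\<^sub>F n in sequentially. log_ennreal (?U n) / ereal (real n) < ereal \<kappa>"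
    using \<kappa> unfolding complexity_def by (rule Limsup_lessD)
  then obtain n0 where n0: "\<And>n. n \<ge> n0 \<Longrightarrow> log_ennreal (?U n) / ereal (real n) < ereal \<kappa>"
    unfolding eventually_sequentially by blast
  have le: "v n \<le> ennreal (exp (- (\<rho> - \<kappa>)) ^ n)" if n: "n \<ge> max 1 n0" for n
  proof -
    have "?U n \<le> ennreal (exp (\<kappa> * real n))"
    proof (cases "?U n = 0")
      case False
      have "?U n < \<infinity>" using fin n by (simp add: finite_complexity_def)
      then obtain u where u: "?U n = ennreal u" "u > 0"
        using False by (cases "?U n") (auto simp: less_le)
      have "ereal (ln u) / ereal (real n) < ereal \<kappa>"
        using n0[of n] n u by (simp add: log_ennreal_def)
      then have "ln u / real n < \<kappa>" using n by simp
      then have "ln u < \<kappa> * real n" using n by (simp add: field_simps)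
      then have "u \<le> exp (\<kappa> * real n)" using u(2) by (metis exp_le_cancel_iff exp_ln less_imp_le)
      then show ?thesis using u by (simp add: ennreal_leI)
    qed simp
    then have "v n \<le> ennreal (exp (\<kappa> * real n)) * ?e n"
      unfolding v_def by (intro mult_right_mono) auto
    also have "\<dots> = ennreal (exp (- (\<rho> - \<kappa>)) ^ n)"
      by (simp add: ennreal_mult[symmetric] exp_add[symmetric] exp_of_nat_mult[symmetric] algebra_simps)
    finally show ?thesis .
  qed
  have "(\<integral>\<^sup>+a. s a * ennreal (exp (- \<rho> * real (\<tau> a))) \<partial>count_space S)
      = (\<integral>\<^sup>+a. (\<Sum>n. ?r n a) \<partial>count_space S)"
  proof (rule nn_integral_cong)
    fix a
    have "(\<Sum>n. ?r n a)
      = (\<Sum>n\<in>{\<tau> a}. ?r n a)"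
      by (rule suminf_finite) auto
    then show "s a * ennreal (exp (- \<rho> * real (\<tau> a)))
      = (\<Sum>n. ?r n a)" by simp
  qed
  also have "\<dots> = (\<Sum>n. \<integral>\<^sup>+a. ?r n a \<partial>count_space S)"
    by (rule nn_integral_suminf) simp
  also have "\<dots> = (\<Sum>n. v n)"
  proof (rule suminf_cong)
    fix n
    have "(\<integral>\<^sup>+a. ?r n a \<partial>count_space S)
      = (\<integral>\<^sup>+a. ?e n * (s a * indicator {a\<in>S. \<tau> a = n} a) \<partial>count_space S)"
    proof (rule nn_integral_cong)
      fix a assume "a \<in> space (count_space S)"
      then show "?r n a
        = ?e n * (s a * indicator {a\<in>S. \<tau> a = n} a)"
        by (cases "\<tau> a = n") (simp_all add: mult.commute)
    qed
    also have "\<dots> = ?e n * (\<integral>\<^sup>+a. s a * indicator {a\<in>S. \<tau> a = n} a \<partial>count_space S)"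
      by (rule nn_integral_cmult) simp_all
    also have "(\<integral>\<^sup>+a. s a * indicator {a\<in>S. \<tau> a = n} a \<partial>count_space S) = (\<integral>\<^sup>+a. s a \<partial>count_space {a\<in>S. \<tau> a = n})"
      by (rule nn_integral_count_space_subset) auto
    also have "\<dots> = ?U n"
      unfolding weighted_count_def s_def[symmetric]
      by (rule infsum_ennreal_eq_nn_integral[symmetric]) (rule countable_subset[OF _ countable_index], auto)
    finally show "(\<integral>\<^sup>+a. ?r n a \<partial>count_space S) = v n"
      by (simp add: v_def mult.commute)
  qed
  also have "\<dots> = (\<Sum>n. v (n + max 1 n0)) + (\<Sum>n<max 1 n0. v n)" by (rule suminf_offset) simp
  also have "\<dots> < \<infinity>"
  proof -
    let ?q = "exp (- (\<rho> - \<kappa>))"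
    have q: "?q < 1" using \<rho> by simp
    have "(\<Sum>n. v (n + max 1 n0)) \<le> (\<Sum>n. ennreal (?q ^ (n + max 1 n0)))"
      by (intro suminf_le le) auto
    also have "\<dots> < \<infinity>"
    proof -
      have "summable (\<lambda>n. ?q ^ (n + max 1 n0))"
        using summable_ignore_initial_segment[OF summable_geometric, of ?q] q by simp
      then show ?thesis
        unfolding infinity_ennreal_def less_top[symmetric] by (rule ennreal_suminf_neq_top) simp
    qed
    finally have "(\<Sum>n. v (n + max 1 n0)) < \<infinity>" .
    moreover have "(\<Sum>n<max 1 n0. v n) < \<infinity>" using vfin by simp
    ultimately show ?thesis by simp
  qed
  finally show ?thesis by (simp only: s_def)
qed

text \<open>Compatibility makes the name of a block independent of the point from which it is
  read.\<close>

lemma compatible_itin_eq: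
  assumes P: "measurable_partition P" "compatible_partition f S J \<tau> P"
    and a: "a \<in> S" "x \<in> J a" "y \<in> J a"
  shows "itin f (cell P) (\<tau> a) x = itin f (cell P) (\<tau> a) y"
  unfolding itin_eq_iff
proof (intro allI impI)
  fix k assume k: "k < \<tau> a"
  have part: "partition_on UNIV P" using P(1) by (simp add: measurable_partition_def)
  obtain A where A: "A \<in> P" "(f ^^ k) ` J a \<subseteq> A"
    using P(2) a(1) k unfolding compatible_partition_def by blast
  have "cell P ((f ^^ k) z) = A" if "z \<in> J a" for z
    using A that by (intro cell_eq[OF part A(1)]) auto
  then show "cell P ((f ^^ k) x) = cell P ((f ^^ k) y)" using a by simp
qed

lemma ks_entropy_le_complexity:
  assumes \<mu>: "\<mu> \<in> ergodic_measures borel f" and pos: "emeasure \<mu> W > 0"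
    and nonrec: "induced_system.block_freq \<mu> W t F \<longlonglongrightarrow> 0"
    and P: "finite P" "measurable_partition P" "generating f P" "compatible_partition f S J \<tau> P"
    and fin: "finite_complexity S J \<tau> (induced_potential f S J \<tau> \<phi>)"
    and \<kappa>: "complexity S J \<tau> (induced_potential f S J \<tau> \<phi>) < ereal \<kappa>" "\<kappa> < \<rho>"
    and \<psi>: "integrable \<mu> \<psi>" "AE x in \<mu>. \<phi> x = \<psi> x"
  shows "ks_entropy f \<mu> \<le> ereal (\<rho> - (\<integral>x. \<psi> x \<partial>\<mu>))"
proof -
  interpret induced_system \<mu> f W t F by (rule induced_system[OF \<mu> pos])
  have s: "sets \<mu> = sets borel" and f: "f \<in> borel_measurable borel" and d: "distr \<mu> borel f = \<mu>"
    using \<mu> by (auto simp: ergodic_measures_def)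
  let ?p = "cell P"
  have part: "partition_on UNIV P" using P(2) by (simp add: measurable_partition_def)
  \<comment> \<open>The midpoint leaves room on both sides: the series converges at
    \<open>\<rho>'\<close>, and \<open>\<rho> - \<rho>'\<close> serves as the \<delta> of the weight
    estimate.\<close>
  define \<rho>' where "\<rho>' = (\<kappa> + \<rho>) / 2"
  have \<rho>': "\<kappa> < \<rho>'" "\<rho> - \<rho>' > 0" using \<kappa>(2) by (auto simp: \<rho>'_def field_simps)
  define nm where "nm a = itin f ?p (\<tau> a) (SOME x. x \<in> J a)" for a
  define w where "w a = (SUP x\<in>J a. ennreal (exp (induced_potential f S J \<tau> \<phi> x)))" for a
  have "\<exists>C. \<forall>n. code_entropy \<mu> (itin f ?p n) \<le> (\<rho>' - (\<integral>x. \<psi> x \<partial>\<mu>) + (\<rho> - \<rho>')) * real n + C"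
  proof (rule code_entropy_itin_le_weights[OF nonrec P(1) _ _ _ _ _ \<psi> \<rho>'(2)])
    show "range ?p \<subseteq> P" using cell(1)[OF part] by auto
    show "simple_function \<mu> ?p" by (rule simple_function_cell[OF P(1,2) s])
    show "length (nm a) > 0" if "a \<in> S" for a using time_pos[OF that] by (simp add: nm_def)
    show "\<exists>a\<in>S. nm a = itin f ?p (t x) x \<and> ennreal (exp (birkhoff_sum f \<phi> (t x) x)) \<le> w a" if xW: "x \<in> W" for x
    proof -
      obtain a where a: "a \<in> S" "x \<in> J a" using xW by (auto simp: inducing_domain_def)
      have tx: "t x = \<tau> a" by (rule inducing_time_eq[OF a])
      have "(SOME x. x \<in> J a) \<in> J a" using a(2) by (rule someI)
      then have "nm a = itin f ?p (t x) x"
        unfolding nm_def tx by (intro compatible_itin_eq[OF P(2,4)] a)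
      moreover have "ennreal (exp (birkhoff_sum f \<phi> (t x) x)) \<le> w a"
        unfolding w_def by (rule SUP_upper2[OF a(2)]) (simp add: induced_potential_def birkhoff_sum_def)
      ultimately show ?thesis using a(1) by blast
    qed
    show "(\<integral>\<^sup>+a. w a * ennreal (exp (- \<rho>' * real (length (nm a)))) \<partial>count_space S) < \<infinity>"
      using weighted_series_finite[OF fin \<kappa>(1) \<rho>'(1)] by (simp add: w_def nm_def)
  qed
  then obtain C where "\<And>n. code_entropy \<mu> (itin f ?p n) \<le> (\<rho> - (\<integral>x. \<psi> x \<partial>\<mu>)) * real n + C"
    by auto
  then show ?thesis by (rule ks_entropy_le[OF prob_space_axioms s f d P(1-3)])
qed

end

theorem theoremB:
  fixes f :: "'a::metric_space \<Rightarrow> 'a"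
    and S :: "'i set" and J :: "'i \<Rightarrow> 'a set" and \<tau> :: "'i \<Rightarrow> nat"
    and P :: "'a set set" and \<phi> :: "'a \<Rightarrow> real" and \<mu> :: "'a measure"
  assumes "compact (UNIV :: 'a set)"
    and "f \<in> borel_measurable borel"
    and "variational_entropy f < \<infinity>"
    and "inducing_scheme f S J \<tau>"
    and L1: "finite P" "measurable_partition P" "generating f P" "compatible_partition f S J \<tau> P"
    and L2: "finite_complexity S J \<tau> (induced_potential f S J \<tau> \<phi>)"
    and "\<mu> \<in> ergodic_measures borel f"
    and "emeasure \<mu> (inducing_domain S J) > 0"
    and "\<phi> \<in> borel_measurable (completion \<mu>)"
    and "complexity S J \<tau> (induced_potential f S J \<tau> \<phi>) < pressure f \<phi> \<mu>"
    and "pressure f \<phi> \<mu> < \<infinity>"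
  shows "\<mu> \<in> liftable_measures f S J \<tau>"
proof (rule ccontr)
  assume not_liftable: "\<mu> \<notin> liftable_measures f S J \<tau>"
  interpret inducing_scheme f S J \<tau> by fact
  note \<mu> = \<open>\<mu> \<in> ergodic_measures borel f\<close> and pos = \<open>emeasure \<mu> W > 0\<close>
  have nonrec: "induced_system.block_freq \<mu> W t F \<longlonglongrightarrow> 0"
    using liftable_if_recurrent[OF assms(1) \<mu> pos] not_liftable by blast
  let ?K = "complexity S J \<tau> (induced_potential f S J \<tau> \<phi>)"
  let ?I = "extended_integral (completion \<mu>) \<phi>"
  have fin: "ks_entropy f \<mu> \<noteq> \<infinity>" "?I \<noteq> \<infinity>"
    using \<open>pressure f \<phi> \<mu> < \<infinity>\<close> by (auto simp: pressure_def)
  \<comment> \<open>With finite entropy, an integral of \<open>-\<infinity>\<close> would make the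
    pressure \<open>-\<infinity>\<close>, which cannot exceed the complexity.\<close>
  have "?I \<noteq> - \<infinity>"
  proof
    assume "?I = - \<infinity>"
    then have "pressure f \<phi> \<mu> = - \<infinity>" using fin(1) by (cases "ks_entropy f \<mu>") (auto simp: pressure_def)
    then show False using \<open>?K < pressure f \<phi> \<mu>\<close> by simp
  qed
  with fin(2) obtain \<psi> where \<psi>: "integrable \<mu> \<psi>" "AE x in \<mu>. \<phi> x = \<psi> x" "?I = ereal (\<integral>x. \<psi> x \<partial>\<mu>)"
    using extended_integral_finite[OF \<open>\<phi> \<in> borel_measurable (completion \<mu>)\<close>] by metis
  \<comment> \<open>Two numbers fit into the strict gap: \<kappa> bounds the growth of the weights,
    and \<rho> becomes an upper bound for the pressure although it lies below it.\<close>
  obtain \<rho> where \<rho>: "?K < ereal \<rho>" "ereal \<rho> < pressure f \<phi> \<mu>"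
    using ereal_dense2[OF \<open>?K < pressure f \<phi> \<mu>\<close>] by blast
  obtain \<kappa> where \<kappa>: "?K < ereal \<kappa>" "ereal \<kappa> < ereal \<rho>" using ereal_dense2[OF \<rho>(1)] by blast
  have "ks_entropy f \<mu> \<le> ereal (\<rho> - (\<integral>x. \<psi> x \<partial>\<mu>))"
    using \<kappa>(2) by (intro ks_entropy_le_complexity[OF \<mu> pos nonrec L1 L2 \<kappa>(1) _ \<psi>(1,2)]) simp
  then have "pressure f \<phi> \<mu> \<le> ereal (\<rho> - (\<integral>x. \<psi> x \<partial>\<mu>)) + ereal (\<integral>x. \<psi> x \<partial>\<mu>)"
    unfolding pressure_def \<psi>(3) by (rule add_right_mono)
  with \<rho>(2) show False by simp
qed

end
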